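(* Let $1<p<\infty$, let $f_+\in H_p^+\setminus\{0\}$, and let $Q$ be an outer function which is bounded away from zero and satisfies $Qf_+\in H_p^+$. Let $\mathcal D_Q=\{\phi_+\in H_p^+: Q\phi_+\in L_p\}$. Then $$K_{\min}^Q(f_+)=K_{\min}(f_+)\cap\mathcal D_Q .$$
   Context: $L_p=L^p(\mathbb R)$; $H_p^+=H^p(\mathbb C^+)$ and $H_p^-=\overline{H_p^+}=H^p(\mathbb C^-)$, identified with closed subspaces of $L_p$ via boundary values. For a measurable $g$ on $\mathbb R$ for which there exists $\phi\in H_p^+\setminus\{0\}$ with $g\phi\in L_p$, the (possibly unbounded) Toeplitz operator $T_g$ has domain $D(T_g)=\{\phi_+\in H_p^+: g\phi_+\in L_p\}$ and $T_g\phi_+=P^+(g\phi_+)$, $P^+$ being the projection of $L_p$ onto $H_p^+$ parallel to $H_p^-$; thus $\ker T_g=\{\phi_+\in H_p^+: g\phi_+\in H_p^-\}$. "Outer function" for $Q$ is meant in the general (Smirnov class) sense: $Q(\xi)=c\exp\left(\frac{1}{i\pi}\int_{\mathbb R}\frac{\log W(t)}{1+t^2}\frac{1+t\xi}{t-\xi}\,dt\right)$ with $|c|=1$, $W=|Q|$ and $\int_{\mathbb R}\frac{|\log W(t)|}{1+t^2}dt<\infty$. $K_{\min}(f_+)$ is the smallest kernel containing $f_+$ among kernels of Toeplitz operators on $H_p^+$ with bounded symbol; it is known that it exists and equals $\ker T_{\overline{I_+}\,\overline{O_+}/O_+}$, where $f_+=I_+O_+$ is an inner-outer factorization. $\sigma_Q$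 is the class of measurable symbols $h$ such that $|h|<c|Q|$ a.e. for some constant $c>0$. $K_{\min}^Q(f_+)$ is the smallest kernel containing $f_+$ among kernels $\ker T_h$ with $h\in\sigma_Q$; it exists and equals $\ker T_{\overline Q\,\overline{I_+}\,\overline{O_+}/O_+}$. *)

theory Defs
  imports "HOL-Analysis.Analysis"
begin

text \<open>
  Elements of \<open>L\<^sub>p\<close> are represented by functions on the real line rather than by classes of functions.
  All sets of functions below are closed under almost everywhere equality, so an equality between
  two of them is the same as the equality of the corresponding sets of classes.
\<close>

definition Lp :: "real \<Rightarrow> (real \<Rightarrow> complex) set" where
  "Lp p = {f \<in> borel_measurable lebesgue. integrable lebesgue (\<lambda>x. norm (f x) powr p)}"

definition uhp :: "complex set" where
  "uhp = {z. Im z > 0}"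

definition hardy_hol :: "real \<Rightarrow> (complex \<Rightarrow> complex) set" where
  "hardy_hol p = {F. F holomorphic_on uhp \<and>
     (\<exists>C. \<forall>y>0. (\<lambda>x. F (Complex x y)) \<in> Lp p \<and>
        (LINT x|lebesgue. norm (F (Complex x y)) powr p) \<le> C)}"

text \<open>Nontangential limits almost everywhere, through cones of every aperture.\<close>

definition boundary_fun :: "(complex \<Rightarrow> complex) \<Rightarrow> (real \<Rightarrow> complex) \<Rightarrow> bool" where
  "boundary_fun F f \<longleftrightarrow> (AE x in lebesgue. \<forall>a>0.
     (F \<longlongrightarrow> f x) (at (of_real x) within {z \<in> uhp. \<bar>Re z - x\<bar> < a * Im z}))"

definition Hp_plus :: "real \<Rightarrow> (real \<Rightarrow> complex) set" where
  "Hp_plus p = {f \<in> Lp p. \<exists>F \<in> hardy_hol p. boundary_fun F f}"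

definition Hp_minus :: "real \<Rightarrow> (real \<Rightarrow> complex) set" where
  "Hp_minus p = (\<lambda>f x. cnj (f x)) ` Hp_plus p"

definition nonzero_fun :: "(real \<Rightarrow> complex) \<Rightarrow> bool" where
  "nonzero_fun f \<longleftrightarrow> \<not> (AE x in lebesgue. f x = 0)"

definition toeplitz_symbol :: "real \<Rightarrow> (real \<Rightarrow> complex) \<Rightarrow> bool" where
  "toeplitz_symbol p g \<longleftrightarrow> g \<in> borel_measurable lebesgue \<and>
     (\<exists>\<phi> \<in> Hp_plus p. nonzero_fun \<phi> \<and> (\<lambda>x. g x * \<phi> x) \<in> Lp p)"

definition toeplitz_dom :: "real \<Rightarrow> (real \<Rightarrow> complex) \<Rightarrow> (real \<Rightarrow> complex) set" where
  "toeplitz_dom p g = {\<phi> \<in> Hp_plus p. (\<lambda>x. g x * \<phi> x) \<in> Lp p}"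

text \<open>
  \<open>riesz_proj p u v\<close> says that \<open>v\<close> is the image of \<open>u\<close> under the projection of \<open>L\<^sub>p\<close> onto the
  Hardy space of the upper half-plane parallel to that of the lower half-plane. It is a relation
  because \<open>v\<close> is only determined almost everywhere.
\<close>

definition riesz_proj :: "real \<Rightarrow> (real \<Rightarrow> complex) \<Rightarrow> (real \<Rightarrow> complex) \<Rightarrow> bool" where
  "riesz_proj p u v \<longleftrightarrow> u \<in> Lp p \<and> v \<in> Hp_plus p \<and> (\<lambda>x. u x - v x) \<in> Hp_minus p"

definition toeplitz :: "real \<Rightarrow> (real \<Rightarrow> complex) \<Rightarrow> (real \<Rightarrow> complex) \<Rightarrow> (real \<Rightarrow> complex) \<Rightarrow> bool" where
  "toeplitz p g \<phi> \<psi> \<longleftrightarrow> \<phi> \<in> toeplitz_dom p g \<and> riesz_proj p (\<lambda>x. g x * \<phi> x) \<psi>"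

definition toeplitz_ker :: "real \<Rightarrow> (real \<Rightarrow> complex) \<Rightarrow> (real \<Rightarrow> complex) set" where
  "toeplitz_ker p g = {\<phi>. toeplitz p g \<phi> (\<lambda>x. 0)}"

lemma zero_in_Hp_plus: "(\<lambda>x. 0) \<in> Hp_plus p"
proof -
  have L: "(\<lambda>x. 0) \<in> Lp p"
    by (simp add: Lp_def)
  moreover have "(\<lambda>z. 0) \<in> hardy_hol p"
    using L by (auto simp: hardy_hol_def)
  moreover have "boundary_fun (\<lambda>z. 0) (\<lambda>x. 0)"
    by (simp add: boundary_fun_def)
  ultimately show ?thesis
    unfolding Hp_plus_def by blast
qed

lemma Hp_minus_subset_Lp: "Hp_minus p \<subseteq> Lp p"
  by (auto simp: Hp_minus_def Hp_plus_def Lp_def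
      intro!: borel_measurable_continuous_on[of cnj] continuous_intros)

lemma toeplitz_ker_eq:
  "toeplitz_ker p g = {\<phi> \<in> Hp_plus p. (\<lambda>x. g x * \<phi> x) \<in> Hp_minus p}"
  using zero_in_Hp_plus Hp_minus_subset_Lp
  by (auto simp: toeplitz_ker_def toeplitz_def toeplitz_dom_def riesz_proj_def)

text \<open>
  Outer functions in the sense of the Smirnov class. An outer function is represented by its
  boundary function \<open>Q\<close> on the real line, with \<open>W = \<bar>Q\<bar>\<close>. Since \<open>ln 0 = 0\<close> in HOL, the condition
  \<open>Q \<noteq> 0\<close> a.e. that is implicit in the integrability of \<open>log W\<close> has to be stated.
\<close>

definition outer_ext :: "complex \<Rightarrow> (real \<Rightarrow> real) \<Rightarrow> complex \<Rightarrow> complex" where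
  "outer_ext c W \<xi> = c * exp (1 / (\<i> * of_real pi) *
     (LINT t|lebesgue. of_real (ln (W t) / (1 + t\<^sup>2)) *
        ((1 + of_real t * \<xi>) / (of_real t - \<xi>))))"

definition outer_fun :: "(real \<Rightarrow> complex) \<Rightarrow> bool" where
  "outer_fun Q \<longleftrightarrow> Q \<in> borel_measurable lebesgue \<and>
     (AE t in lebesgue. Q t \<noteq> 0) \<and>
     integrable lebesgue (\<lambda>t. \<bar>ln (norm (Q t))\<bar> / (1 + t\<^sup>2)) \<and>
     (\<exists>c. norm c = 1 \<and> boundary_fun (outer_ext c (\<lambda>t. norm (Q t))) Q)"

definition bounded_away_from_zero :: "(real \<Rightarrow> complex) \<Rightarrow> bool" where
  "bounded_away_from_zero Q \<longleftrightarrow> (\<exists>\<delta>>0. AE x in lebesgue. \<delta> \<le> norm (Q x))"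

definition bounded_symbols :: "(real \<Rightarrow> complex) set" where
  "bounded_symbols = {g \<in> borel_measurable lebesgue. \<exists>C. AE x in lebesgue. norm (g x) \<le> C}"

definition sigma_symbols :: "(real \<Rightarrow> complex) \<Rightarrow> (real \<Rightarrow> complex) set" where
  "sigma_symbols Q = {h \<in> borel_measurable lebesgue.
     \<exists>c>0. AE x in lebesgue. norm (h x) < c * norm (Q x)}"

definition toeplitz_kernels :: "real \<Rightarrow> (real \<Rightarrow> complex) set \<Rightarrow> (real \<Rightarrow> complex) set set" where
  "toeplitz_kernels p S = {toeplitz_ker p g | g. g \<in> S \<and> toeplitz_symbol p g}"

text \<open>\<^const>\<open>Least\<close> is taken here with respect to inclusion of sets of functions.\<close>

definition K_min :: "real \<Rightarrow> (real \<Rightarrow> complex) \<Rightarrow> (real \<Rightarrow> complex) set" where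
  "K_min p f = (LEAST K. K \<in> toeplitz_kernels p bounded_symbols \<and> f \<in> K)"

definition K_min_Q :: "real \<Rightarrow> (real \<Rightarrow> complex) \<Rightarrow> (real \<Rightarrow> complex) \<Rightarrow> (real \<Rightarrow> complex) set" where
  "K_min_Q p Q f = (LEAST K. K \<in> toeplitz_kernels p (sigma_symbols Q) \<and> f \<in> K)"

definition D_class :: "real \<Rightarrow> (real \<Rightarrow> complex) \<Rightarrow> (real \<Rightarrow> complex) set" where
  "D_class p Q = {\<phi> \<in> Hp_plus p. (\<lambda>x. Q x * \<phi> x) \<in> Lp p}"

end

theory Submission
  imports Defs "HOL-Complex_Analysis.Complex_Analysis"
begin

text \<open>
  Let \<open>E\<close> be the outer function with boundary values \<open>e\<close>, \<open>\<bar>e\<bar> = \<bar>f\<bar>\<close>, and \<open>g = cnj e / f\<close>, a unimodular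
  symbol. If \<open>h f\<close> and \<open>g \<phi>\<close> are the conjugates of \<open>\<psi>\<close> and \<open>\<eta>\<close> in \<open>H\<^sub>p\<^sup>+\<close>, then \<open>h \<phi>\<close> is the conjugate of
  \<open>\<psi> \<eta> / e\<close>, which by Smirnov's theorem lies in \<open>H\<^sub>p\<^sup>+\<close> as soon as it lies in \<open>L\<^sub>p\<close>. Hence \<open>ker T\<^sub>g\<close> is minimal
  for bounded symbols. Since \<open>\<bar>g\<bar> = 1\<close>, multiplication and division by \<open>Q\<close> in the Smirnov class show
  that \<open>ker T\<close> for the symbol \<open>cnj Q g\<close> is \<open>ker T\<^sub>g \<inter> D\<^sub>Q\<close>, and the same computation makes it
  minimal for symbols dominated by \<open>Q\<close>.

  The analytic input is the inequality \<open>ln \<bar>F\<bar> \<le> P[ln \<bar>f\<bar>]\<close> between a function and the Poisson integral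
  of its boundary values, and Fatou's theorem for bounded functions, which gives the boundary
  values of \<open>E\<close>. For the latter, a primitive of the function is Lipschitz, so its boundary values are
  differentiable almost everywhere.
\<close>

section \<open>The Poisson kernel\<close>

text \<open>The symbol \<open>g\<close> is the known one, \<open>cnj I * cnj O / O\<close> for
  \<open>f = I * O\<close>, rewritten: with \<open>e\<close> as the outer factor and
  \<open>\<bar>e\<bar> = \<bar>f\<bar>\<close> it equals \<open>cnj e / f\<close>. In this form the
  inner factor never has to be constructed, and the divisions that must preserve analyticity are by
  outer functions only. The obstacle is that products and quotients of Hardy functions leave the
  Hardy space. The work is therefore done in a class defined by the inequality between
  \<open>ln \<bar>F\<bar>\<close> and the Poisson integral of \<open>ln \<bar>f\<bar>\<close>: it
  adds up under products, it survives division when the denominator satisfies it with equality, and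
  together with membership in \<open>Lp\<close> it gives back the Hardy space by Jensen's
  inequality. Hardy functions enter this class by a.e. boundary limits and uniform bounds on
  horizontal lines; no norm convergence to the boundary values is used. An outer function with
  arbitrary integrable log-modulus is a quotient of two functions bounded by 1, which is why Fatou's
  theorem for bounded functions is enough.\<close>

lemma borel_measurable_lebesgue: "f \<in> borel_measurable borel \<Longrightarrow> f \<in> borel_measurable lebesgue"
  by (simp add: measurable_completion)

lemma integrable_inverse_1_plus_sq: "integrable lebesgue (\<lambda>t::real. 1 / (1 + t\<^sup>2))"
  and integral_inverse_1_plus_sq: "(LINT t|lebesgue. 1 / (1 + t\<^sup>2 :: real)) = pi"
proof -
  have A: "set_integrable lborel (einterval (-\<infinity>) \<infinity>) (\<lambda>x::real. 1 / (1 + x\<^sup>2))"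
    and B: "(LBINT x=-\<infinity>..\<infinity>. 1 / (1 + x\<^sup>2 :: real)) = pi / 2 - (- (pi/2))"
    by (rule interval_integral_FTC_nonneg[where F = arctan and A = "- (pi/2)" and B = "pi/2"];
        (auto intro!: derivative_eq_intros continuous_intros simp: ereal_tendsto_simps tendsto_arctan_at_top
          tendsto_arctan_at_bot add_nonneg_eq_0_iff inverse_eq_divide)[1])+
  have "integrable lborel (\<lambda>t::real. 1 / (1 + t\<^sup>2))"
    using A by (simp add: set_integrable_def einterval_eq)
  then show "integrable lebesgue (\<lambda>t::real. 1 / (1 + t\<^sup>2))"
    by (simp add: integrable_completion)
  show "(LINT t|lebesgue. 1 / (1 + t\<^sup>2 :: real)) = pi"
    using B by (simp add: integral_completion interval_lebesgue_integral_def set_lebesgue_integral_def einterval_eq)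
qed

definition poisson_kernel :: "complex \<Rightarrow> real \<Rightarrow> real" where
  "poisson_kernel z t = Im z / (pi * ((Re z - t)\<^sup>2 + (Im z)\<^sup>2))"

definition poisson :: "(real \<Rightarrow> real) \<Rightarrow> complex \<Rightarrow> real" where
  "poisson w z = (LINT t|lebesgue. poisson_kernel z t * w t)"

text \<open>The weight is pi times the kernel at \<open>\<i>\<close>. It is comparable with the
  kernel at every point of the half-plane, so this one condition decides integrability against all
  of them.\<close>

abbreviation poisson_integrable :: "(real \<Rightarrow> real) \<Rightarrow> bool" where
  "poisson_integrable w \<equiv> integrable lebesgue (\<lambda>t. w t / (1 + t\<^sup>2))"

lemma one_plus_sq_pos [simp]: "0 < 1 + (t::real)\<^sup>2" "1 + (t::real)\<^sup>2 \<noteq> 0"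
  by (auto simp: add_pos_nonneg pos_add_strict power2_eq_square add_nonneg_eq_0_iff)

lemma poisson_kernel_measurable [measurable]: "poisson_kernel z \<in> borel_measurable borel"
  unfolding poisson_kernel_def by measurable

lemma poisson_kernel_measurable_lebesgue [measurable]: "poisson_kernel z \<in> borel_measurable lebesgue"
  by (rule borel_measurable_lebesgue) measurable

lemma poisson_kernel_denom_pos: "z \<in> uhp \<Longrightarrow> 0 < (Re z - t)\<^sup>2 + (Im z)\<^sup>2"
  by (auto simp: uhp_def intro!: add_nonneg_pos)

lemma poisson_kernel_pos: "z \<in> uhp \<Longrightarrow> 0 < poisson_kernel z t"
  using poisson_kernel_denom_pos[of z t] by (auto simp: poisson_kernel_def uhp_def)

lemma poisson_kernel_nonneg: "z \<in> uhp \<Longrightarrow> 0 \<le> poisson_kernel z t"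
  using poisson_kernel_pos less_imp_le by blast

lemma poisson_kernel_upper:
  assumes "z \<in> uhp"
  obtains C where "C > 0" "\<And>t. poisson_kernel z t \<le> C / (1 + t\<^sup>2)"
proof -
  define x y where "x = Re z" and "y = Im z"
  have y: "y > 0" using assms by (simp add: uhp_def y_def)
  \<comment> \<open>Expanding \<open>0 \<le> (t - 2 * x)^2\<close> gives
    \<open>1 + t^2 \<le> 2 * (x - t)^2 + 2 * x^2 + 1\<close>; the constant part is written as a
    multiple of \<open>y^2\<close> and absorbed by the denominator of the kernel.\<close>
  define K where "K = 2 + (2 * x\<^sup>2 + 1) / y\<^sup>2"
  have K: "K > 0" by (auto simp: K_def intro!: add_pos_nonneg)
  have *: "1 + t\<^sup>2 \<le> K * ((x - t)\<^sup>2 + y\<^sup>2)" for t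
  proof -
    have "0 \<le> (t - 2 * x)\<^sup>2" by simp
    then have "1 + t\<^sup>2 \<le> 2 * (x - t)\<^sup>2 + 2 * x\<^sup>2 + 1"
      by (simp add: power2_eq_square algebra_simps)
    also have "\<dots> \<le> 2 * ((x - t)\<^sup>2 + y\<^sup>2) + (2 * x\<^sup>2 + 1) / y\<^sup>2 * y\<^sup>2"
      using y by simp
    also have "\<dots> \<le> 2 * ((x - t)\<^sup>2 + y\<^sup>2) + (2 * x\<^sup>2 + 1) / y\<^sup>2 * ((x - t)\<^sup>2 + y\<^sup>2)"
      by (intro add_mono mult_left_mono) auto
    finally show ?thesis by (simp add: K_def algebra_simps)
  qed
  have "poisson_kernel z t \<le> (y * K / pi) / (1 + t\<^sup>2)" for t
  proof -
    have d: "0 < (x - t)\<^sup>2 + y\<^sup>2" using y by (simp add: add_nonneg_pos)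
    have "y / ((x - t)\<^sup>2 + y\<^sup>2) \<le> y * K / (1 + t\<^sup>2)"
    proof -
      have "y * (1 + t\<^sup>2) \<le> y * K * ((x - t)\<^sup>2 + y\<^sup>2)"
        using mult_left_mono[OF *[of t], of y] y by (simp only: mult.assoc less_imp_le)
      then show ?thesis
        using d one_plus_sq_pos(1)[of t] by (simp only: divide_le_eq pos_le_divide_eq times_divide_eq_left if_True)
    qed
    then have "(1 / pi) * (y / ((x - t)\<^sup>2 + y\<^sup>2)) \<le> (1 / pi) * (y * K / (1 + t\<^sup>2))"
      by (rule mult_left_mono) simp
    then show ?thesis
      unfolding poisson_kernel_def x_def[symmetric] y_def[symmetric] by (simp add: mult.commute)
  qed
  moreover have "y * K / pi > 0" using y K by simp
  ultimately show ?thesis using that by blast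
qed

lemma poisson_kernel_lower:
  assumes "z \<in> uhp"
  obtains c where "c > 0" "\<And>t. c / (1 + t\<^sup>2) \<le> poisson_kernel z t"
proof -
  define x y where "x = Re z" and "y = Im z"
  have y: "y > 0" using assms by (simp add: uhp_def y_def)
  define K where "K = 2 + 2 * x\<^sup>2 + y\<^sup>2"
  have K: "K > 0" by (auto simp: K_def intro!: add_pos_nonneg)
  have *: "(x - t)\<^sup>2 + y\<^sup>2 \<le> K * (1 + t\<^sup>2)" for t
  proof -
    have "0 \<le> (t + x)\<^sup>2" by simp
    then have "(x - t)\<^sup>2 + y\<^sup>2 \<le> 2 * x\<^sup>2 + 2 * t\<^sup>2 + y\<^sup>2"
      by (simp add: power2_eq_square algebra_simps)
    also have "\<dots> \<le> K * (1 + t\<^sup>2)"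
      by (simp add: K_def algebra_simps)
    finally show ?thesis .
  qed
  have "(y / (K * pi)) / (1 + t\<^sup>2) \<le> poisson_kernel z t" for t
  proof -
    have d: "0 < (x - t)\<^sup>2 + y\<^sup>2" using y by (simp add: add_nonneg_pos)
    have "y / (K * (1 + t\<^sup>2)) \<le> y / ((x - t)\<^sup>2 + y\<^sup>2)"
      using * y d K by (intro divide_left_mono mult_pos_pos) auto
    then have "(1 / pi) * (y / (K * (1 + t\<^sup>2))) \<le> (1 / pi) * (y / ((x - t)\<^sup>2 + y\<^sup>2))"
      by (rule mult_left_mono) simp
    then show ?thesis
      unfolding poisson_kernel_def x_def[symmetric] y_def[symmetric] by (simp add: mult_ac)
  qed
  moreover have "y / (K * pi) > 0" using y K by simp
  ultimately show ?thesis using that by blast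
qed

lemma poisson_integrable_measurable:
  assumes "poisson_integrable w" shows "w \<in> borel_measurable lebesgue"
proof -
  have "(\<lambda>t. (1 + t\<^sup>2) * (w t / (1 + t\<^sup>2))) \<in> borel_measurable lebesgue"
    by (rule borel_measurable_times[OF borel_measurable_lebesgue])
       (use assms in \<open>auto simp: borel_measurable_integrable\<close>)
  then show ?thesis by simp
qed

lemma poisson_integrableD:
  assumes "poisson_integrable w" "z \<in> uhp"
  shows "integrable lebesgue (\<lambda>t. poisson_kernel z t * w t)"
proof -
  obtain C where C: "C > 0" "\<And>t. poisson_kernel z t \<le> C / (1 + t\<^sup>2)"
    using poisson_kernel_upper assms(2) by blast
  have [measurable]: "w \<in> borel_measurable lebesgue"
    using assms(1) by (rule poisson_integrable_measurable)
  show ?thesis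
  proof (rule Bochner_Integration.integrable_bound)
    show "integrable lebesgue (\<lambda>t. C * (w t / (1 + t\<^sup>2)))"
      by (rule integrable_mult_right) (rule assms(1))
    show "AE t in lebesgue. norm (poisson_kernel z t * w t) \<le> norm (C * (w t / (1 + t\<^sup>2)))"
    proof (rule AE_I2)
      fix t
      show "norm (poisson_kernel z t * w t) \<le> norm (C * (w t / (1 + t\<^sup>2)))"
        using mult_right_mono[OF C(2)[of t], of "\<bar>w t\<bar>"] poisson_kernel_nonneg[OF assms(2), of t] C(1)
        by (simp add: abs_mult)
    qed
  qed measurable
qed

lemma poisson_integrableI:
  assumes "integrable lebesgue (\<lambda>t. poisson_kernel z t * w t)" "z \<in> uhp"
  shows "poisson_integrable w"
proof -
  obtain c where c: "c > 0" "\<And>t. c / (1 + t\<^sup>2) \<le> poisson_kernel z t"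
    using poisson_kernel_lower assms(2) by blast
  have "(\<lambda>t. (poisson_kernel z t * w t) / (poisson_kernel z t)) \<in> borel_measurable lebesgue"
    by (rule borel_measurable_divide) (use assms(1) in auto)
  then have [measurable]: "w \<in> borel_measurable lebesgue"
    using poisson_kernel_pos[OF assms(2)] by (simp add: less_imp_neq[THEN not_sym])
  have [measurable]: "(\<lambda>t::real. 1 + t\<^sup>2) \<in> borel_measurable lebesgue"
    by (rule borel_measurable_lebesgue) measurable
  show ?thesis
  proof (rule Bochner_Integration.integrable_bound)
    show "integrable lebesgue (\<lambda>t. (1/c) * (poisson_kernel z t * w t))" using assms(1) by simp
    show "AE t in lebesgue. norm (w t / (1 + t\<^sup>2)) \<le> norm ((1/c) * (poisson_kernel z t * w t))"
    proof (rule AE_I2)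
      fix t
      have "c * (\<bar>w t\<bar> / (1 + t\<^sup>2)) \<le> poisson_kernel z t * \<bar>w t\<bar>"
        using mult_right_mono[OF c(2)[of t], of "\<bar>w t\<bar>"] by simp
      then have "\<bar>w t\<bar> / (1 + t\<^sup>2) \<le> (poisson_kernel z t * \<bar>w t\<bar>) / c"
        using c(1) by (simp add: field_simps)
      then show "norm (w t / (1 + t\<^sup>2)) \<le> norm ((1/c) * (poisson_kernel z t * w t))"
        using poisson_kernel_nonneg[OF assms(2), of t] c(1)
        by (simp add: abs_mult)
    qed
  qed measurable
qed

lemma poisson_kernel_integrable: "z \<in> uhp \<Longrightarrow> integrable lebesgue (poisson_kernel z)"
  using poisson_integrableD[of "\<lambda>_. 1" z] integrable_inverse_1_plus_sq by simp

lemma poisson_kernel_integral: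
  assumes "z \<in> uhp" shows "(LINT t|lebesgue. poisson_kernel z t) = 1"
proof -
  have y: "Im z > 0" using assms by (simp add: uhp_def)
  have eq: "pi * poisson_kernel z (Re z + Im z * t) * Im z = 1 / (1 + t\<^sup>2)" for t
  proof -
    have "(Re z - (Re z + Im z * t))\<^sup>2 + (Im z)\<^sup>2 = (Im z)\<^sup>2 * (1 + t\<^sup>2)"
      by (simp add: power2_eq_square algebra_simps)
    then show ?thesis
      using y by (simp add: poisson_kernel_def power2_eq_square)
  qed
  have "(LINT t|lborel. poisson_kernel z t) = \<bar>Im z\<bar> *\<^sub>R (LINT t|lborel. poisson_kernel z (Re z + Im z * t))"
    using y by (intro lborel_integral_real_affine) auto
  also have "\<dots> = (1/pi) * (LINT t|lborel. pi * poisson_kernel z (Re z + Im z * t) * Im z)"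
    using y by (simp add: mult_ac)
  also have "\<dots> = (1/pi) * (LINT t|lborel. 1 / (1 + t\<^sup>2))"
    by (subst eq) simp
  also have "\<dots> = 1"
    using integral_inverse_1_plus_sq by (simp add: integral_completion)
  finally show ?thesis by (simp add: integral_completion)
qed

lemma poisson_const: "z \<in> uhp \<Longrightarrow> poisson (\<lambda>_. c) z = c"
  by (simp add: poisson_def poisson_kernel_integral)

lemma poisson_mono:
  assumes "poisson_integrable u" "poisson_integrable v" "z \<in> uhp" "AE t in lebesgue. u t \<le> v t"
  shows "poisson u z \<le> poisson v z"
  unfolding poisson_def
  by (intro integral_mono_AE poisson_integrableD assms)
     (use assms(4) poisson_kernel_nonneg[OF assms(3)] in \<open>auto elim!: eventually_mono intro: mult_left_mono\<close>)

lemma poisson_cong_AE: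
  assumes "u \<in> borel_measurable lebesgue" "v \<in> borel_measurable lebesgue" "AE t in lebesgue. u t = v t"
  shows "poisson u z = poisson v z"
  unfolding poisson_def
  by (intro integral_cong_AE) (use assms in \<open>auto elim!: eventually_mono\<close>)

lemma poisson_add:
  assumes "poisson_integrable u" "poisson_integrable v" "z \<in> uhp"
  shows "poisson (\<lambda>t. u t + v t) z = poisson u z + poisson v z"
  using assms by (simp add: poisson_def distrib_left poisson_integrableD)

lemma poisson_diff:
  assumes "poisson_integrable u" "poisson_integrable v" "z \<in> uhp"
  shows "poisson (\<lambda>t. u t - v t) z = poisson u z - poisson v z"
  using assms by (simp add: poisson_def right_diff_distrib poisson_integrableD)

lemma poisson_cmult: "poisson (\<lambda>t. c * u t) z = c * poisson u z"
  by (simp add: poisson_def mult.left_commute)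

lemma poisson_uminus: "poisson (\<lambda>t. - u t) z = - poisson u z"
  by (simp add: poisson_def)

lemma poisson_integrable_bounded:
  assumes "w \<in> borel_measurable lebesgue" "\<And>t. \<bar>w t\<bar> \<le> M"
  shows "poisson_integrable w"
proof (rule Bochner_Integration.integrable_bound)
  show "integrable lebesgue (\<lambda>t::real. M * (1 / (1 + t\<^sup>2)))"
    by (rule integrable_mult_right) (rule integrable_inverse_1_plus_sq)
  have "(\<lambda>t::real. 1 / (1 + t\<^sup>2)) \<in> borel_measurable lebesgue"
    using integrable_inverse_1_plus_sq by auto
  from borel_measurable_times[OF assms(1) this]
  show "(\<lambda>t. w t / (1 + t\<^sup>2)) \<in> borel_measurable lebesgue" by simp
  show "AE t in lebesgue. norm (w t / (1 + t\<^sup>2)) \<le> norm (M * (1 / (1 + t\<^sup>2)))"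
    using assms(2) by (auto intro!: divide_right_mono order_trans[OF assms(2)])
qed

text \<open>The exponential is handled by its tangent line at the mean value.\<close>

lemma exp_poisson_le:
  assumes "poisson_integrable u" "poisson_integrable (\<lambda>t. exp (u t))" "z \<in> uhp"
  shows "exp (poisson u z) \<le> poisson (\<lambda>t. exp (u t)) z"
proof -
  define m where "m = poisson u z"
  have i1: "poisson_integrable (\<lambda>t. 1 - m)"
    by (rule poisson_integrable_bounded[where M = "\<bar>1 - m\<bar>"]) auto
  have i2: "poisson_integrable (\<lambda>t. (1 - m) + u t)"
    using Bochner_Integration.integrable_add[OF i1 assms(1)] by (simp add: add_divide_distrib)
  have i3: "poisson_integrable (\<lambda>t. exp m * ((1 - m) + u t))"
    using integrable_mult_right[OF i2, of "exp m"] by simp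
  have "poisson (\<lambda>t. exp m * ((1 - m) + u t)) z \<le> poisson (\<lambda>t. exp (u t)) z"
  proof (rule poisson_mono[OF i3 assms(2,3)], rule AE_I2)
    fix t
    have "(1 - m) + u t \<le> exp (u t - m)"
      using exp_ge_add_one_self[of "u t - m"] by linarith
    then have "exp m * ((1 - m) + u t) \<le> exp m * exp (u t - m)"
      by (intro mult_left_mono) auto
    also have "\<dots> = exp (u t)" by (simp flip: exp_add)
    finally show "exp m * ((1 - m) + u t) \<le> exp (u t)" .
  qed
  moreover have "poisson (\<lambda>t. exp m * ((1 - m) + u t)) z = exp m"
    using poisson_add[OF i1 assms(1,3)] by (simp add: poisson_cmult poisson_const assms(3) m_def)
  ultimately show ?thesis by (simp add: m_def)
qed

text \<open>Away from the point \<open>x\<close> the kernel is dominated by a small multiple of the kernel at \<open>x + \<i> r\<close>.\<close>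

lemma poisson_near_const:
  assumes w: "w \<in> borel_measurable lebesgue" "\<And>t. \<bar>w t\<bar> \<le> M"
    and near: "\<And>t. \<bar>t - x\<bar> < r \<Longrightarrow> \<bar>w t - c\<bar> \<le> \<eta>" and r: "0 < r"
    and z: "z \<in> uhp" "\<bar>Re z - x\<bar> < r / 2"
  shows "\<bar>poisson w z - c\<bar> \<le> \<eta> + (M + \<bar>c\<bar>) * (8 * Im z / r)"
proof -
  define z' where "z' = Complex x r"
  have z': "z' \<in> uhp" using r by (simp add: z'_def uhp_def)
  have y: "Im z > 0" using z by (simp add: uhp_def)
  have M: "M \<ge> 0" using w(2)[of 0] by linarith
  have eta: "\<eta> \<ge> 0" using near[of x] r by fastforce
  \<comment> \<open>Since \<open>t\<close> is at least \<open>\<bar>t - x\<bar> / 2\<close> away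
    from \<open>Re z\<close>, squaring costs a factor 4; replacing \<open>r^2\<close> by
    \<open>(t - x)^2\<close> costs another 2. The numerators contribute
    \<open>Im z / r\<close>.\<close>
  have far: "poisson_kernel z t \<le> (8 * Im z / r) * poisson_kernel z' t" if "\<bar>t - x\<bar> \<ge> r" for t
  proof -
    have "\<bar>t - x\<bar> \<le> \<bar>Re z - t\<bar> + \<bar>Re z - x\<bar>" by linarith
    moreover have "a / 2 \<le> b" if "a \<le> b + c" "c < r / 2" "r \<le> a" for a b c :: real
      using that by linarith
    ultimately have d: "\<bar>Re z - t\<bar> \<ge> \<bar>t - x\<bar> / 2" using z(2) that by blast
    have "(\<bar>t - x\<bar> / 2)\<^sup>2 \<le> \<bar>Re z - t\<bar>\<^sup>2" by (rule power_mono[OF d]) simp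
    then have "(t - x)\<^sup>2 \<le> 4 * (Re z - t)\<^sup>2" by (simp add: power_divide)
    moreover have "r\<^sup>2 \<le> \<bar>t - x\<bar>\<^sup>2" using that r by (intro power_mono) auto
    moreover have "a + b \<le> 8 * (c + d)" if "a \<le> 4 * c" "b \<le> a" "0 \<le> d" for a b c d :: real
      using that by (simp add: distrib_left)
    ultimately have "(x - t)\<^sup>2 + r\<^sup>2 \<le> 8 * ((Re z - t)\<^sup>2 + (Im z)\<^sup>2)"
      unfolding power2_commute[of x t] power2_abs using zero_le_power2 by blast
    moreover have "0 < (x - t)\<^sup>2 + r\<^sup>2" "0 < (Re z - t)\<^sup>2 + (Im z)\<^sup>2"
      using r y by (auto intro: add_nonneg_pos)
    moreover have "Im z / B \<le> Im z * (8 / A)" if "A \<le> 8 * B" "0 < A" "0 < B" for A B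
      using mult_left_mono[OF that(1), of "Im z"] that y by (simp add: field_simps)
    ultimately have "Im z / ((Re z - t)\<^sup>2 + (Im z)\<^sup>2) \<le> Im z * (8 / ((x - t)\<^sup>2 + r\<^sup>2))"
      by blast
    then have "1 / pi * (Im z / ((Re z - t)\<^sup>2 + (Im z)\<^sup>2)) \<le> 1 / pi * (Im z * (8 / ((x - t)\<^sup>2 + r\<^sup>2)))"
      by (rule mult_left_mono) simp
    then show ?thesis
      using r by (simp add: poisson_kernel_def z'_def mult_ac)
  qed
  have pi: "poisson_integrable w" using poisson_integrable_bounded w by blast
  have pc: "poisson_integrable (\<lambda>_. c)" by (rule poisson_integrable_bounded[where M = "\<bar>c\<bar>"]) auto
  have pd: "poisson_integrable (\<lambda>t. w t - c)"
    using Bochner_Integration.integrable_diff[OF pi pc] by (simp add: diff_divide_distrib)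
  have "\<bar>poisson w z - c\<bar> = \<bar>poisson (\<lambda>t. w t - c) z\<bar>"
    using poisson_diff[OF pi pc z(1)] by (simp add: poisson_const z)
  also have "\<dots> \<le> (LINT t|lebesgue. \<bar>poisson_kernel z t * (w t - c)\<bar>)"
    unfolding poisson_def by (rule integral_abs_bound)
  \<comment> \<open>The line is not split: the sum of the near bound and the far bound dominates the
    integrand everywhere, and both kernels have integral 1.\<close>
  also have "\<dots> \<le> (LINT t|lebesgue. \<eta> * poisson_kernel z t + (M + \<bar>c\<bar>) * (8 * Im z / r) * poisson_kernel z' t)"
  proof (rule integral_mono)
    show "integrable lebesgue (\<lambda>t. \<bar>poisson_kernel z t * (w t - c)\<bar>)"
      using poisson_integrableD[OF pd z(1)] by simp
    show "integrable lebesgue (\<lambda>t. \<eta> * poisson_kernel z t + (M + \<bar>c\<bar>) * (8 * Im z / r) * poisson_kernel z' t)"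
      using poisson_kernel_integrable z z' by simp
    fix t
    have pz: "0 \<le> poisson_kernel z t" "0 \<le> poisson_kernel z' t" using poisson_kernel_nonneg z z' by auto
    show "\<bar>poisson_kernel z t * (w t - c)\<bar> \<le> \<eta> * poisson_kernel z t + (M + \<bar>c\<bar>) * (8 * Im z / r) * poisson_kernel z' t"
    proof (cases "\<bar>t - x\<bar> < r")
      case True
      have "\<bar>poisson_kernel z t * (w t - c)\<bar> \<le> \<eta> * poisson_kernel z t"
        using mult_right_mono[OF near[OF True] pz(1)] pz(1) by (simp add: abs_mult mult.commute)
      moreover have "0 \<le> (M + \<bar>c\<bar>) * (8 * Im z / r) * poisson_kernel z' t" using M y r pz by simp
      ultimately show ?thesis by linarith
    next
      case False
      have "\<bar>w t - c\<bar> \<le> M + \<bar>c\<bar>" using w(2)[of t] by linarith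
      then have "\<bar>poisson_kernel z t * (w t - c)\<bar> \<le> ((8 * Im z / r) * poisson_kernel z' t) * (M + \<bar>c\<bar>)"
        unfolding abs_mult using far False pz y r by (intro mult_mono) auto
      moreover have "0 \<le> \<eta> * poisson_kernel z t" using eta pz by simp
      ultimately show ?thesis by (simp add: mult_ac)
    qed
  qed
  also have "\<dots> = \<eta> + (M + \<bar>c\<bar>) * (8 * Im z / r)"
    using poisson_kernel_integrable z z' poisson_kernel_integral by simp
  finally show ?thesis .
qed

lemma poisson_tendsto:
  assumes w: "w \<in> borel_measurable lebesgue" "\<And>t. \<bar>w t\<bar> \<le> M" and c: "isCont w x"
  shows "(poisson w \<longlongrightarrow> w x) (at (of_real x) within uhp)"
proof (rule tendstoI)
  fix e :: real assume e: "e > 0"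
  have M: "M \<ge> 0" using w(2)[of 0] by linarith
  obtain r where r: "r > 0" "\<And>t. \<bar>t - x\<bar> < r \<Longrightarrow> \<bar>w t - w x\<bar> < e / 2"
    using c e unfolding continuous_at_eps_delta dist_real_def by (metis half_gt_zero)
  \<comment> \<open>With the factor 8 of \<open>poisson_near_const\<close>, the 32 leaves
    \<open>e / 4\<close> for the far part and \<open>3 * e / 4\<close> in total.
    \<open>M + M + 1\<close> bounds \<open>M + \<bar>w x\<bar>\<close> and is never 0.\<close>
  define d where "d = min (r/2) (e * r / (32 * (M + M + 1)))"
  have d: "d > 0" using r e M by (simp add: d_def)
  have "dist (poisson w z) (w x) < e" if z: "z \<in> uhp" "dist z (of_real x) < d" for z
  proof -
    have nz: "norm (z - of_real x) < d" using z(2) by (simp add: dist_norm)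
    have "\<bar>Re z - x\<bar> < d" using abs_Re_le_cmod[of "z - of_real x"] nz by simp
    moreover have y: "\<bar>Im z\<bar> < d" using abs_Im_le_cmod[of "z - of_real x"] nz by simp
    moreover have "\<bar>poisson w z - w x\<bar> \<le> e / 2 + (M + \<bar>w x\<bar>) * (8 * Im z / r)"
      by (rule poisson_near_const[OF w]) (use r z calculation in \<open>auto simp: d_def less_imp_le\<close>)
    moreover have "(M + \<bar>w x\<bar>) * (8 * Im z / r) \<le> (M + M + 1) * (8 * (e * r / (32 * (M + M + 1))) / r)"
      using y w(2)[of x] r M z by (intro mult_mono divide_right_mono) (auto simp: d_def uhp_def)
    moreover have "K * (8 * (e * r / (32 * K)) / r) = e / 4" if "K > 0" for K
      using r that by (simp add: field_simps)
    from this[of "M + M + 1"] have "(M + M + 1) * (8 * (e * r / (32 * (M + M + 1))) / r) = e / 4"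
      using M by simp
    ultimately show ?thesis using e by (simp add: dist_real_def)
  qed
  then show "\<forall>\<^sub>F z in at (of_real x) within uhp. dist (poisson w z) (w x) < e"
    unfolding eventually_at using d by blast
qed

section \<open>Schwarz integrals and the maximum principle\<close>

lemma open_uhp [simp]: "open uhp"
  unfolding uhp_def by (rule open_halfspace_Im_gt)

lemma convex_uhp: "convex uhp"
  unfolding uhp_def by (rule convex_halfspace_Im_gt)

text \<open>The holomorphic completion of the Poisson integral. With the weight included, the kernel
  is \<open>1 / (t - z) - t / (1 + t^2)\<close>: the Cauchy kernel with the subtraction that makes
  the integral converge for every \<open>poisson_integrable\<close> function.\<close>

definition schwarz :: "(real \<Rightarrow> real) \<Rightarrow> complex \<Rightarrow> complex" where
  "schwarz w z = 1 / (\<i> * of_real pi) *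
     (LINT t|lebesgue. of_real (w t / (1 + t\<^sup>2)) * ((1 + of_real t * z) / (of_real t - z)))"

lemma outer_ext_schwarz: "outer_ext c W z = c * exp (schwarz (\<lambda>t. ln (W t)) z)"
  by (simp add: outer_ext_def schwarz_def)

lemma uhp_neq_real: "z \<in> uhp \<Longrightarrow> of_real t - z \<noteq> 0"
  by (auto simp: uhp_def complex_eq_iff)

lemma norm_real_minus: "(norm (of_real t - z))\<^sup>2 = (Re z - t)\<^sup>2 + (Im z)\<^sup>2"
  by (simp add: cmod_power2 power2_commute)

lemma Im_le_norm_real_minus: "Im z \<le> norm (of_real t - z)"
  using abs_Im_le_cmod[of "of_real t - z"] by simp

lemma schwarz_kernel_Im:
  assumes "z \<in> uhp"
  shows "Im ((1 + of_real t * z) / (of_real t - z)) = pi * poisson_kernel z t * (1 + t\<^sup>2)"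
proof -
  have "Im ((1 + of_real t * z) / (of_real t - z)) =
      Im ((1 + of_real t * z) * cnj (of_real t - z)) / (norm (of_real t - z))\<^sup>2"
    by (subst complex_div_cnj) simp
  also have "Im ((1 + of_real t * z) * cnj (of_real t - z)) = Im z * (1 + t\<^sup>2)"
    by (simp add: algebra_simps power2_eq_square)
  finally show ?thesis
    by (simp add: norm_real_minus poisson_kernel_def)
qed

lemma schwarz_kernel_bound:
  assumes "z \<in> uhp"
  shows "norm ((1 + of_real t * z) / (of_real t - z)) \<le> norm z + norm (1 + z\<^sup>2) / Im z"
proof -
  have "(1 + of_real t * z) / (of_real t - z) = z + (1 + z\<^sup>2) / (of_real t - z)"
    using uhp_neq_real[OF assms, of t] by (simp add: field_simps power2_eq_square)
  then have "norm ((1 + of_real t * z) / (of_real t - z)) \<le> norm z + norm (1 + z\<^sup>2) / norm (of_real t - z)"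
    by (metis norm_triangle_ineq norm_divide)
  also have "\<dots> \<le> norm z + norm (1 + z\<^sup>2) / Im z"
    using assms Im_le_norm_real_minus[of z t]
    by (intro add_left_mono divide_left_mono mult_pos_pos) (auto simp: uhp_def)
  finally show ?thesis .
qed

lemma integrable_mult_bounded:
  fixes k :: "real \<Rightarrow> complex" and w :: "real \<Rightarrow> real"
  assumes "integrable lebesgue w" "k \<in> borel_measurable lebesgue" "\<And>t. norm (k t) \<le> B"
  shows "integrable lebesgue (\<lambda>t. of_real (w t) * k t)"
proof (rule Bochner_Integration.integrable_bound)
  show "integrable lebesgue (\<lambda>t. B * w t)" by (rule integrable_mult_right) (rule assms(1))
  have [measurable]: "w \<in> borel_measurable lebesgue" "k \<in> borel_measurable lebesgue" using assms by auto
  show "(\<lambda>t. of_real (w t) * k t) \<in> borel_measurable lebesgue" by measurable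
  have "norm (w t) * norm (k t) \<le> \<bar>w t\<bar> * \<bar>B\<bar>" for t
    using assms(3)[of t] by (intro mult_mono) auto
  then show "AE t in lebesgue. norm (of_real (w t) * k t) \<le> norm (B * w t)"
    by (auto simp: norm_mult abs_mult mult.commute)
qed

lemma schwarz_kernel_measurable [measurable]:
  "(\<lambda>t. (1 + of_real t * z) / (of_real t - z)) \<in> borel_measurable lebesgue" for z :: complex
  by (rule borel_measurable_lebesgue) measurable

lemma schwarz_integrable:
  assumes "poisson_integrable w" "z \<in> uhp"
  shows "integrable lebesgue (\<lambda>t. complex_of_real (w t / (1 + t\<^sup>2)) * ((1 + of_real t * z) / (of_real t - z)))"
  by (rule integrable_mult_bounded[OF assms(1) schwarz_kernel_measurable schwarz_kernel_bound[OF assms(2)]])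

lemma Re_schwarz:
  assumes "poisson_integrable w" "z \<in> uhp"
  shows "Re (schwarz w z) = poisson w z"
proof -
  define I where "I = (LINT t|lebesgue. complex_of_real (w t / (1 + t\<^sup>2)) * ((1 + of_real t * z) / (of_real t - z)))"
  have "Re (schwarz w z) = Im I / pi"
    unfolding schwarz_def I_def[symmetric] by (simp add: Re_divide field_simps power2_eq_square)
  also have "Im I = (LINT t|lebesgue. Im (complex_of_real (w t / (1 + t\<^sup>2)) * ((1 + of_real t * z) / (of_real t - z))))"
    unfolding I_def by (rule integral_Im[symmetric]) (rule schwarz_integrable[OF assms])
  also have "\<dots> = (LINT t|lebesgue. pi * (poisson_kernel z t * w t))"
    by (intro Bochner_Integration.integral_cong refl)
      (simp add: schwarz_kernel_Im[OF assms(2)] del: of_real_divide times_divide_eq_right)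
  also have "\<dots> = pi * poisson w z" by (simp add: poisson_def)
  finally show ?thesis by simp
qed

text \<open>The difference quotient of the kernel in \<open>z\<close> is exactly
  \<open>L z t\<close>. It is bounded in \<open>t\<close> uniformly for \<open>z\<close> within
  \<open>Im z0 / 2\<close> of \<open>z0\<close>, because \<open>t\<close> is then at least half as
  far from \<open>z\<close> as from \<open>z0\<close>. Dominated convergence is about sequences,
  hence the sequential form of the limit.\<close>

lemma schwarz_has_derivative:
  assumes w: "poisson_integrable w" and z0: "z0 \<in> uhp"
  shows "\<exists>D. (schwarz w has_field_derivative D) (at z0)"
proof -
  define L where "L z t = (1 + (complex_of_real t)\<^sup>2) / ((of_real t - z) * (of_real t - z0))" for z t
  define D where "D = 1 / (\<i> * of_real pi) * (LINT t|lebesgue. of_real (w t / (1 + t\<^sup>2)) * L z0 t)"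
  have y0: "Im z0 > 0" using z0 by (simp add: uhp_def)
  obtain C where C: "C > 0" "\<And>t. poisson_kernel z0 t \<le> C / (1 + t\<^sup>2)"
    using poisson_kernel_upper z0 by blast
  have Lm [measurable]: "L z \<in> borel_measurable lebesgue" for z
    unfolding L_def by (rule borel_measurable_lebesgue) measurable
  have Lb: "norm (L z t) \<le> 2 * pi * C / Im z0" if z: "norm (z - z0) \<le> Im z0 / 2" for z t
  proof -
    have n0: "norm (of_real t - z0) > 0" using uhp_neq_real[OF z0] by simp
    have "norm (of_real t - z0) \<le> norm (of_real t - z) + norm (z - z0)"
      using norm_triangle_ineq[of "of_real t - z" "z - z0"] by simp
    then have h: "norm (of_real t - z0) / 2 \<le> norm (of_real t - z)"
      using z Im_le_norm_real_minus[of z0 t] by linarith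
    have "1 + (complex_of_real t)\<^sup>2 = of_real (1 + t\<^sup>2)" by simp
    then have n1: "norm (1 + (complex_of_real t)\<^sup>2) = 1 + t\<^sup>2"
      using one_plus_sq_pos(1)[of t] by (simp only: norm_of_real abs_of_pos)
    have "norm (L z t) = (1 + t\<^sup>2) / (norm (of_real t - z) * norm (of_real t - z0))"
      unfolding L_def norm_divide n1 norm_mult ..
    also have "\<dots> \<le> (1 + t\<^sup>2) / ((norm (of_real t - z0) / 2) * norm (of_real t - z0))"
      using h n0 one_plus_sq_pos(1)[of t] by (intro divide_left_mono mult_right_mono mult_pos_pos) (auto intro: less_le_trans)
    also have "\<dots> = 2 * pi / Im z0 * ((1 + t\<^sup>2) * poisson_kernel z0 t)"
    proof -
      have "A / ((n / 2) * n) = 2 * pi / y * (A * (y / (pi * n\<^sup>2)))" if "y > 0" "n > 0" for A n y :: real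
        using that by (simp add: field_simps power2_eq_square)
      then show ?thesis
        unfolding poisson_kernel_def norm_real_minus[symmetric] using y0 n0 by blast
    qed
    also have "\<dots> \<le> 2 * pi / Im z0 * C"
      using C(2)[of t] one_plus_sq_pos(1)[of t] y0
      by (intro mult_left_mono) (auto simp: pos_le_divide_eq mult.commute)
    finally show ?thesis by simp
  qed
  have quot: "(schwarz w z - schwarz w z0) / (z - z0) =
      1 / (\<i> * of_real pi) * (LINT t|lebesgue. of_real (w t / (1 + t\<^sup>2)) * L z t)"
    if z: "z \<in> uhp" "z \<noteq> z0" for z
  proof -
    have e: "(1 + of_real t * z) / (of_real t - z) - (1 + of_real t * z0) / (of_real t - z0) = (z - z0) * L z t" for t
      using uhp_neq_real[OF z(1), of t] uhp_neq_real[OF z0, of t]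
      by (simp add: L_def diff_frac_eq) (simp add: algebra_simps power2_eq_square)
    have "schwarz w z - schwarz w z0 = 1 / (\<i> * of_real pi) *
       (LINT t|lebesgue. of_real (w t / (1 + t\<^sup>2)) * ((1 + of_real t * z) / (of_real t - z))
           - of_real (w t / (1 + t\<^sup>2)) * ((1 + of_real t * z0) / (of_real t - z0)))"
      unfolding schwarz_def
      by (subst Bochner_Integration.integral_diff[OF schwarz_integrable[OF w z(1)] schwarz_integrable[OF w z0]])
         (rule right_diff_distrib[symmetric])
    also have "\<dots> = 1 / (\<i> * of_real pi) *
       (LINT t|lebesgue. (z - z0) * (of_real (w t / (1 + t\<^sup>2)) * L z t))"
      by (simp only: right_diff_distrib[symmetric] e mult.left_commute)
    also have "\<dots> = (z - z0) * (1 / (\<i> * of_real pi) * (LINT t|lebesgue. of_real (w t / (1 + t\<^sup>2)) * L z t))"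
      by (simp only: integral_mult_right_zero mult.left_commute)
    finally show ?thesis using z by simp
  qed
  have "((\<lambda>z. (schwarz w z - schwarz w z0) / (z - z0)) \<longlongrightarrow> D) (at z0)"
    unfolding tendsto_at_iff_sequentially
  proof (intro allI impI)
    fix X :: "nat \<Rightarrow> complex"
    assume X: "\<forall>i. X i \<in> UNIV - {z0}" "X \<longlonglongrightarrow> z0"
    have ev1: "\<forall>\<^sub>F n in sequentially. X n \<in> uhp"
      using X(2) z0 by (rule topological_tendstoD[OF _ open_uhp])
    have ev2: "\<forall>\<^sub>F n in sequentially. norm (X n - z0) \<le> Im z0 / 2"
      using tendstoD[OF X(2), of "Im z0 / 2"] y0 by (auto simp: dist_norm elim!: eventually_mono)
    obtain N where N: "\<And>n. n \<ge> N \<Longrightarrow> X n \<in> uhp \<and> norm (X n - z0) \<le> Im z0 / 2"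
      using eventually_conj[OF ev1 ev2] unfolding eventually_sequentially by blast
    have "(\<lambda>n. LINT t|lebesgue. complex_of_real (w t / (1 + t\<^sup>2)) * L (X (n + N)) t) \<longlonglongrightarrow>
          (LINT t|lebesgue. of_real (w t / (1 + t\<^sup>2)) * L z0 t)"
    proof (rule integral_dominated_convergence)
      have [measurable]: "(\<lambda>t. w t / (1 + t\<^sup>2)) \<in> borel_measurable lebesgue" using w by auto
      show "(\<lambda>t. of_real (w t / (1 + t\<^sup>2)) * L z0 t) \<in> borel_measurable lebesgue" by measurable
      show "(\<lambda>t. of_real (w t / (1 + t\<^sup>2)) * L (X (i + N)) t) \<in> borel_measurable lebesgue" for i by measurable
      show "integrable lebesgue (\<lambda>t. \<bar>w t / (1 + t\<^sup>2)\<bar> * (2 * pi * C / Im z0))"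
        by (intro integrable_mult_left integrable_abs w)
      show "AE t in lebesgue. (\<lambda>i. of_real (w t / (1 + t\<^sup>2)) * L (X (i + N)) t) \<longlonglongrightarrow> of_real (w t / (1 + t\<^sup>2)) * L z0 t"
        unfolding L_def
        by (intro AE_I2 tendsto_intros LIMSEQ_ignore_initial_segment X)
           (use uhp_neq_real[OF z0] in auto)
      show "AE t in lebesgue. norm (of_real (w t / (1 + t\<^sup>2)) * L (X (i + N)) t) \<le> \<bar>w t / (1 + t\<^sup>2)\<bar> * (2 * pi * C / Im z0)" for i
        using Lb N[of "i + N"] by (intro AE_I2) (simp only: norm_mult norm_of_real, intro mult_left_mono, auto)
    qed
    then have "(\<lambda>n. 1 / (\<i> * of_real pi) * (LINT t|lebesgue. of_real (w t / (1 + t\<^sup>2)) * L (X (n + N)) t)) \<longlonglongrightarrow> D"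
      unfolding D_def by (rule tendsto_mult_left)
    then have "(\<lambda>n. (schwarz w (X (n + N)) - schwarz w z0) / (X (n + N) - z0)) \<longlonglongrightarrow> D"
      by (subst quot) (use X(1) N in auto)
    then show "((\<lambda>z. (schwarz w z - schwarz w z0) / (z - z0)) \<circ> X) \<longlonglongrightarrow> D"
      by (simp add: comp_def LIMSEQ_offset)
  qed
  then show ?thesis unfolding has_field_derivative_iff by blast
qed

lemma schwarz_holomorphic: "poisson_integrable w \<Longrightarrow> schwarz w holomorphic_on uhp"
  using schwarz_has_derivative by (auto simp: holomorphic_on_open)

text \<open>At a level \<open>m > c\<close> the superlevel set of \<open>norm (S z)\<close> is
  compact inside the open half-plane: the bound near the real line keeps it off the boundary, the
  decay at infinity keeps it bounded. So the maximum is attained, \<open>S\<close> is constant, and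
  the decay contradicts this.\<close>

lemma uhp_max_principle:
  assumes hol: "S holomorphic_on uhp" and c: "c > 0"
    and bd: "\<And>x. \<forall>\<^sub>F z in at (complex_of_real x) within uhp. norm (S z) \<le> c"
    and inf: "\<And>e. e > 0 \<Longrightarrow> \<exists>R. \<forall>z\<in>uhp. norm z \<ge> R \<longrightarrow> norm (S z) < e"
    and z0: "z0 \<in> uhp"
  shows "norm (S z0) \<le> c"
proof (rule ccontr)
  assume "\<not> norm (S z0) \<le> c"
  define m where "m = norm (S z0)"
  have m: "m > c" "m > 0" using \<open>\<not> _\<close> c by (auto simp: m_def)
  define K where "K = {z \<in> uhp. m \<le> norm (S z)}"
  have cont: "continuous_on uhp S" using hol by (rule holomorphic_on_imp_continuous_on)
  obtain R where R: "\<And>z. z \<in> uhp \<Longrightarrow> norm z \<ge> R \<Longrightarrow> norm (S z) < m" using inf[OF m(2)] by blast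
  have "bounded K"
    unfolding bounded_iff K_def using R by (auto intro!: exI[of _ R]) (metis linorder_not_le nle_le)
  moreover have "closed K"
    unfolding closed_sequential_limits
  proof (intro allI impI)
    fix x l assume *: "(\<forall>n. x n \<in> K) \<and> x \<longlonglongrightarrow> l"
    then have xK: "\<And>n. x n \<in> uhp" "\<And>n. m \<le> norm (S (x n))" and l: "x \<longlonglongrightarrow> l" by (auto simp: K_def)
    have "Im l \<ge> 0"
      by (rule LIMSEQ_le_const[OF tendsto_Im[OF l]]) (use xK(1) in \<open>auto simp: uhp_def intro!: exI[of _ 0] less_imp_le\<close>)
    moreover have "Im l \<noteq> 0"
    proof
      assume "Im l = 0"
      then have lr: "l = of_real (Re l)" by (simp add: complex_eq_iff)
      have "filterlim x (at l within uhp) sequentially"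
        unfolding filterlim_at using l xK(1) \<open>Im l = 0\<close>
        by (auto simp: uhp_def intro!: always_eventually) (metis less_irrefl)
      then have "\<forall>\<^sub>F n in sequentially. norm (S (x n)) \<le> c"
        using eventually_compose_filterlim[OF bd[of "Re l"]] lr by simp
      then show False using xK(2) m(1) by (auto simp: eventually_sequentially) (metis le_refl not_le order_trans)
    qed
    ultimately have lu: "l \<in> uhp" by (simp add: uhp_def)
    have "(\<lambda>n. S (x n)) \<longlonglongrightarrow> S l"
      using cont xK(1) l lu by (rule_tac continuous_on_tendsto_compose) auto
    then have "m \<le> norm (S l)"
      by (intro LIMSEQ_le_const[OF tendsto_norm]) (use xK(2) in auto)
    with lu show "l \<in> K" by (simp add: K_def)
  qed
  ultimately have "compact K" by (simp add: compact_eq_bounded_closed)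
  moreover have "z0 \<in> K" using z0 by (simp add: K_def m_def)
  moreover have "continuous_on K (\<lambda>z. norm (S z))"
    by (intro continuous_on_norm continuous_on_subset[OF cont]) (auto simp: K_def)
  ultimately obtain z1 where z1: "z1 \<in> K" "\<And>z. z \<in> K \<Longrightarrow> norm (S z) \<le> norm (S z1)"
    using continuous_attains_sup[of K "\<lambda>z. norm (S z)"] by blast
  have max: "norm (S z) \<le> norm (S z1)" if "z \<in> uhp" for z
    using z1 that by (cases "z \<in> K") (auto simp: K_def)
  have "S constant_on uhp"
    using maximum_modulus_principle[OF hol open_uhp _ open_uhp order_refl, of z1] z1(1) max
    by (auto simp: K_def intro: convex_connected convex_uhp)
  then obtain v where v: "\<And>z. z \<in> uhp \<Longrightarrow> S z = v" by (auto simp: constant_on_def)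
  have "v = S z1" using v z1(1) by (simp add: K_def)
  define u where "u = Complex 0 (max 1 R)"
  have "u \<in> uhp" "norm u \<ge> R" by (auto simp: u_def uhp_def cmod_def)
  then have "norm (S u) < m" using R by blast
  then show False using v[OF \<open>u \<in> uhp\<close>] \<open>v = S z1\<close> z1(1) by (simp add: K_def)
qed

text \<open>Dividing the powers of the function by \<open>z + \<i>\<close> removes the point at infinity.\<close>

lemma uhp_max_principle_bounded:
  assumes hol: "R holomorphic_on uhp" and M: "\<And>z. z \<in> uhp \<Longrightarrow> norm (R z) \<le> M"
    and bd: "\<And>x. \<forall>\<^sub>F z in at (complex_of_real x) within uhp. norm (R z) \<le> 1"
    and z0: "z0 \<in> uhp"
  shows "norm (R z0) \<le> 1"
proof -
  have ni: "norm (z + \<i>) > 1" "z + \<i> \<noteq> 0" if "z \<in> uhp" for z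
  proof -
    show "norm (z + \<i>) > 1" using that abs_Im_le_cmod[of "z + \<i>"] by (simp add: uhp_def)
    then show "z + \<i> \<noteq> 0" by auto
  qed
  \<comment> \<open>The price of the divisor is the factor \<open>norm (z0 + \<i>)\<close>, the same
    for every \<open>n\<close>; the powers of a number above 1 would outgrow it.\<close>
  have *: "norm (R z0) ^ n \<le> norm (z0 + \<i>)" for n
  proof -
    have "norm (R z0 ^ n / (z0 + \<i>)) \<le> 1"
    proof (rule uhp_max_principle[OF _ _ _ _ z0])
      show "(\<lambda>z. R z ^ n / (z + \<i>)) holomorphic_on uhp"
        using ni by (intro holomorphic_intros hol) auto
      show "\<forall>\<^sub>F z in at (complex_of_real x) within uhp. norm (R z ^ n / (z + \<i>)) \<le> 1" for x
      proof -
        have "\<forall>\<^sub>F z in at (complex_of_real x) within uhp. z \<in> uhp"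
          by (simp add: eventually_at_filter)
        with bd[of x] show ?thesis
        proof eventually_elim
          case (elim z)
          then have "norm (R z) ^ n \<le> 1" by (simp add: power_le_one)
          with ni(1)[OF elim(2)] have "norm (R z) ^ n \<le> norm (z + \<i>)" by linarith
          then show ?case using ni[OF elim(2)] by (simp add: norm_divide norm_power divide_le_eq_1)
        qed
      qed
      fix e :: real assume e: "e > 0"
      have M0: "M \<ge> 0" using M[OF z0] norm_ge_zero order_trans by blast
      have "norm (R z ^ n / (z + \<i>)) < e" if z: "z \<in> uhp" "norm z \<ge> M ^ n / e + 2" for z
      proof -
        have "norm z \<le> norm (z + \<i>) + 1" using norm_triangle_ineq4[of "z + \<i>" \<i>] by simp
        then have g: "M ^ n / e < norm (z + \<i>)" using z(2) by linarith
        have "norm (R z) ^ n \<le> M ^ n" by (intro power_mono M z) auto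
        also have "\<dots> < e * norm (z + \<i>)" using g e by (simp add: divide_less_eq mult.commute)
        finally show ?thesis using ni[OF z(1)] by (simp add: norm_divide norm_power divide_less_eq mult.commute)
      qed
      then show "\<exists>B. \<forall>z\<in>uhp. norm z \<ge> B \<longrightarrow> norm (R z ^ n / (z + \<i>)) < e" by blast
    qed simp
    then show ?thesis using ni[OF z0] by (simp add: norm_divide norm_power divide_le_eq_1)
  qed
  show ?thesis
  proof (rule ccontr)
    assume "\<not> norm (R z0) \<le> 1"
    then obtain n where "norm (z0 + \<i>) < norm (R z0) ^ n" using real_arch_pow[of "norm (R z0)"] by auto
    with *[of n] show False by simp
  qed
qed

lemma closure_uhp_real: "complex_of_real x \<in> closure uhp"
  and uhp_subset_closure: "uhp \<subseteq> closure uhp"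
proof -
  have "\<exists>y\<in>uhp. dist y (complex_of_real x) < e" if "e > 0" for e
    using that by (intro bexI[of _ "Complex x (e/2)"]) (auto simp: uhp_def dist_norm cmod_def)
  then show "complex_of_real x \<in> closure uhp" by (simp add: closure_approachable)
qed (rule closure_subset)

text \<open>The quotient by the outer function of boundary modulus \<open>\<bar>F\<bar> + \<delta>\<close> has boundary values
  of modulus less than 1.\<close>

lemma poisson_log_bounded:
  assumes hol: "F holomorphic_on uhp" and cont: "continuous_on (closure uhp) F"
    and M: "\<And>z. z \<in> closure uhp \<Longrightarrow> norm (F z) \<le> M"
    and \<delta>: "\<delta> > 0" and z: "z \<in> uhp"
  shows "norm (F z) \<le> exp (poisson (\<lambda>t. ln (norm (F (of_real t)) + \<delta>)) z)"
proof -
  \<comment> \<open>Adding \<open>\<delta>\<close> keeps \<open>w\<close> bounded and continuous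
    even at zeros of \<open>F\<close>, and makes the boundary limit of the quotient strictly less
    than 1, so that the limit yields a bound in a whole neighbourhood.\<close>
  define w where "w t = ln (norm (F (complex_of_real t)) + \<delta>)" for t
  have ct: "continuous_on UNIV (\<lambda>t. F (complex_of_real t))"
    by (rule continuous_on_compose2[OF cont]) (auto intro: continuous_intros closure_uhp_real)
  have pos: "norm (F (complex_of_real t)) + \<delta> > 0" for t using \<delta> by (simp add: add_nonneg_pos)
  have cw: "continuous_on UNIV w" unfolding w_def
    by (intro continuous_intros ct) (use pos in \<open>metis less_irrefl\<close>)
  have wm: "w \<in> borel_measurable lebesgue"
    by (intro borel_measurable_lebesgue borel_measurable_continuous_onI cw)
  have wl: "ln \<delta> \<le> w t" and wu: "w t \<le> ln (M + \<delta>)" for t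
    using \<delta> pos[of t] M[OF closure_uhp_real, of t] by (auto simp: w_def add_nonneg_pos intro!: ln_mono)
  define B where "B = \<bar>ln \<delta>\<bar> + \<bar>ln (M + \<delta>)\<bar>"
  have wb: "\<bar>w t\<bar> \<le> B" for t using wl[of t] wu[of t] by (simp add: B_def)
  have pw: "poisson_integrable w" using poisson_integrable_bounded[OF wm wb] .
  define R where "R z = F z / exp (schwarz w z)" for z
  have nR: "norm (R z) = norm (F z) / exp (poisson w z)" if "z \<in> uhp" for z
    using that by (simp add: R_def norm_divide Re_schwarz pw)
  have pi_const: "poisson_integrable (\<lambda>_. ln \<delta>)" by (rule poisson_integrable_bounded[where M = "\<bar>ln \<delta>\<bar>"]) auto
  have "norm (R z) \<le> 1"
  proof (rule uhp_max_principle_bounded[OF _ _ _ z])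
    show "R holomorphic_on uhp" unfolding R_def
      by (intro holomorphic_intros hol schwarz_holomorphic pw) auto
    show "norm (R z) \<le> M / \<delta>" if "z \<in> uhp" for z
    proof -
      have "poisson (\<lambda>_. ln \<delta>) z \<le> poisson w z"
        by (rule poisson_mono[OF pi_const pw that]) (use wl in auto)
      then have "exp (ln \<delta>) \<le> exp (poisson w z)" by (simp add: poisson_const that)
      then have "\<delta> \<le> exp (poisson w z)" using \<delta> by simp
      moreover have "norm (F z) \<le> M" using M uhp_subset_closure that by blast
      ultimately show ?thesis unfolding nR[OF that] using \<delta> by (intro frac_le) (auto intro: order_trans[OF norm_ge_zero])
    qed
    fix x
    have "(poisson w \<longlongrightarrow> w x) (at (of_real x) within uhp)"
      by (rule poisson_tendsto[OF wm wb]) (use cw in \<open>simp add: continuous_on_eq_continuous_at\<close>)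
    moreover have "(F \<longlongrightarrow> F (of_real x)) (at (of_real x) within uhp)"
      using cont closure_uhp_real[of x] uhp_subset_closure
      by (meson continuous_on_def tendsto_within_subset)
    ultimately have "((\<lambda>z. norm (F z) / exp (poisson w z)) \<longlongrightarrow> norm (F (of_real x)) / exp (w x)) (at (of_real x) within uhp)"
      by (intro tendsto_intros) auto
    moreover have "norm (F (of_real x)) / exp (w x) < 1"
      using pos[of x] \<delta> by (simp add: w_def)
    ultimately have "\<forall>\<^sub>F z in at (of_real x) within uhp. norm (F z) / exp (poisson w z) < 1"
      by (rule order_tendstoD(2))
    moreover have "\<forall>\<^sub>F z in at (complex_of_real x) within uhp. z \<in> uhp"
      by (simp add: eventually_at_filter)
    ultimately show "\<forall>\<^sub>F z in at (complex_of_real x) within uhp. norm (R z) \<le> 1"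
      by eventually_elim (simp add: nR)
  qed
  then show ?thesis unfolding nR[OF z] w_def by simp
qed

section \<open>Logarithmic majorants\<close>

text \<open>The vertical approach lies in every cone; reducing it to a sequence is what
  measurability and dominated convergence ask for.\<close>

lemma boundary_fun_vertical:
  assumes "boundary_fun F f"
  shows "AE x in lebesgue. (\<lambda>n. F (Complex x (1 / Suc n))) \<longlonglongrightarrow> f x"
  using assms unfolding boundary_fun_def
proof eventually_elim
  case (elim x)
  have "filterlim (\<lambda>n. Complex x (1 / Suc n)) (at (of_real x) within {z \<in> uhp. \<bar>Re z - x\<bar> < 1 * Im z}) sequentially"
    unfolding filterlim_at
  proof
    have "(\<lambda>n. Complex x (1 / Suc n)) \<longlonglongrightarrow> Complex x 0"
      by (intro tendsto_Complex tendsto_const LIMSEQ_Suc lim_1_over_n)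
    then show "(\<lambda>n. Complex x (1 / Suc n)) \<longlonglongrightarrow> of_real x"
      by (simp add: complex_of_real_def)
  qed (auto simp: uhp_def complex_eq_iff)
  moreover have "(F \<longlongrightarrow> f x) (at (of_real x) within {z \<in> uhp. \<bar>Re z - x\<bar> < 1 * Im z})"
    using elim zero_less_one by blast
  ultimately show ?case by (rule filterlim_compose[rotated])
qed

text \<open>The limit of the restrictions to horizontal lines is Borel; \<open>f\<close> agrees with
  it almost everywhere and inherits measurability because Lebesgue measure is complete.\<close>

lemma boundary_fun_measurable:
  assumes "F holomorphic_on uhp" "boundary_fun F f"
  shows "f \<in> borel_measurable lebesgue"
proof -
  have c: "continuous_on UNIV (\<lambda>x. F (Complex x (1 / Suc n)))" for n
    by (rule continuous_on_compose2[OF holomorphic_on_imp_continuous_on[OF assms(1)]])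
       (auto intro!: continuous_intros simp: uhp_def Complex_eq)
  define g where "g x = lim (\<lambda>n. F (Complex x (1 / Suc n)))" for x
  have [measurable]: "(\<lambda>x. F (Complex x (1 / Suc n))) \<in> borel_measurable borel" for n
    by (rule borel_measurable_continuous_onI[OF c])
  have "g \<in> borel_measurable borel"
    unfolding g_def by measurable
  moreover have "AE x in lebesgue. g x = f x"
    using boundary_fun_vertical[OF assms(2)] by eventually_elim (simp add: g_def limI)
  ultimately show ?thesis
    by (rule borel_measurable_AE[OF borel_measurable_lebesgue])
qed

text \<open>Truncation at \<open>M\<close> loses at most \<open>x / M\<close>. Integrated over a
  horizontal line this is of order \<open>1 / M\<close> uniformly in the height, so limits can be
  taken for the bounded truncations.\<close>

lemma ln_add_min_le:
  assumes "0 \<le> x" "0 < M" "0 < \<delta>"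
  shows "ln (x + \<delta>) \<le> ln (min x M + \<delta>) + x / (M::real)"
proof (cases "x \<le> M")
  case True
  then show ?thesis using assms by simp
next
  case False
  have "ln (x + \<delta>) - ln (M + \<delta>) = ln ((x + \<delta>) / (M + \<delta>))"
    using assms by (simp add: ln_div)
  also have "\<dots> \<le> (x + \<delta>) / (M + \<delta>) - 1"
    using assms by (intro ln_le_minus_one) simp
  also have "\<dots> = (x - M) / (M + \<delta>)"
    using assms by (simp add: field_simps)
  also have "\<dots> \<le> x / M"
    using assms False by (intro frac_le) auto
  finally show ?thesis using False by simp
qed

lemma abs_ln_add_le:
  fixes x :: real
  assumes "0 \<le> x" "0 < \<delta>"
  shows "\<bar>ln (x + \<delta>)\<bar> \<le> x + (\<bar>ln \<delta>\<bar> + \<delta>)"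
proof -
  have "ln (x + \<delta>) \<le> x + \<delta>" using assms ln_le_minus_one[of "x + \<delta>"] by simp
  moreover have "ln \<delta> \<le> ln (x + \<delta>)" using assms by simp
  ultimately show ?thesis using assms by linarith
qed

lemma poisson_integrable_const: "poisson_integrable (\<lambda>_. c)"
  by (rule poisson_integrable_bounded[where M = "\<bar>c\<bar>"]) auto

lemma poisson_integrable_add:
  assumes "poisson_integrable u" "poisson_integrable v"
  shows "poisson_integrable (\<lambda>t. u t + v t)"
  using Bochner_Integration.integrable_add[OF assms] by (simp add: add_divide_distrib)

lemma poisson_integrable_cmult:
  assumes "poisson_integrable u"
  shows "poisson_integrable (\<lambda>t. c * u t)"
  using integrable_mult_right[of c lebesgue "\<lambda>t. u t / (1 + t\<^sup>2)"] assms by simp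

lemma poisson_integrable_dominated:
  assumes "poisson_integrable v" "u \<in> borel_measurable lebesgue" "AE t in lebesgue. \<bar>u t\<bar> \<le> v t"
  shows "poisson_integrable u"
proof (rule Bochner_Integration.integrable_bound[OF assms(1)])
  have "(\<lambda>t::real. 1 / (1 + t\<^sup>2)) \<in> borel_measurable lebesgue"
    using integrable_inverse_1_plus_sq by auto
  from borel_measurable_times[OF assms(2) this]
  show "(\<lambda>t. u t / (1 + t\<^sup>2)) \<in> borel_measurable lebesgue" by simp
  show "AE t in lebesgue. norm (u t / (1 + t\<^sup>2)) \<le> norm (v t / (1 + t\<^sup>2))"
    using assms(3) by eventually_elim (auto intro!: divide_right_mono)
qed

lemma poisson_integrable_ln_add:
  assumes "poisson_integrable g" "\<And>t. 0 \<le> g t" "0 < \<delta>"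
  shows "poisson_integrable (\<lambda>t. ln (g t + \<delta>))"
proof (rule poisson_integrable_dominated)
  show "poisson_integrable (\<lambda>t. g t + (\<bar>ln \<delta>\<bar> + \<delta>))"
    by (intro poisson_integrable_add poisson_integrable_const assms)
  have [measurable]: "g \<in> borel_measurable lebesgue" using assms(1) by (rule poisson_integrable_measurable)
  show "(\<lambda>t. ln (g t + \<delta>)) \<in> borel_measurable lebesgue" by measurable
  show "AE t in lebesgue. \<bar>ln (g t + \<delta>)\<bar> \<le> g t + (\<bar>ln \<delta>\<bar> + \<delta>)"
    using abs_ln_add_le assms by auto
qed

text \<open>The common growth condition of Hardy functions and bounded functions. The first clause
  makes \<open>poisson_log_bounded\<close> applicable to vertical shifts of \<open>F\<close>; the
  second makes the error of truncation uniform in the height.\<close>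

definition shifts_bounded :: "(complex \<Rightarrow> complex) \<Rightarrow> bool" where
  "shifts_bounded F \<longleftrightarrow>
     (\<forall>y>0. \<exists>B. \<forall>z\<in>uhp. y \<le> Im z \<longrightarrow> norm (F z) \<le> B) \<and>
     (\<exists>C. \<forall>y>0. poisson_integrable (\<lambda>t. norm (F (Complex t y))) \<and>
        (LINT t|lebesgue. norm (F (Complex t y)) / (1 + t\<^sup>2)) \<le> C)"

lemma poisson_le_weighted:
  assumes "z \<in> uhp" "\<And>t. poisson_kernel z t \<le> C / (1 + t\<^sup>2)"
    and "poisson_integrable v" "\<And>t. 0 \<le> v t"
  shows "poisson v z \<le> C * (LINT t|lebesgue. v t / (1 + t\<^sup>2))"
proof -
  have "poisson v z \<le> (LINT t|lebesgue. C * (v t / (1 + t\<^sup>2)))"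
    unfolding poisson_def
  proof (rule integral_mono)
    show "integrable lebesgue (\<lambda>t. poisson_kernel z t * v t)" by (rule poisson_integrableD[OF assms(3,1)])
    show "integrable lebesgue (\<lambda>t. C * (v t / (1 + t\<^sup>2)))" by (rule integrable_mult_right) (rule assms(3))
    show "poisson_kernel z t * v t \<le> C * (v t / (1 + t\<^sup>2))" for t
      using mult_right_mono[OF assms(2,4)[of t]] by simp
  qed
  also have "\<dots> = C * (LINT t|lebesgue. v t / (1 + t\<^sup>2))" by (rule integral_mult_right_zero)
  finally show ?thesis .
qed

lemma holomorphic_shift:
  assumes "F holomorphic_on uhp" "0 \<le> y"
  shows "(\<lambda>u. F (u + Complex 0 y)) holomorphic_on uhp"
proof -
  have "(F \<circ> (\<lambda>u. u + Complex 0 y)) holomorphic_on uhp"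
  proof (rule holomorphic_on_compose_gen[OF _ assms(1)])
    show "(\<lambda>u. u + Complex 0 y) holomorphic_on uhp" by (intro holomorphic_intros)
  qed (use assms(2) in \<open>auto simp: uhp_def\<close>)
  then show ?thesis by (simp add: comp_def)
qed

lemma closure_uhp_Im: "z \<in> closure uhp \<Longrightarrow> 0 \<le> Im z"
proof -
  have "closure uhp \<subseteq> {z. Im z \<ge> 0}"
    by (rule closure_minimal) (auto simp: uhp_def closed_halfspace_Im_ge)
  then show "z \<in> closure uhp \<Longrightarrow> 0 \<le> Im z" by auto
qed

text \<open>Each shift of \<open>F\<close> satisfies the inequality with its own values on a
  horizontal line. Towards the boundary only a.e. convergence of these values is at hand, so their
  logarithms are cut at level \<open>M\<close>, where dominated convergence applies. The loss is at
  most \<open>Cz * C / M\<close>, with \<open>Cz\<close> from the kernel at \<open>z\<close> and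
  \<open>C\<close> from the means on lines, and vanishes as \<open>M\<close> grows.\<close>

lemma poisson_log_majorant_aux:
  assumes hol: "F holomorphic_on uhp" and sb: "shifts_bounded F" and bd: "boundary_fun F f"
    and pf: "poisson_integrable (\<lambda>t. norm (f t))" and \<delta>: "\<delta> > 0" and z: "z \<in> uhp"
  shows "norm (F z) \<le> exp (poisson (\<lambda>t. ln (norm (f t) + \<delta>)) z)"
proof -
  obtain Cz where Cz: "Cz > 0" "\<And>t. poisson_kernel z t \<le> Cz / (1 + t\<^sup>2)"
    using poisson_kernel_upper z by blast
  obtain C where C: "\<And>y. y > 0 \<Longrightarrow> poisson_integrable (\<lambda>t. norm (F (Complex t y)))"
     "\<And>y. y > 0 \<Longrightarrow> (LINT t|lebesgue. norm (F (Complex t y)) / (1 + t\<^sup>2)) \<le> C"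
    using sb unfolding shifts_bounded_def by blast
  have [measurable]: "f \<in> borel_measurable lebesgue" by (rule boundary_fun_measurable[OF hol bd])
  define y where "y n = 1 / real (Suc n)" for n
  have y: "y n > 0" for n by (simp add: y_def)
  have Fm [measurable]: "(\<lambda>t. norm (F (Complex t (y n)))) \<in> borel_measurable lebesgue" for n
    using poisson_integrable_measurable[OF C(1)[OF y]] .
  define w where "w M n t = ln (min (norm (F (Complex t (y n)))) M + \<delta>)" for M n t
  define w' where "w' M t = ln (min (norm (f t)) M + \<delta>)" for M t
  have min_bd: "\<bar>ln (min (norm a) M + \<delta>)\<bar> \<le> M + (\<bar>ln \<delta>\<bar> + \<delta>)" if "M > 0" for M and a :: complex
    using abs_ln_add_le[of "min (norm a) M" \<delta>] that \<delta> by auto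
  have w_meas [measurable]: "w M n \<in> borel_measurable lebesgue" "w' M \<in> borel_measurable lebesgue" for M n
    unfolding w_def w'_def by measurable
  have step: "norm (F (z + Complex 0 (y n))) \<le> exp (poisson (w M n) z + Cz * C / M)" if M: "M > 0" for M n
  proof -
    obtain B where B: "\<And>z. z \<in> uhp \<Longrightarrow> y n \<le> Im z \<Longrightarrow> norm (F z) \<le> B"
      using sb y[of n] unfolding shifts_bounded_def by blast
    have pF: "poisson_integrable (\<lambda>t. norm (F (Complex t (y n))))" by (rule C(1)[OF y])
    have cl: "u + Complex 0 (y n) \<in> uhp" if "u \<in> closure uhp" for u
      using closure_uhp_Im[OF that] y[of n] by (simp add: uhp_def)
    have "norm (F (z + Complex 0 (y n))) \<le> exp (poisson (\<lambda>t. ln (norm (F (complex_of_real t + Complex 0 (y n))) + \<delta>)) z)"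
    proof (rule poisson_log_bounded[where F = "\<lambda>u. F (u + Complex 0 (y n))", OF _ _ _ \<delta> z])
      show "(\<lambda>u. F (u + Complex 0 (y n))) holomorphic_on uhp"
        by (rule holomorphic_shift[OF hol less_imp_le[OF y]])
      show "continuous_on (closure uhp) (\<lambda>u. F (u + Complex 0 (y n)))"
        by (rule continuous_on_compose2[OF holomorphic_on_imp_continuous_on[OF hol]])
           (use cl in \<open>auto intro: continuous_intros\<close>)
      show "norm (F (u + Complex 0 (y n))) \<le> B" if "u \<in> closure uhp" for u
        using B[OF cl[OF that]] closure_uhp_Im[OF that] by simp
    qed
    also have "(\<lambda>t. ln (norm (F (complex_of_real t + Complex 0 (y n))) + \<delta>)) = (\<lambda>t. ln (norm (F (Complex t (y n))) + \<delta>))"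
      by (simp add: complex_of_real_def complex_add)
    also have "poisson \<dots> z \<le> poisson (\<lambda>t. w M n t + 1 / M * norm (F (Complex t (y n)))) z"
    proof (rule poisson_mono[OF _ _ z])
      show "poisson_integrable (\<lambda>t. ln (norm (F (Complex t (y n))) + \<delta>))"
        by (rule poisson_integrable_ln_add[OF pF _ \<delta>]) simp
      show "poisson_integrable (\<lambda>t. w M n t + 1 / M * norm (F (Complex t (y n))))"
        by (intro poisson_integrable_add poisson_integrable_cmult pF poisson_integrable_bounded[where M = "M + (\<bar>ln \<delta>\<bar> + \<delta>)"])
           (use min_bd M in \<open>auto simp: w_def\<close>, measurable)
      show "AE t in lebesgue. ln (norm (F (Complex t (y n))) + \<delta>) \<le> w M n t + 1 / M * norm (F (Complex t (y n)))"
        using ln_add_min_le[OF norm_ge_zero M \<delta>] by (auto simp: w_def)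
    qed
    also have "\<dots> = poisson (w M n) z + 1 / M * poisson (\<lambda>t. norm (F (Complex t (y n)))) z"
      by (subst poisson_add[OF _ poisson_integrable_cmult[OF pF] z])
         (use poisson_integrable_bounded[OF w_meas(1), of M n "M + (\<bar>ln \<delta>\<bar> + \<delta>)"] min_bd M in
          \<open>auto simp: w_def poisson_cmult[of "1 / M", simplified]\<close>)
    also have "\<dots> \<le> poisson (w M n) z + 1 / M * (Cz * C)"
      using Cz(1) M
      by (intro add_left_mono mult_left_mono order_trans[OF poisson_le_weighted[OF z Cz(2) pF]] C(2)[OF y]) auto
    finally show ?thesis by simp
  qed
  have "(\<lambda>n. norm (F (z + Complex 0 (y n)))) \<longlonglongrightarrow> norm (F z)"
  proof -
    have "(\<lambda>n. z + Complex 0 (y n)) \<longlonglongrightarrow> z + Complex 0 0"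
      unfolding y_def by (intro tendsto_add tendsto_Complex tendsto_const LIMSEQ_Suc lim_1_over_n)
    moreover have "z + Complex 0 0 = z" by (simp add: complex_eq_iff)
    ultimately have "(\<lambda>n. z + Complex 0 (y n)) \<longlonglongrightarrow> z" by (simp only:)
    moreover have "isCont F z" using hol z
      by (meson continuous_on_eq_continuous_at holomorphic_on_imp_continuous_on open_uhp)
    ultimately show ?thesis by (intro tendsto_norm) (rule isCont_tendsto_compose)
  qed
  moreover have "(\<lambda>n. exp (poisson (w M n) z + Cz * C / M)) \<longlonglongrightarrow> exp (poisson (w' M) z + Cz * C / M)"
    if M: "M > 0" for M
  proof (intro tendsto_intros)
    show "(\<lambda>n. poisson (w M n) z) \<longlonglongrightarrow> poisson (w' M) z"
      unfolding poisson_def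
    proof (rule integral_dominated_convergence)
      show "integrable lebesgue (\<lambda>t. poisson_kernel z t * (M + (\<bar>ln \<delta>\<bar> + \<delta>)))"
        by (intro integrable_mult_left poisson_kernel_integrable z)
      show "AE t in lebesgue. (\<lambda>n. poisson_kernel z t * w M n t) \<longlonglongrightarrow> poisson_kernel z t * w' M t"
        using boundary_fun_vertical[OF bd]
      proof eventually_elim
        case (elim t)
        have "min (norm (f t)) M + \<delta> \<noteq> 0" using M \<delta> by (auto simp: min_def add_nonneg_eq_0_iff)
        then show ?case unfolding w_def w'_def y_def
          by (intro tendsto_intros elim)
      qed
      show "AE t in lebesgue. norm (poisson_kernel z t * w M n t) \<le> poisson_kernel z t * (M + (\<bar>ln \<delta>\<bar> + \<delta>))" for n
        using min_bd[OF M] poisson_kernel_nonneg[OF z] by (intro AE_I2) (auto simp: abs_mult w_def intro!: mult_left_mono)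
    qed measurable
  qed
  ultimately have bM: "norm (F z) \<le> exp (poisson (w' M) z + Cz * C / M)" if "M > 0" for M
    using LIMSEQ_le[of _ "norm (F z)"] step[OF that] that by (meson)
  have "poisson (w' M) z \<le> poisson (\<lambda>t. ln (norm (f t) + \<delta>)) z" if M: "M > 0" for M
  proof (rule poisson_mono[OF _ poisson_integrable_ln_add[OF pf _ \<delta>] z])
    show "poisson_integrable (w' M)"
      by (rule poisson_integrable_bounded[OF w_meas(2), where M = "M + (\<bar>ln \<delta>\<bar> + \<delta>)"]) (use min_bd M in \<open>auto simp: w'_def\<close>)
    have "min (norm (f t)) M + \<delta> > 0" for t using M \<delta> by (intro add_nonneg_pos) auto
    then show "AE t in lebesgue. w' M t \<le> ln (norm (f t) + \<delta>)"
      unfolding w'_def by (intro AE_I2 ln_mono) (auto simp: add_nonneg_pos \<delta>)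
  qed simp
  then have bM': "norm (F z) \<le> exp (poisson (\<lambda>t. ln (norm (f t) + \<delta>)) z + Cz * C / M)" if "M > 0" for M
    using bM[OF that] that by (meson add_right_mono exp_le_cancel_iff order_trans)
  have "(\<lambda>n. exp (poisson (\<lambda>t. ln (norm (f t) + \<delta>)) z + Cz * C / real (Suc n))) \<longlonglongrightarrow>
        exp (poisson (\<lambda>t. ln (norm (f t) + \<delta>)) z + 0)"
    by (intro tendsto_intros LIMSEQ_Suc lim_const_over_n)
  then show ?thesis
    by (intro LIMSEQ_le_const[of _ "exp (poisson (\<lambda>t. ln (norm (f t) + \<delta>)) z)"]) (auto intro!: bM' simp del: of_nat_Suc)
qed

text \<open>Fatou's lemma as \<open>\<delta>\<close> tends to 0: a lower bound for the logarithmic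
  means that is uniform in \<open>\<delta>\<close> limits how small \<open>g\<close> can be on
  average, and a zero set of positive measure would make the means tend to minus infinity.\<close>

lemma ln_poisson_integrable:
  assumes g: "poisson_integrable g" "\<And>t. 0 \<le> g t" and z: "z \<in> uhp"
    and c: "\<And>\<delta>. 0 < \<delta> \<Longrightarrow> c \<le> poisson (\<lambda>t. ln (g t + \<delta>)) z"
  shows "AE t in lebesgue. g t \<noteq> 0" and "poisson_integrable (\<lambda>t. ln (g t))"
proof -
  have gm [measurable]: "g \<in> borel_measurable lebesgue" using g(1) by (rule poisson_integrable_measurable)
  \<comment> \<open>Subtracting from \<open>ln (g t + 1)\<close> produces the sign that Fatou's
    lemma requires; the logarithm alone has none.\<close>
  define u where "u n t = ln (g t + 1) - ln (g t + 1 / real (Suc n))" for n t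
  have um [measurable]: "u n \<in> borel_measurable lebesgue" for n unfolding u_def by measurable
  have u0: "0 \<le> u n t" for n t
    using g(2)[of t] by (simp add: u_def add_nonneg_pos)
  define K where "K = poisson (\<lambda>t. ln (g t + 1)) z - c"
  have l1: "poisson_integrable (\<lambda>t. ln (g t + \<delta>))" if "\<delta> > 0" for \<delta>
    using poisson_integrable_ln_add[OF g that] .
  have pu: "poisson_integrable (u n)" for n
    using poisson_integrable_add[OF l1[of 1] poisson_integrable_cmult[OF l1[of "1 / real (Suc n)"], of "-1"]]
    by (simp add: u_def)
  have le: "(\<integral>\<^sup>+t. ennreal (poisson_kernel z t * u n t) \<partial>lebesgue) \<le> ennreal K" for n
  proof -
    have "(\<integral>\<^sup>+t. ennreal (poisson_kernel z t * u n t) \<partial>lebesgue) = ennreal (poisson (u n) z)"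
      unfolding poisson_def using poisson_integrableD[OF pu z] u0 poisson_kernel_nonneg[OF z]
      by (intro nn_integral_eq_integral) auto
    also have "poisson (u n) z = poisson (\<lambda>t. ln (g t + 1)) z - poisson (\<lambda>t. ln (g t + 1 / real (Suc n))) z"
      unfolding u_def by (intro poisson_diff l1 z) auto
    also have "\<dots> \<le> K" unfolding K_def using c[of "1 / real (Suc n)"] by simp
    finally show ?thesis by (simp add: ennreal_leI)
  qed
  define U where "U t = liminf (\<lambda>n. ennreal (poisson_kernel z t * u n t))" for t
  have Um [measurable]: "U \<in> borel_measurable lebesgue" unfolding U_def by measurable
  have "(\<integral>\<^sup>+t. U t \<partial>lebesgue) \<le> liminf (\<lambda>n. \<integral>\<^sup>+t. ennreal (poisson_kernel z t * u n t) \<partial>lebesgue)"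
    unfolding U_def by (rule nn_integral_liminf) measurable
  also have "\<dots> \<le> liminf (\<lambda>n::nat. ennreal K)" by (intro Liminf_mono always_eventually allI le)
  also have "\<dots> = ennreal K" by (simp add: Liminf_const)
  finally have UK: "(\<integral>\<^sup>+t. U t \<partial>lebesgue) \<le> ennreal K" .
  then have "(\<integral>\<^sup>+t. U t \<partial>lebesgue) \<noteq> \<infinity>" using ennreal_less_top[of K] by (metis infinity_ennreal_def leD)
  then have fin: "AE t in lebesgue. U t \<noteq> \<infinity>" by (intro nn_integral_PInf_AE Um)
  \<comment> \<open>Zeros of \<open>g\<close> are treated apart: since \<open>ln 0 = 0\<close>, the
    formula of \<open>limU\<close> would hide the divergence there.\<close>
  have lim0: "U t = \<infinity>" if "g t = 0" for t
  proof -
    have "filterlim (\<lambda>n. poisson_kernel z t * ln (real (Suc n))) at_top sequentially"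
      by (intro filterlim_tendsto_pos_mult_at_top[OF tendsto_const] poisson_kernel_pos z
           filterlim_compose[OF ln_at_top] filterlim_compose[OF filterlim_real_sequentially filterlim_Suc])
    moreover have "poisson_kernel z t * ln (real (Suc n)) = poisson_kernel z t * u n t" for n
      using that by (simp add: u_def ln_div)
    ultimately have "filterlim (\<lambda>n. poisson_kernel z t * u n t) at_top sequentially" by (simp only:)
    then have "(\<lambda>n. ennreal (poisson_kernel z t * u n t)) \<longlonglongrightarrow> \<infinity>"
      by (simp add: ennreal_tendsto_top_eq_at_top)
    then show ?thesis unfolding U_def by (intro lim_imp_Liminf) auto
  qed
  show nz: "AE t in lebesgue. g t \<noteq> 0" using fin by eventually_elim (use lim0 in auto)
  have limU: "U t = ennreal (poisson_kernel z t * (ln (g t + 1) - ln (g t)))" if "g t \<noteq> 0" for t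
  proof -
    have "(\<lambda>n. poisson_kernel z t * u n t) \<longlonglongrightarrow> poisson_kernel z t * (ln (g t + 1) - ln (g t + 0))"
      unfolding u_def using that by (intro tendsto_intros LIMSEQ_Suc lim_1_over_n) auto
    then show ?thesis unfolding U_def by (intro lim_imp_Liminf) (auto intro!: tendsto_ennrealI)
  qed
  have "integrable lebesgue (\<lambda>t. poisson_kernel z t * (ln (g t + 1) - ln (g t)))"
  proof (rule integrableI_nonneg)
    show "AE t in lebesgue. 0 \<le> poisson_kernel z t * (ln (g t + 1) - ln (g t))"
      using nz
    proof eventually_elim
      case (elim t)
      then have "g t > 0" using g(2)[of t] by simp
      then show ?case using poisson_kernel_nonneg[OF z, of t] by simp
    qed
    have "(\<integral>\<^sup>+t. ennreal (poisson_kernel z t * (ln (g t + 1) - ln (g t))) \<partial>lebesgue) = (\<integral>\<^sup>+t. U t \<partial>lebesgue)"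
      by (intro nn_integral_cong_AE) (use nz limU in \<open>auto elim!: eventually_mono\<close>)
    also have "\<dots> < \<infinity>" using UK ennreal_less_top[of K] by (simp add: le_less_trans)
    finally show "(\<integral>\<^sup>+t. ennreal (poisson_kernel z t * (ln (g t + 1) - ln (g t))) \<partial>lebesgue) < \<infinity>" .
  qed measurable
  then have "poisson_integrable (\<lambda>t. ln (g t + 1) - ln (g t))" using z by (rule poisson_integrableI)
  from poisson_integrable_add[OF l1[of 1] poisson_integrable_cmult[OF this, of "-1"]]
  show "poisson_integrable (\<lambda>t. ln (g t))" by simp
qed

text \<open>One point with \<open>F z1 \<noteq> 0\<close> bounds the means of
  \<open>ln (norm (f t) + \<delta>)\<close> from below for all \<open>\<delta>\<close> at once. This
  forces \<open>ln (norm (f t))\<close> to be integrable, and that integrability in turn supplies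
  the dominating function for letting \<open>\<delta>\<close> tend to 0 at every other
  point.\<close>

proposition poisson_log_majorant:
  assumes hol: "F holomorphic_on uhp" and sb: "shifts_bounded F" and bd: "boundary_fun F f"
    and pf: "poisson_integrable (\<lambda>t. norm (f t))" and nz: "z1 \<in> uhp" "F z1 \<noteq> 0"
  shows "AE t in lebesgue. f t \<noteq> 0" and "poisson_integrable (\<lambda>t. ln (norm (f t)))"
    and "z \<in> uhp \<Longrightarrow> norm (F z) \<le> exp (poisson (\<lambda>t. ln (norm (f t))) z)"
proof -
  have aux: "norm (F z) \<le> exp (poisson (\<lambda>t. ln (norm (f t) + \<delta>)) z)" if "\<delta> > 0" "z \<in> uhp" for \<delta> z
    by (rule poisson_log_majorant_aux[OF hol sb bd pf that])
  have c: "ln (norm (F z1)) \<le> poisson (\<lambda>t. ln (norm (f t) + \<delta>)) z1" if "\<delta> > 0" for \<delta>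
    using aux[OF that nz(1)] nz(2) by (metis ln_exp ln_mono exp_gt_zero zero_less_norm_iff)
  show AEnz: "AE t in lebesgue. f t \<noteq> 0"
    using ln_poisson_integrable(1)[OF pf _ nz(1) c] by simp
  show pl: "poisson_integrable (\<lambda>t. ln (norm (f t)))"
    using ln_poisson_integrable(2)[OF pf _ nz(1) c] by simp
  have [measurable]: "f \<in> borel_measurable lebesgue" by (rule boundary_fun_measurable[OF hol bd])
  assume z: "z \<in> uhp"
  have p1: "poisson_integrable (\<lambda>t. \<bar>ln (norm (f t))\<bar> + norm (f t) + 1)"
    using integrable_abs[OF pl] by (intro poisson_integrable_add pf poisson_integrable_const) simp
  have "(\<lambda>n. poisson (\<lambda>t. ln (norm (f t) + 1 / real (Suc n))) z) \<longlonglongrightarrow> poisson (\<lambda>t. ln (norm (f t))) z"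
    unfolding poisson_def
  proof (rule integral_dominated_convergence)
    show "integrable lebesgue (\<lambda>t. poisson_kernel z t * (\<bar>ln (norm (f t))\<bar> + norm (f t) + 1))"
      by (rule poisson_integrableD[OF p1 z])
    show "AE t in lebesgue. (\<lambda>n. poisson_kernel z t * ln (norm (f t) + 1 / real (Suc n))) \<longlonglongrightarrow> poisson_kernel z t * ln (norm (f t))"
      using AEnz
    proof eventually_elim
      case (elim t)
      have "(\<lambda>n. poisson_kernel z t * ln (norm (f t) + 1 / real (Suc n))) \<longlonglongrightarrow> poisson_kernel z t * ln (norm (f t) + 0)"
        using elim by (intro tendsto_intros LIMSEQ_Suc lim_1_over_n) auto
      then show ?case by simp
    qed
    show "AE t in lebesgue. norm (poisson_kernel z t * ln (norm (f t) + 1 / real (Suc n))) \<le> poisson_kernel z t * (\<bar>ln (norm (f t))\<bar> + norm (f t) + 1)" for n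
      using AEnz
    proof eventually_elim
      case (elim t)
      have "1 / real (Suc n) \<le> 1" "1 / real (Suc n) > 0" by simp_all
      then have "ln (norm (f t) + 1 / real (Suc n)) \<le> norm (f t) + 1"
        using ln_le_minus_one[of "norm (f t) + 1 / real (Suc n)"] norm_ge_zero[of "f t"] by linarith
      moreover have "ln (norm (f t)) \<le> ln (norm (f t) + 1 / real (Suc n))"
        using elim by (intro ln_mono) (auto simp: add_pos_pos)
      ultimately have "\<bar>ln (norm (f t) + 1 / real (Suc n))\<bar> \<le> \<bar>ln (norm (f t))\<bar> + norm (f t) + 1"
        using norm_ge_zero[of "f t"] by linarith
      then show ?case using poisson_kernel_nonneg[OF z, of t] by (auto simp: abs_mult intro!: mult_left_mono)
    qed
  qed measurable
  then have "(\<lambda>n. exp (poisson (\<lambda>t. ln (norm (f t) + 1 / real (Suc n))) z)) \<longlonglongrightarrow> exp (poisson (\<lambda>t. ln (norm (f t))) z)"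
    by (rule tendsto_exp)
  then show "norm (F z) \<le> exp (poisson (\<lambda>t. ln (norm (f t))) z)"
    by (rule LIMSEQ_le_const) (use aux z in \<open>auto simp del: of_nat_Suc\<close>)
qed

section \<open>Growth of Hardy functions and of bounded functions\<close>

lemma le_1_plus_powr:
  fixes x :: real
  assumes "0 \<le> x" "1 \<le> p"
  shows "x \<le> 1 + x powr p"
proof (cases "x \<le> 1")
  case True
  then show ?thesis using powr_ge_zero[of x p] by linarith
next
  case False
  then have "x powr 1 \<le> x powr p" using assms by (intro powr_mono) auto
  then show ?thesis using False by simp
qed

text \<open>The estimate \<open>x \<le> 1 + x powr p\<close> stands in for Hoelder's inequality; its
  constant 1, integrated against the weight, is the \<open>pi\<close> of the bound.\<close>

lemma Lp_poisson_integrable: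
  assumes "g \<in> Lp p" "1 \<le> p"
  shows "poisson_integrable (\<lambda>t. norm (g t))"
    and "(LINT t|lebesgue. norm (g t) / (1 + t\<^sup>2)) \<le> pi + (LINT t|lebesgue. norm (g t) powr p)"
proof -
  have m [measurable]: "g \<in> borel_measurable lebesgue" and i: "integrable lebesgue (\<lambda>t. norm (g t) powr p)"
    using assms(1) by (auto simp: Lp_def)
  have b: "norm (g t) / (1 + t\<^sup>2) \<le> 1 / (1 + t\<^sup>2) + norm (g t) powr p" for t
  proof -
    have "norm (g t) / (1 + t\<^sup>2) \<le> (1 + norm (g t) powr p) / (1 + t\<^sup>2)"
      using le_1_plus_powr[of "norm (g t)" p] assms(2) by (intro divide_right_mono) auto
    also have "\<dots> = 1 / (1 + t\<^sup>2) + norm (g t) powr p / (1 + t\<^sup>2)" by (rule add_divide_distrib)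
    also have "\<dots> \<le> 1 / (1 + t\<^sup>2) + norm (g t) powr p / 1"
      by (intro add_left_mono divide_left_mono) auto
    finally show ?thesis by simp
  qed
  have i2: "integrable lebesgue (\<lambda>t. 1 / (1 + t\<^sup>2) + norm (g t) powr p)"
    by (intro Bochner_Integration.integrable_add integrable_inverse_1_plus_sq i)
  show pg: "poisson_integrable (\<lambda>t. norm (g t))"
  proof (rule Bochner_Integration.integrable_bound[OF i2])
    have "(\<lambda>t::real. 1 + t\<^sup>2) \<in> borel_measurable lebesgue"
      by (rule borel_measurable_lebesgue) measurable
    then show "(\<lambda>t. norm (g t) / (1 + t\<^sup>2)) \<in> borel_measurable lebesgue" by measurable
    show "AE t in lebesgue. norm (norm (g t) / (1 + t\<^sup>2)) \<le> norm (1 / (1 + t\<^sup>2) + norm (g t) powr p)"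
    proof (rule AE_I2)
      fix t
      have "0 \<le> norm (g t) / (1 + t\<^sup>2)" by simp
      then show "norm (norm (g t) / (1 + t\<^sup>2)) \<le> norm (1 / (1 + t\<^sup>2) + norm (g t) powr p)"
        using b[of t] unfolding real_norm_def by linarith
    qed
  qed
  have "(LINT t|lebesgue. norm (g t) / (1 + t\<^sup>2)) \<le> (LINT t|lebesgue. 1 / (1 + t\<^sup>2) + norm (g t) powr p)"
    by (rule integral_mono[OF pg i2 b])
  also have "\<dots> = pi + (LINT t|lebesgue. norm (g t) powr p)"
    by (subst Bochner_Integration.integral_add[OF integrable_inverse_1_plus_sq i]) (simp add: integral_inverse_1_plus_sq)
  finally show "(LINT t|lebesgue. norm (g t) / (1 + t\<^sup>2)) \<le> pi + (LINT t|lebesgue. norm (g t) powr p)" .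
qed

lemma uhp_primitive:
  assumes "F holomorphic_on uhp"
  obtains A where "\<And>z. z \<in> uhp \<Longrightarrow> (A has_field_derivative F z) (at z)"
  using holomorphic_convex_primitive'[OF convex_uhp open_uhp assms]
  by (metis at_within_open open_uhp)

lemma uhp_Cauchy_estimate:
  assumes hol: "G holomorphic_on uhp" and B: "\<And>z. z \<in> uhp \<Longrightarrow> norm (G z) \<le> B" and z: "z \<in> uhp"
  shows "norm (deriv G z) \<le> 2 * B / Im z"
proof -
  have y: "Im z > 0" using z by (simp add: uhp_def)
  have sub: "cball z (Im z / 2) \<subseteq> uhp"
  proof
    fix u assume "u \<in> cball z (Im z / 2)"
    then have "\<bar>Im (z - u)\<bar> \<le> Im z / 2" using abs_Im_le_cmod[of "z - u"] by (simp add: dist_norm)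
    then have "Im z - Im u \<le> Im z / 2" unfolding minus_complex.sel by linarith
    then show "u \<in> uhp" using y by (simp add: uhp_def)
  qed
  have "norm ((deriv ^^ 1) G z) \<le> fact 1 * B / (Im z / 2) ^ 1"
  proof (rule Cauchy_inequality)
    show "G holomorphic_on ball z (Im z / 2)" using sub ball_subset_cball by (intro holomorphic_on_subset[OF hol]) blast
    show "continuous_on (cball z (Im z / 2)) G" using sub by (intro continuous_on_subset[OF holomorphic_on_imp_continuous_on[OF hol]])
    show "norm (G x) \<le> B" if "norm (z - x) = Im z / 2" for x
      using that sub by (intro B) (auto simp: dist_norm)
  qed (use y in auto)
  then show ?thesis by (simp add: field_simps)
qed

text \<open>Horizontal differences of a primitive \<open>A\<close> of \<open>F\<close> are bounded by local means of \<open>\<bar>F\<bar>\<close>, so Cauchy's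
  estimate shows that \<open>F\<close> hardly varies along horizontal lines and is comparable with these means.\<close>

lemma horizontal_mean_bound:
  assumes hol: "F holomorphic_on uhp"
    and C: "\<And>x y u. y > 0 \<Longrightarrow> 0 \<le> u \<Longrightarrow> u \<le> 1 \<Longrightarrow> integral {0..u} (\<lambda>s. norm (F (Complex (x + s) y))) \<le> C"
    and z: "z \<in> uhp"
  shows "norm (F z) \<le> C * (1 + 2 / Im z)"
proof -
  obtain A where A: "\<And>z. z \<in> uhp \<Longrightarrow> (A has_field_derivative F z) (at z)"
    using uhp_primitive[OF hol] by blast
  have y: "Im z > 0" using z by (simp add: uhp_def)
  have cont: "continuous_on {0..u} (\<lambda>s. F (z + complex_of_real s))" if "z \<in> uhp" for u :: real and z
    by (rule continuous_on_compose2[OF holomorphic_on_imp_continuous_on[OF hol]])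
       (use that in \<open>auto intro!: continuous_intros simp: uhp_def\<close>)
  have eqC: "F (z + complex_of_real s) = F (Complex (Re z + s) (Im z))" for s z
    by (rule arg_cong[where f = F]) (simp add: complex_eq_iff)
  have diff: "norm (A (z + complex_of_real u) - A z) \<le> C" if z: "z \<in> uhp" and u: "0 \<le> u" "u \<le> 1" for z u
  proof -
    have "((\<lambda>s. F (z + complex_of_real s)) has_integral (A (z + complex_of_real u) - A (z + complex_of_real 0))) {0..u}"
    proof (rule fundamental_theorem_of_calculus[OF u(1)])
      fix s assume "s \<in> {0..u}"
      have "z + complex_of_real s \<in> uhp" using z by (simp add: uhp_def)
      then have "(A has_field_derivative F (z + complex_of_real s)) (at (z + complex_of_real s))" by (rule A)
      moreover have "((\<lambda>s. z + complex_of_real s) has_vector_derivative 1) (at s within {0..u})"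
        by (auto intro!: derivative_eq_intros)
      ultimately have "((A \<circ> (\<lambda>s. z + complex_of_real s)) has_vector_derivative (1 * F (z + complex_of_real s))) (at s within {0..u})"
        by (intro field_vector_diff_chain_within) (auto intro: has_field_derivative_at_within)
      then show "((\<lambda>s. A (z + complex_of_real s)) has_vector_derivative F (z + complex_of_real s)) (at s within {0..u})"
        by (simp add: comp_def)
    qed
    then have "norm (A (z + complex_of_real u) - A z) = norm (integral {0..u} (\<lambda>s. F (z + complex_of_real s)))"
      by (simp add: integral_unique)
    also have "\<dots> \<le> integral {0..u} (\<lambda>s. norm (F (z + complex_of_real s)))"
      by (intro integral_norm_bound_integral integrable_continuous_real continuous_on_norm cont z) auto
    also have "\<dots> \<le> C" unfolding eqC by (rule C) (use z u in \<open>auto simp: uhp_def\<close>)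
    finally show ?thesis .
  qed
  have near: "norm (F z) \<le> norm (F (z + complex_of_real u)) + 2 * C / Im z" if u: "0 \<le> u" "u \<le> 1" for u
  proof -
    define G where "G z = A (z + complex_of_real u) - A z" for z
    have shift: "z + complex_of_real u \<in> uhp" if "z \<in> uhp" for z using that by (simp add: uhp_def)
    have dG: "(G has_field_derivative (F (z + complex_of_real u) - F z)) (at z)" if "z \<in> uhp" for z
    proof -
      have "((\<lambda>z. A (z + complex_of_real u)) has_field_derivative F (z + complex_of_real u) * 1) (at z)"
        by (rule DERIV_chain2[of A]) (use A[OF shift[OF that]] in \<open>auto intro!: derivative_eq_intros\<close>)
      then show ?thesis unfolding G_def using DERIV_diff[OF _ A[OF that]] by simp
    qed
    have "G holomorphic_on uhp" using dG by (auto simp: holomorphic_on_open)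
    then have "norm (deriv G z) \<le> 2 * C / Im z"
      by (rule uhp_Cauchy_estimate) (use diff u z in \<open>auto simp: G_def\<close>)
    then have "norm (F z - F (z + complex_of_real u)) \<le> 2 * C / Im z"
      using DERIV_imp_deriv[OF dG[OF z]] by (simp add: norm_minus_commute)
    then show ?thesis using norm_triangle_ineq2[of "F z" "F (z + complex_of_real u)"] by linarith
  qed
  have "integral {0..1} (\<lambda>u::real. norm (F z)) \<le> integral {0..1} (\<lambda>u. norm (F (z + complex_of_real u)) + 2 * C / Im z)"
    by (intro integral_le integrable_continuous_real continuous_intros cont z) (use near in auto)
  also have "\<dots> = integral {0..1} (\<lambda>u. norm (F (z + complex_of_real u))) + 2 * C / Im z"
    by (subst Henstock_Kurzweil_Integration.integral_add)
       (auto intro!: integrable_continuous_real continuous_intros cont z)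
  also have "\<dots> \<le> C + 2 * C / Im z"
    unfolding eqC by (intro add_right_mono C y) auto
  finally show ?thesis by (simp add: algebra_simps)
qed

text \<open>\<open>hardy_hol\<close> controls integrals over lines only. The pointwise bound above a
  line comes from means over segments of length at most 1, which are at most \<open>1 + C\<close> by
  \<open>le_1_plus_powr\<close>.\<close>

lemma hardy_hol_shifts_bounded:
  assumes "F \<in> hardy_hol p" "1 \<le> p"
  shows "shifts_bounded F"
proof -
  have hol: "F holomorphic_on uhp" using assms(1) by (simp add: hardy_hol_def)
  obtain C where C: "\<And>y. y > 0 \<Longrightarrow> (\<lambda>x. F (Complex x y)) \<in> Lp p"
     "\<And>y. y > 0 \<Longrightarrow> (LINT x|lebesgue. norm (F (Complex x y)) powr p) \<le> C"
    using assms(1) unfolding hardy_hol_def by blast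
  have bd: "norm (F z) \<le> (1 + C) * (1 + 2 / Im z)" if z: "z \<in> uhp" for z
  proof (rule horizontal_mean_bound[OF hol _ z])
    fix x y u :: real assume y: "y > 0" and u: "0 \<le> u" "u \<le> 1"
    define q where "q s = norm (F (Complex s y)) powr p" for s
    have iq: "integrable lebesgue q" using C(1)[OF y] by (simp add: Lp_def q_def[abs_def])
    have hq: "(q has_integral (LINT x|lebesgue. q x)) UNIV" by (rule has_integral_integral_lebesgue[OF iq])
    have q0: "0 \<le> q s" for s by (simp add: q_def)
    have qi: "q integrable_on {x..x+u}"
      using hq integrable_on_subcbox[of q UNIV x "x + u"] by auto
    have "integral {x..x+u} q \<le> integral UNIV q"
      by (rule integral_subset_le) (use qi hq q0 in auto)
    also have "\<dots> \<le> C" using C(2)[OF y] hq by (simp add: integral_unique q_def[abs_def])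
    finally have qC: "integral {x..x+u} q \<le> C" .
    have shift: "((\<lambda>s. q (x + s)) has_integral integral {x..x+u} q) {0..u}"
      using has_integral_affinity'[OF integrable_integral[OF qi[unfolded interval_cbox]], of 1 x] by (simp add: add.commute)
    have cont: "continuous_on {0..u} (\<lambda>s. norm (F (Complex (x + s) y)))"
      by (intro continuous_on_norm continuous_on_compose2[OF holomorphic_on_imp_continuous_on[OF hol]])
         (use y in \<open>auto intro!: continuous_intros simp: uhp_def Complex_eq\<close>)
    have "integral {0..u} (\<lambda>s. norm (F (Complex (x + s) y))) \<le> integral {0..u} (\<lambda>s. 1 + q (x + s))"
    proof (rule integral_le)
      show "(\<lambda>s. norm (F (Complex (x + s) y))) integrable_on {0..u}"
        by (rule integrable_continuous_real[OF cont])
      show "(\<lambda>s. 1 + q (x + s)) integrable_on {0..u}"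
        by (rule Henstock_Kurzweil_Integration.integrable_add) (use shift in auto)
      show "norm (F (Complex (x + s) y)) \<le> 1 + q (x + s)" for s
        unfolding q_def by (rule le_1_plus_powr) (use assms in auto)
    qed
    also have "\<dots> = u + integral {x..x+u} q"
      by (subst Henstock_Kurzweil_Integration.integral_add) (use shift u in \<open>auto simp: integral_unique\<close>)
    also have "\<dots> \<le> 1 + C" using u qC by simp
    finally show "integral {0..u} (\<lambda>s. norm (F (Complex (x + s) y))) \<le> 1 + C" .
  qed
  show ?thesis unfolding shifts_bounded_def
  proof (intro conjI allI impI)
    fix y :: real assume y: "y > 0"
    have "0 \<le> (LINT x|lebesgue. norm (F (Complex x y)) powr p)" by simp
    then have C0: "0 \<le> 1 + C" using C(2)[OF y] by linarith
    have "norm (F z) \<le> (1 + C) * (1 + 2 / y)" if "z \<in> uhp" "y \<le> Im z" for z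
    proof -
      have "2 / Im z \<le> 2 / y" using that y by (intro divide_left_mono) auto
      then have "(1 + C) * (1 + 2 / Im z) \<le> (1 + C) * (1 + 2 / y)" using C0 by (intro mult_left_mono) auto
      then show ?thesis using bd[OF that(1)] by linarith
    qed
    then show "\<exists>B. \<forall>z\<in>uhp. y \<le> Im z \<longrightarrow> norm (F z) \<le> B" by blast
  next
    show "\<exists>D. \<forall>y>0. poisson_integrable (\<lambda>t. norm (F (Complex t y))) \<and>
        (LINT t|lebesgue. norm (F (Complex t y)) / (1 + t\<^sup>2)) \<le> D"
      using Lp_poisson_integrable[OF C(1) assms(2)] C(2)
      by (intro exI[of _ "pi + C"]) (fastforce intro: order_trans)
  qed
qed

lemma bounded_shifts_bounded:
  assumes hol: "F holomorphic_on uhp" and B: "\<And>z. z \<in> uhp \<Longrightarrow> norm (F z) \<le> B"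
  shows "shifts_bounded F"
proof -
  have u: "Complex t y \<in> uhp" if "y > 0" for t y using that by (simp add: uhp_def)
  have m: "(\<lambda>t. norm (F (Complex t y))) \<in> borel_measurable lebesgue" if "y > 0" for y
    by (intro borel_measurable_lebesgue borel_measurable_continuous_onI continuous_on_norm
          continuous_on_compose2[OF holomorphic_on_imp_continuous_on[OF hol]])
       (use that in \<open>auto intro!: continuous_intros simp: uhp_def Complex_eq\<close>)
  have p: "poisson_integrable (\<lambda>t. norm (F (Complex t y)))" if "y > 0" for y
    by (rule poisson_integrable_bounded[OF m[OF that], where M = B]) (use B[OF u[OF that]] in simp)
  have "(LINT t|lebesgue. norm (F (Complex t y)) / (1 + t\<^sup>2)) \<le> (LINT t|lebesgue. B / (1 + t\<^sup>2))" if "y > 0" for y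
    by (intro integral_mono p[OF that] poisson_integrable_const divide_right_mono B u that) auto
  then show ?thesis unfolding shifts_bounded_def using B p by blast
qed

section \<open>Boundary values of bounded holomorphic functions\<close>

lemma integral_right_derivative:
  fixes h :: "real \<Rightarrow> real"
  assumes h: "\<And>a b. h integrable_on {a..b}"
  obtains N where "negligible N"
    "\<And>x e. x \<notin> N \<Longrightarrow> 0 < e \<Longrightarrow> \<exists>d>0. \<forall>k. 0 < k \<and> k < d \<longrightarrow> norm (integral {x..x+k} h /\<^sub>R k - h x) < e"
proof (rule integrable_ccontinuous_explicit[of h])
  show "h integrable_on cbox a b" for a b using h by (simp only: cbox_interval)
  fix N
  assume "negligible N" and *: "\<And>x e. \<lbrakk>x \<notin> N; 0 < e\<rbrakk> \<Longrightarrow> \<exists>d>0. \<forall>k. 0 < k \<and> k < d \<longrightarrow>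
     norm (integral (cbox x (x + k *\<^sub>R One)) h /\<^sub>R k ^ DIM(real) - h x) < e"
  show ?thesis
  proof (rule that[OF \<open>negligible N\<close>])
    fix x e :: real assume "x \<notin> N" "0 < e"
    from *[OF this] show "\<exists>d>0. \<forall>k. 0 < k \<and> k < d \<longrightarrow> norm (integral {x..x+k} h /\<^sub>R k - h x) < e"
      by (simp add: cbox_interval)
  qed
qed

text \<open>\<open>integral_right_derivative\<close> looks to the right only. The left-hand
  quotients at \<open>x\<close> are right-hand quotients at \<open>- x\<close> of the reflected
  function, so the exceptional set also contains the mirror image of the second null set.\<close>

lemma indefinite_integral_derivative_AE:
  fixes h :: "real \<Rightarrow> real"
  assumes h: "\<And>a b. h integrable_on {a..b}"
    and a: "\<And>x y. x \<le> y \<Longrightarrow> a y - a x = integral {x..y} h"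
  shows "AE x in lebesgue. (a has_real_derivative h x) (at x)"
proof -
  obtain N where N: "negligible N"
    "\<And>x e. x \<notin> N \<Longrightarrow> 0 < e \<Longrightarrow> \<exists>d>0. \<forall>k. 0 < k \<and> k < d \<longrightarrow> norm (integral {x..x+k} h /\<^sub>R k - h x) < e"
    using integral_right_derivative[OF h] by blast
  have hr: "(\<lambda>s. h (- s)) integrable_on {a..b}" for a b
    using h[of "-b" "-a"] Henstock_Kurzweil_Integration.integrable_reflect_real[of h "-a" "-b"] by simp
  obtain N' where N': "negligible N'"
    "\<And>x e. x \<notin> N' \<Longrightarrow> 0 < e \<Longrightarrow> \<exists>d>0. \<forall>k. 0 < k \<and> k < d \<longrightarrow> norm (integral {x..x+k} (\<lambda>s. h (- s)) /\<^sub>R k - h (- x)) < e"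
    using integral_right_derivative[OF hr] by blast
  have "negligible (N \<union> uminus ` N')"
    using N(1) N'(1)
    by (intro negligible_Un negligible_differentiable_image_negligible) (auto intro!: derivative_intros)
  then have "AE x in lebesgue. x \<notin> N \<union> uminus ` N'"
    unfolding negligible_iff_null_sets by (rule AE_not_in)
  then show ?thesis
  proof eventually_elim
    case (elim x)
    then have x: "x \<notin> N" "- x \<notin> N'" by force+
    have "((\<lambda>k. (a (x + k) - a x) / k) \<longlongrightarrow> h x) (at 0)"
    proof (rule tendstoI)
      fix e :: real assume e: "e > 0"
      obtain d1 where d1: "d1 > 0" "\<And>k. 0 < k \<Longrightarrow> k < d1 \<Longrightarrow> norm (integral {x..x+k} h /\<^sub>R k - h x) < e"
        using N(2)[OF x(1) e] by blast
      obtain d2 where d2: "d2 > 0" "\<And>k. 0 < k \<Longrightarrow> k < d2 \<Longrightarrow> norm (integral {-x..-x+k} (\<lambda>s. h (- s)) /\<^sub>R k - h x) < e"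
        using N'(2)[OF x(2) e] by auto
      have "dist ((a (x + k) - a x) / k) (h x) < e" if k: "k \<noteq> 0" "\<bar>k\<bar> < min d1 d2" for k
      proof (cases "k > 0")
        case True
        then show ?thesis using d1(2)[of k] k a[of x "x + k"]
          by (simp add: dist_norm divide_inverse mult.commute)
      next
        case False
        then have k': "- k > 0" "- k < d2" using k by auto
        have "integral {-x..-x + (- k)} (\<lambda>s. h (- s)) = integral {x + k..x} h"
          using Henstock_Kurzweil_Integration.integral_reflect_real[of "x" "x + k" h] by (simp add: add.commute)
        also have "\<dots> = a x - a (x + k)" using a[of "x + k" x] k' by simp
        finally have "norm ((a x - a (x + k)) /\<^sub>R (- k) - h x) < e" using d2(2)[OF k'] by simp
        moreover have "(a x - a (x + k)) /\<^sub>R (- k) = (a (x + k) - a x) / k"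
          using k(1) by (simp add: field_simps)
        ultimately show ?thesis by (simp add: dist_norm)
      qed
      then show "\<forall>\<^sub>F k in at 0. dist ((a (x + k) - a x) / k) (h x) < e"
        unfolding eventually_at using d1(1) d2(1) by (intro exI[of _ "min d1 d2"]) (auto simp: dist_real_def)
    qed
    then show ?case by (simp add: DERIV_def)
  qed
qed

text \<open>With Lipschitz constant \<open>1/2\<close> the measures with distribution functions \<open>t/2 \<plusminus> a t\<close> add up to
  Lebesgue measure, so both have a density.\<close>

lemma lipschitz_derivative_AE_half:
  fixes a :: "real \<Rightarrow> real"
  assumes lip: "\<And>s t. \<bar>a s - a t\<bar> \<le> \<bar>s - t\<bar> / 2"
  shows "AE x in lebesgue. \<exists>d. (a has_real_derivative d) (at x)"
proof -
  define m1 where "m1 t = t / 2 + a t" for t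
  define m2 where "m2 t = t / 2 - a t" for t
  have mono: "m1 x \<le> m1 y" "m2 x \<le> m2 y" if "x \<le> y" for x y
  proof -
    have "\<bar>a x - a y\<bar> \<le> y / 2 - x / 2" using lip[of x y] that by (simp add: diff_divide_distrib)
    then show "m1 x \<le> m1 y" "m2 x \<le> m2 y" unfolding m1_def m2_def by linarith+
  qed
  have conta: "continuous_on UNIV a"
  proof -
    have "(1/2)-lipschitz_on UNIV a" using lip by (intro lipschitz_onI) (auto simp: dist_real_def)
    then show ?thesis by (rule lipschitz_on_continuous_on)
  qed
  have cont: "continuous_on UNIV m1" "continuous_on UNIV m2"
    unfolding m1_def m2_def using conta by (auto intro!: continuous_intros)
  define \<mu>1 where "\<mu>1 = interval_measure m1"
  define \<mu>2 where "\<mu>2 = interval_measure m2"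
  define \<nu> where "\<nu> = measure_of UNIV (sets borel) (\<lambda>A. emeasure \<mu>1 A + emeasure \<mu>2 A)"
  have s [simp]: "sets \<mu>1 = sets borel" "sets \<mu>2 = sets borel" by (simp_all add: \<mu>1_def \<mu>2_def)
  have s\<nu>: "sets \<nu> = sets borel"
    unfolding \<nu>_def using sets.sets_measure_of_eq[of "borel :: real measure"] by simp
  have em: "emeasure \<nu> A = emeasure \<mu>1 A + emeasure \<mu>2 A" if "A \<in> sets borel" for A
  proof (rule emeasure_measure_of[OF \<nu>_def])
    show "countably_additive (sets \<nu>) (\<lambda>A. emeasure \<mu>1 A + emeasure \<mu>2 A)"
      unfolding countably_additive_def
    proof (intro allI impI)
      fix A :: "nat \<Rightarrow> real set"
      assume A: "range A \<subseteq> sets \<nu>" "disjoint_family A" "\<Union> (range A) \<in> sets \<nu>"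
      then have "range A \<subseteq> sets \<mu>1" "range A \<subseteq> sets \<mu>2" by (auto simp: s\<nu>)
      then show "(\<Sum>i. emeasure \<mu>1 (A i) + emeasure \<mu>2 (A i)) = emeasure \<mu>1 (\<Union> (range A)) + emeasure \<mu>2 (\<Union> (range A))"
        using A(2) by (simp add: suminf_add[symmetric] suminf_emeasure)
    qed
  qed (use that in \<open>auto simp: positive_def s\<nu>\<close>)

  have "lborel = \<nu>"
  proof (rule lborel_eqI)
    fix l u :: real assume "\<And>b. b \<in> Basis \<Longrightarrow> l \<bullet> b \<le> u \<bullet> b"
    then have lu: "l \<le> u" by simp
    have ee: "emeasure \<mu> (box l u) = ennreal (m u - m l)"
      if "\<mu> = interval_measure m" "\<And>x y. x \<le> y \<Longrightarrow> m x \<le> m y" "continuous_on UNIV m" for \<mu> m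
    proof -
      have "emeasure \<mu> {l..u} = ennreal (m u - m l)"
        unfolding that(1) by (rule emeasure_interval_measure_Icc[OF lu that(2,3)])
      moreover have "emeasure \<mu> {l..u} = emeasure \<mu> (box l u)"
      proof (rule emeasure_eq_AE)
        have s: "emeasure \<mu> {x} = 0" for x
          unfolding that(1) using emeasure_interval_measure_Icc[OF order_refl that(2,3), of x] by simp
        have "AE x in \<mu>. x \<noteq> c" for c
          by (rule AE_I[where N = "{c}"]) (use s that(1) in auto)
        from AE_conjI[OF this[of l] this[of u]]
        show "AE x in \<mu>. (x \<in> {l..u}) = (x \<in> box l u)"
          by eventually_elim (auto simp: box_real)
      qed (use that in auto)
      ultimately show ?thesis by simp
    qed
    have "emeasure \<nu> (box l u) = ennreal (m1 u - m1 l) + ennreal (m2 u - m2 l)"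
      using ee[OF \<mu>1_def mono(1) cont(1)] ee[OF \<mu>2_def mono(2) cont(2)] by (subst em) auto
    also have "\<dots> = ennreal (u - l)"
      using mono[OF lu] by (simp add: m1_def m2_def flip: ennreal_plus)
    finally show "emeasure \<nu> (box l u) = ennreal (\<Prod>b\<in>Basis. (u - l) \<bullet> b)" by simp
  qed (rule s\<nu>)
  \<comment> \<open>\<open>\<mu>1\<close> is dominated by \<open>\<nu>\<close>, which has just been
    identified as Lebesgue measure.\<close>
  then have "absolutely_continuous lborel \<mu>1"
    unfolding absolutely_continuous_def null_sets_def using em by auto
  then obtain h where h [measurable]: "h \<in> borel_measurable lborel" and dens: "density lborel h = \<mu>1"
    using sigma_finite_measure.Radon_Nikodym[OF sigma_finite_lborel, of \<mu>1] by auto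
  have nnh: "(\<integral>\<^sup>+t. h t * indicator {x..y} t \<partial>lborel) = ennreal (m1 y - m1 x)" if "x \<le> y" for x y
  proof -
    have "(\<integral>\<^sup>+t. h t * indicator {x..y} t \<partial>lborel) = emeasure \<mu>1 {x..y}"
      unfolding dens[symmetric] by (subst emeasure_density) auto
    also have "\<dots> = ennreal (m1 y - m1 x)"
      unfolding \<mu>1_def by (rule emeasure_interval_measure_Icc[OF that mono(1) cont(1)])
    finally show ?thesis .
  qed
  have fin: "AE t in lborel. h t \<noteq> \<infinity>"
  proof -
    have "AE t in lborel. h t * indicator {- real n..real n} t \<noteq> \<infinity>" for n
      by (rule nn_integral_PInf_AE) (use nnh[of "- real n" "real n"] in auto)
    then have "AE t in lborel. \<forall>n. h t * indicator {- real n..real n} t \<noteq> \<infinity>"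
      by (simp add: AE_all_countable)
    then show ?thesis
    proof eventually_elim
      case (elim t)
      obtain n where "\<bar>t\<bar> \<le> real n" using real_arch_simple by blast
      then have "t \<in> {- real n..real n}" by auto
      then show ?case using elim[rule_format, of n] by (auto simp: indicator_def)
    qed
  qed
  define k where "k t = enn2real (h t)" for t
  have [measurable]: "k \<in> borel_measurable borel" unfolding k_def using h by simp
  have hk: "(k has_integral (m1 y - m1 x)) {x..y}" if "x \<le> y" for x y
  proof -
    have "((\<lambda>t. k t * indicator {x..y} t) has_integral (m1 y - m1 x)) UNIV"
    proof (rule nn_integral_has_integral)
      have "(\<integral>\<^sup>+t. ennreal (k t * indicator {x..y} t) \<partial>lborel) = (\<integral>\<^sup>+t. h t * indicator {x..y} t \<partial>lborel)"
      proof (rule nn_integral_cong_AE)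
        show "AE t in lborel. ennreal (k t * indicator {x..y} t) = h t * indicator {x..y} t"
          using fin by eventually_elim (simp add: k_def indicator_def ennreal_enn2real_if)
      qed
      then show "(\<integral>\<^sup>+t. ennreal (k t * indicator {x..y} t) \<partial>lborel) = ennreal (m1 y - m1 x)"
        using nnh[OF that] by simp
    qed (use mono(1)[OF that] in \<open>simp_all add: k_def\<close>)
    moreover have "(\<lambda>t. k t * indicator {x..y} t) = (\<lambda>t. if t \<in> {x..y} then k t else 0)"
      by (auto simp: indicator_def)
    ultimately show ?thesis by (simp only: has_integral_restrict_UNIV)
  qed
  have "AE x in lebesgue. (m1 has_real_derivative k x) (at x)"
  proof (rule indefinite_integral_derivative_AE)
    show "k integrable_on {x..y}" for x y
      using hk[of x y] by (cases "x \<le> y") (auto simp: integrable_on_def)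
    show "m1 y - m1 x = integral {x..y} k" if "x \<le> y" for x y
      using hk[OF that] by (simp add: integral_unique)
  qed
  then show ?thesis
  proof eventually_elim
    case (elim x)
    have "((\<lambda>t. m1 t - t / 2) has_real_derivative (k x - 1 / 2)) (at x)"
      by (intro DERIV_diff elim DERIV_cdivide DERIV_ident)
    then show ?case by (auto simp: m1_def)
  qed
qed

lemma lipschitz_derivative_AE:
  fixes a :: "real \<Rightarrow> real"
  assumes lip: "\<And>s t. \<bar>a s - a t\<bar> \<le> M * \<bar>s - t\<bar>"
  shows "AE x in lebesgue. \<exists>d. (a has_real_derivative d) (at x)"
proof -
  \<comment> \<open>Dividing by at least \<open>2 * M\<close> brings the Lipschitz constant down to
    \<open>1 / 2\<close>; the 1 keeps the divisor positive when \<open>M = 0\<close>.\<close>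
  define K where "K = 2 * \<bar>M\<bar> + 1"
  have K: "K > 0" by (simp add: K_def)
  have "\<bar>a s / K - a t / K\<bar> \<le> \<bar>s - t\<bar> / 2" for s t
  proof -
    have "\<bar>a s - a t\<bar> \<le> (K / 2) * \<bar>s - t\<bar>"
      using lip[of s t] by (rule order_trans) (intro mult_right_mono, auto simp: K_def)
    then show ?thesis using K by (simp add: field_simps flip: diff_divide_distrib)
  qed
  then have "AE x in lebesgue. \<exists>d. ((\<lambda>t. a t / K) has_real_derivative d) (at x)"
    by (rule lipschitz_derivative_AE_half)
  then show ?thesis
  proof eventually_elim
    case (elim x)
    then obtain d where "((\<lambda>t. a t / K) has_real_derivative d) (at x)" by blast
    then have "((\<lambda>t. K * (a t / K)) has_real_derivative K * d) (at x)" by (rule DERIV_cmult)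
    then show ?case using K by auto
  qed
qed

lemma lipschitz_vector_derivative_AE:
  fixes \<alpha> :: "real \<Rightarrow> complex"
  assumes lip: "\<And>s t. norm (\<alpha> s - \<alpha> t) \<le> M * \<bar>s - t\<bar>"
  shows "AE x in lebesgue. \<exists>d. (\<alpha> has_vector_derivative d) (at x)"
proof -
  have "\<bar>Re (\<alpha> s) - Re (\<alpha> t)\<bar> \<le> M * \<bar>s - t\<bar>" "\<bar>Im (\<alpha> s) - Im (\<alpha> t)\<bar> \<le> M * \<bar>s - t\<bar>" for s t
    using lip[of s t] abs_Re_le_cmod[of "\<alpha> s - \<alpha> t"] abs_Im_le_cmod[of "\<alpha> s - \<alpha> t"]
    unfolding minus_complex.sel by linarith+
  then have "AE x in lebesgue. \<exists>d. ((\<lambda>t. Re (\<alpha> t)) has_real_derivative d) (at x)"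
    "AE x in lebesgue. \<exists>d. ((\<lambda>t. Im (\<alpha> t)) has_real_derivative d) (at x)"
    by (blast intro: lipschitz_derivative_AE)+
  then show ?thesis
  proof eventually_elim
    case (elim x)
    then obtain d e where "((\<lambda>t. Re (\<alpha> t)) has_real_derivative d) (at x)" "((\<lambda>t. Im (\<alpha> t)) has_real_derivative e) (at x)"
      by blast
    then have "(\<alpha> has_vector_derivative Complex d e) (at x)"
      by (simp add: has_vector_derivative_complex_iff has_real_derivative_iff_has_vector_derivative)
    then show ?case by blast
  qed
qed

text \<open>The quotient \<open>D(z) / (z - x + \<i> \<kappa>)\<close>, where \<open>D\<close> is the error of the linear approximation, is bounded
  uniformly in \<open>\<kappa>\<close> and small on the real line near \<open>x\<close>.\<close>

lemma boundary_derivative_extends: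
  assumes lip: "\<And>u v. u \<in> closure uhp \<Longrightarrow> v \<in> closure uhp \<Longrightarrow> norm (g u - g v) \<le> M * norm (u - v)"
    and hol: "g holomorphic_on uhp"
    and d: "((\<lambda>t. g (complex_of_real t)) has_vector_derivative d) (at x)"
    and e: "e > 0"
  shows "\<exists>r>0. \<forall>z\<in>uhp. norm (z - of_real x) < r \<longrightarrow>
           norm (g z - g (of_real x) - d * (z - of_real x)) \<le> e * norm (z - of_real x)"
proof -
  define X where "X = complex_of_real x"
  define D where "D z = g z - g X - d * (z - X)" for z
  define M' where "M' = M + norm d"
  \<comment> \<open>The 4 is \<open>exp (2 * ln 2)\<close>: one \<open>ln 2\<close> arises near
    \<open>x\<close>, where \<open>norm (H t) + \<eta> \<le> 2 * \<eta>\<close>, the other is the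
    allowance for the far part of the Poisson integral.\<close>
  define \<eta> where "\<eta> = e / 4"
  have \<eta>: "\<eta> > 0" using e by (simp add: \<eta>_def)
  have Xc: "X \<in> closure uhp" unfolding X_def by (rule closure_uhp_real)
  have Db: "norm (D z) \<le> M' * norm (z - X)" if "z \<in> closure uhp" for z
  proof -
    have "norm (D z) \<le> norm (g z - g X) + norm (d * (z - X))" unfolding D_def by (rule norm_triangle_ineq4)
    also have "\<dots> \<le> M * norm (z - X) + norm d * norm (z - X)"
      using lip[OF that Xc] by (simp add: norm_mult)
    finally show ?thesis by (simp add: M'_def algebra_simps)
  qed
  have M'0: "M' \<ge> 0"
  proof -
    have "norm (D (X + 1)) \<le> M'" using Db[of "X + 1"] closure_uhp_real[of "x + 1"] by (simp add: X_def)
    then show ?thesis using norm_ge_zero order_trans by blast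
  qed
  obtain r0 where r0: "r0 > 0" "\<And>t. \<bar>t - x\<bar> < r0 \<Longrightarrow> norm (D (complex_of_real t)) \<le> \<eta> * \<bar>t - x\<bar>"
  proof -
    have "((\<lambda>t. g (complex_of_real t)) has_derivative (\<lambda>h. h *\<^sub>R d)) (at x)"
      using d by (simp add: has_vector_derivative_def)
    then have "\<exists>r>0. \<forall>t. norm (t - x) < r \<longrightarrow>
        norm (g (complex_of_real t) - g (complex_of_real x) - (t - x) *\<^sub>R d) \<le> \<eta> * norm (t - x)"
      using \<eta> unfolding has_derivative_at_alt by blast
    then show ?thesis
      using that by (auto simp: D_def X_def scaleR_conv_of_real mult.commute)
  qed
  define B where "B = \<bar>ln \<eta>\<bar> + \<bar>ln (M' + \<eta>)\<bar>"
  \<comment> \<open>The second entry makes the far term of \<open>poisson_near_const\<close>, with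
    \<open>B\<close> bounding the logarithm, at most \<open>ln 2\<close>; the first is the
    hypothesis of that lemma.\<close>
  define r where "r = min (r0 / 2) (r0 * ln 2 / (8 * (B + \<bar>ln \<eta>\<bar> + 1)))"
  have B0: "B + \<bar>ln \<eta>\<bar> + 1 > 0" by (simp add: B_def add_nonneg_pos)
  have r: "r > 0" using r0(1) B0 by (simp add: r_def)
  have contg: "continuous_on (closure uhp) g"
  proof -
    have "\<bar>M\<bar>-lipschitz_on (closure uhp) g"
      by (intro lipschitz_onI) (auto simp: dist_norm intro!: order_trans[OF lip] mult_right_mono)
    then show ?thesis by (rule lipschitz_on_continuous_on)
  qed
  \<comment> \<open>The denominator of \<open>H\<close> vanishes at
    \<open>X - \<i> * \<kappa>\<close> only, below the real line, so \<open>H\<close> is continuous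
    up to the boundary. As \<open>r\<close> was fixed before \<open>\<kappa>\<close>, the limit
    \<open>\<kappa>\<close> to 0 can be taken afterwards.\<close>
  have main: "norm (D z) \<le> e * norm (z - X + \<i> * of_real \<kappa>)" if z: "z \<in> uhp" "norm (z - X) < r" and \<kappa>: "\<kappa> > 0" for z \<kappa>
  proof -
    define H where "H z = D z / (z - X + \<i> * of_real \<kappa>)" for z
    have nz: "u - X + \<i> * of_real \<kappa> \<noteq> 0" and nle: "norm (u - X) \<le> norm (u - X + \<i> * of_real \<kappa>)"
      if "u \<in> closure uhp" for u
    proof -
      have i: "Im u \<ge> 0" by (rule closure_uhp_Im[OF that])
      then show "u - X + \<i> * of_real \<kappa> \<noteq> 0" using \<kappa> by (auto simp: complex_eq_iff X_def)
      have "(Im u)\<^sup>2 \<le> (Im u + \<kappa>)\<^sup>2" using i \<kappa> by (intro power_mono) auto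
      then show "norm (u - X) \<le> norm (u - X + \<i> * of_real \<kappa>)"
        by (simp add: cmod_def X_def)
    qed
    have Hb: "norm (H u) \<le> M'" if "u \<in> closure uhp" for u
    proof -
      have "norm (D u) \<le> M' * norm (u - X + \<i> * of_real \<kappa>)"
        using Db[OF that] mult_left_mono[OF nle[OF that] M'0] by linarith
      then show ?thesis using nz[OF that] by (simp add: H_def norm_divide divide_le_eq)
    qed
    define w where "w t = ln (norm (H (complex_of_real t)) + \<eta>)" for t
    have pos: "norm (H u) + \<eta> > 0" for u using \<eta> by (simp add: add_nonneg_pos)
    have contH: "continuous_on (closure uhp) H"
      unfolding H_def D_def using contg nz by (auto intro!: continuous_intros)
    have "norm (H z) \<le> exp (poisson w z)"
      unfolding w_def
    proof (rule poisson_log_bounded[OF _ contH Hb \<eta> z(1)])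
      show "H holomorphic_on uhp"
        unfolding H_def D_def using hol nz uhp_subset_closure by (auto intro!: holomorphic_intros)
    qed
    also have "poisson w z \<le> ln \<eta> + 2 * ln 2"
    proof -
      have wl: "ln \<eta> \<le> w t" "w t \<le> ln (M' + \<eta>)" for t
        unfolding w_def using Hb[OF closure_uhp_real, of t] \<eta> pos M'0 by (auto intro!: ln_mono add_nonneg_pos)
      have "\<bar>poisson w z - ln \<eta>\<bar> \<le> ln 2 + (B + \<bar>ln \<eta>\<bar>) * (8 * Im z / r0)"
      proof (rule poisson_near_const[where r = r0 and x = x])
        have "continuous_on UNIV (\<lambda>t. H (complex_of_real t))"
          by (rule continuous_on_compose2[OF contH]) (auto intro: continuous_intros closure_uhp_real)
        then have "continuous_on UNIV w"
          unfolding w_def using pos by (intro continuous_intros) (auto simp: less_imp_neq[THEN not_sym])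
        then show "w \<in> borel_measurable lebesgue"
          by (intro borel_measurable_lebesgue borel_measurable_continuous_onI)
        show "\<bar>w t\<bar> \<le> B" for t using wl[of t] by (simp add: B_def)
        show "\<bar>w t - ln \<eta>\<bar> \<le> ln 2" if "\<bar>t - x\<bar> < r0" for t
        proof -
          have "norm (D (complex_of_real t)) \<le> \<eta> * norm (complex_of_real t - X + \<i> * of_real \<kappa>)"
          proof -
            have eq: "norm (complex_of_real t - X) = \<bar>t - x\<bar>" by (simp add: X_def flip: of_real_diff)
            show ?thesis
              using r0(2)[OF that] mult_left_mono[OF nle[OF closure_uhp_real[of t], unfolded eq] less_imp_le[OF \<eta>]]
              by (rule order_trans)
          qed
          then have "norm (H (complex_of_real t)) \<le> \<eta>"
            using nz[OF closure_uhp_real[of t]] by (simp add: H_def norm_divide divide_le_eq)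
          then have "w t \<le> ln (2 * \<eta>)" unfolding w_def using pos \<eta> by (intro ln_mono) auto
          then have "w t \<le> ln 2 + ln \<eta>" using \<eta> by (simp add: ln_mult)
          then show ?thesis using wl(1)[of t] by simp
        qed
        have "\<bar>Re (z - X)\<bar> < r" using z(2) abs_Re_le_cmod le_less_trans by blast
        then show "\<bar>Re z - x\<bar> < r0 / 2" by (simp add: X_def r_def)
      qed (use r0 z in auto)
      also have "(B + \<bar>ln \<eta>\<bar>) * (8 * Im z / r0) \<le> ln 2"
      proof -
        have "\<bar>Im (z - X)\<bar> < r" using z(2) abs_Im_le_cmod le_less_trans by blast
        then have y: "Im z \<le> r0 * ln 2 / (8 * (B + \<bar>ln \<eta>\<bar> + 1))" "0 < Im z"
          using z(1) by (auto simp: X_def r_def uhp_def)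
        have "(B + \<bar>ln \<eta>\<bar>) * (8 * Im z / r0) \<le> (B + \<bar>ln \<eta>\<bar> + 1) * (8 * (r0 * ln 2 / (8 * (B + \<bar>ln \<eta>\<bar> + 1))) / r0)"
          using y r0(1) B0 by (intro mult_mono divide_right_mono mult_left_mono) (auto simp: B_def)
        also have "\<dots> = ln 2"
        proof -
          have "K * (8 * (r0 * ln 2 / (8 * K)) / r0) = ln 2" if "K > 0" for K :: real
            using that r0(1) by (simp add: field_simps)
          then show ?thesis using B0 by blast
        qed
        finally show ?thesis .
      qed
      finally show ?thesis by linarith
    qed
    also have "exp (ln \<eta> + 2 * ln 2) = e"
    proof -
      have "exp (2 * ln 2) = (4 :: real)" using exp_of_nat_mult[of 2 "ln 2 :: real"] by simp
      then show ?thesis using \<eta> by (simp add: exp_add \<eta>_def)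
    qed
    finally have "norm (H z) \<le> e" by simp
    moreover have "z \<in> closure uhp" using z(1) uhp_subset_closure by blast
    ultimately show ?thesis using nz[of z] by (simp add: H_def norm_divide divide_le_eq)
  qed
  have "norm (D z) \<le> e * norm (z - X)" if z: "z \<in> uhp" "norm (z - X) < r" for z
  proof -
    have "(\<lambda>n. e * norm (z - X + \<i> * of_real (1 / real (Suc n)))) \<longlonglongrightarrow> e * norm (z - X + \<i> * of_real 0)"
      by (intro tendsto_intros LIMSEQ_Suc lim_1_over_n)
    then have "norm (D z) \<le> e * norm (z - X + \<i> * of_real 0)"
      by (rule LIMSEQ_le_const) (intro exI[of _ 0] allI impI main[OF z], simp)
    then show ?thesis by simp
  qed
  then show ?thesis using r unfolding D_def X_def by blast
qed

text \<open>At a point \<open>x\<close> where the boundary trace of the primitive has derivative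
  \<open>d\<close>, the error \<open>D\<close> of the linear approximation is small compared with
  \<open>norm (z - X)\<close> inside the half-plane too. Cauchy's estimate on the disc of radius
  \<open>Im z / 2\<close> turns this into smallness of \<open>F z - d\<close>, the derivative of
  \<open>D\<close>. The cone enters here: in it \<open>norm (z - X)\<close> is comparable with that
  radius.\<close>

theorem fatou_bounded:
  assumes hol: "F holomorphic_on uhp" and M: "\<And>z. z \<in> uhp \<Longrightarrow> norm (F z) \<le> M"
  shows "\<exists>f. boundary_fun F f"
proof -
  obtain A where A: "\<And>z. z \<in> uhp \<Longrightarrow> (A has_field_derivative F z) (at z)"
    using uhp_primitive[OF hol] by blast
  have "\<bar>M\<bar>-lipschitz_on uhp A"
  proof (rule lipschitz_onI)
    show "dist (A u) (A v) \<le> \<bar>M\<bar> * dist u v" if "u \<in> uhp" "v \<in> uhp" for u v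
      unfolding dist_norm
      by (rule field_differentiable_bound[OF convex_uhp _ _ that])
         (use A in \<open>auto intro: has_field_derivative_at_within order_trans[OF M]\<close>)
  qed simp
  then obtain g where g: "\<bar>M\<bar>-lipschitz_on (closure uhp) g" "\<And>z. z \<in> uhp \<Longrightarrow> g z = A z"
    using lipschitz_extend_closure by blast
  have lip: "norm (g u - g v) \<le> \<bar>M\<bar> * norm (u - v)" if "u \<in> closure uhp" "v \<in> closure uhp" for u v
    using lipschitz_onD[OF g(1) that] by (simp add: dist_norm)
  have dg: "(g has_field_derivative F z) (at z)" if "z \<in> uhp" for z
    by (rule has_field_derivative_transform_within_open[OF A[OF that] open_uhp that]) (simp add: g(2))
  have holg: "g holomorphic_on uhp" using dg by (auto simp: holomorphic_on_open)
  have "AE x in lebesgue. \<exists>d. ((\<lambda>t. g (complex_of_real t)) has_vector_derivative d) (at x)"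
    by (rule lipschitz_vector_derivative_AE[where M = "\<bar>M\<bar>"])
       (metis lip closure_uhp_real norm_of_real of_real_diff)
  then have "AE x in lebesgue. \<exists>d. \<forall>a>0. (F \<longlongrightarrow> d) (at (of_real x) within {z \<in> uhp. \<bar>Re z - x\<bar> < a * Im z})"
  proof eventually_elim
    case (elim x)
    then obtain d where d: "((\<lambda>t. g (complex_of_real t)) has_vector_derivative d) (at x)" by blast
    define X where "X = complex_of_real x"
    have "(F \<longlongrightarrow> d) (at X within {z \<in> uhp. \<bar>Re z - x\<bar> < a * Im z})" if a: "a > 0" for a
    proof (rule tendstoI)
      fix e :: real assume e: "e > 0"
      \<comment> \<open>On the disc \<open>norm (u - X) \<le> (a + 1) * Im z + Im z / 2\<close>;
        division by the radius \<open>Im z / 2\<close> gives \<open>2 * a + 3\<close>, and the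
        remaining 2 makes the final inequality strict.\<close>
      define \<eta> where "\<eta> = e / (2 * (2 * a + 3))"
      have \<eta>: "\<eta> > 0" using e a by (simp add: \<eta>_def)
      obtain r where r: "r > 0" "\<And>z. z \<in> uhp \<Longrightarrow> norm (z - X) < r \<Longrightarrow> norm (g z - g X - d * (z - X)) \<le> \<eta> * norm (z - X)"
        using boundary_derivative_extends[OF lip holg d \<eta>] unfolding X_def by blast
      have "dist (F z) d < e" if z: "z \<in> uhp" "\<bar>Re z - x\<bar> < a * Im z" "dist z X < r / 2" for z
      proof -
        define D where "D z = g z - g X - d * (z - X)" for z
        have y: "Im z > 0" using z by (simp add: uhp_def)
        have nzX: "norm (z - X) \<le> (a + 1) * Im z"
          using cmod_le[of "z - X"] z(2) y by (simp add: X_def algebra_simps)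
        have yr: "Im z < r / 2"
          using abs_Im_le_cmod[of "z - X"] z(3) by (simp add: X_def dist_norm)
        have near: "u \<in> uhp" "norm (u - X) < r" "norm (u - X) \<le> norm (z - X) + Im z / 2" if "u \<in> cball z (Im z / 2)" for u
        proof -
          have d1: "norm (u - z) \<le> Im z / 2" using that by (simp add: dist_norm norm_minus_commute)
          then have "\<bar>Im u - Im z\<bar> \<le> Im z / 2" using abs_Im_le_cmod[of "u - z"] by simp
          then have "0 < Im u" using y by linarith
          then show "u \<in> uhp" by (simp add: uhp_def)
          show n: "norm (u - X) \<le> norm (z - X) + Im z / 2"
            using norm_triangle_ineq[of "u - z" "z - X"] d1 by simp
          then show "norm (u - X) < r" using z(3) yr y unfolding dist_norm by linarith
        qed
        have "norm ((deriv ^^ 1) D z) \<le> fact 1 * (\<eta> * ((a + 1) * Im z + Im z / 2)) / (Im z / 2) ^ 1"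
        proof (rule Cauchy_inequality)
          have holD: "D holomorphic_on uhp" unfolding D_def by (intro holomorphic_intros holg)
          show "D holomorphic_on ball z (Im z / 2)"
            by (rule holomorphic_on_subset[OF holD]) (use near(1) in auto)
          show "continuous_on (cball z (Im z / 2)) D"
            by (rule continuous_on_subset[OF holomorphic_on_imp_continuous_on[OF holD]]) (use near(1) in auto)
          fix u assume "norm (z - u) = Im z / 2"
          then have u: "u \<in> cball z (Im z / 2)" by (simp add: dist_norm)
          have "norm (D u) \<le> \<eta> * norm (u - X)" unfolding D_def by (rule r(2)[OF near(1,2)[OF u]])
          also have "\<dots> \<le> \<eta> * ((a + 1) * Im z + Im z / 2)"
            using near(3)[OF u] nzX \<eta> by (intro mult_left_mono) auto
          finally show "norm (D u) \<le> \<eta> * ((a + 1) * Im z + Im z / 2)" .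
        qed (use y in auto)
        moreover have "\<eta> * ((a + 1) * Im z + Im z / 2) / (Im z / 2) = \<eta> * (2 * a + 3)"
          using y by (simp add: field_simps)
        moreover have "(D has_field_derivative (F z - d)) (at z)"
          unfolding D_def by (auto intro!: derivative_eq_intros dg[OF z(1)])
        ultimately have "norm (F z - d) \<le> \<eta> * (2 * a + 3)"
          by (simp add: DERIV_imp_deriv)
        also have "\<dots> = e / 2" using a by (simp add: \<eta>_def field_simps)
        finally show ?thesis using e by (simp add: dist_norm)
      qed
      then show "\<forall>\<^sub>F z in at X within {z \<in> uhp. \<bar>Re z - x\<bar> < a * Im z}. dist (F z) d < e"
        unfolding eventually_at using r(1) by (intro exI[of _ "r / 2"]) auto
    qed
    then show ?case unfolding X_def by blast
  qed
  moreover define f where "f x = (SOME d. \<forall>a>0. (F \<longlongrightarrow> d) (at (of_real x) within {z \<in> uhp. \<bar>Re z - x\<bar> < a * Im z}))" for x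
  ultimately have "boundary_fun F f"
    unfolding boundary_fun_def f_def by (elim eventually_mono) (rule someI_ex)
  then show ?thesis by blast
qed

section \<open>Outer functions\<close>

lemma pair_sigma_finite_lebesgue: "pair_sigma_finite (lebesgue :: real measure) (lebesgue :: real measure)"
proof -
  have "sigma_finite_measure (lebesgue :: real measure)"
  proof
    show "\<exists>A :: real set set. countable A \<and> A \<subseteq> sets lebesgue \<and> \<Union> A = space lebesgue \<and> (\<forall>a\<in>A. emeasure lebesgue a \<noteq> \<infinity>)"
    proof (intro exI conjI ballI)
      show "countable (range (\<lambda>n::nat. {- real n..real n}))" by simp
      show "\<Union> (range (\<lambda>n::nat. {- real n..real n})) = space lebesgue"
      proof -
        have "\<exists>n. x \<in> {- real n..real n}" for x
        proof -
          obtain n where "\<bar>x\<bar> \<le> real n" using real_arch_simple by blast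
          then show ?thesis by (intro exI[of _ n]) auto
        qed
        then show ?thesis by auto
      qed
    qed auto
  qed
  then show ?thesis by (simp add: pair_sigma_finite_def)
qed

lemma poisson_kernel_swap: "poisson_kernel (Complex s y) t = poisson_kernel (Complex t y) s"
  by (simp add: poisson_kernel_def power2_commute)

lemma poisson_kernel_pair_measurable [measurable]:
  "(\<lambda>(s, t). poisson_kernel (Complex s y) t) \<in> borel_measurable (lebesgue \<Otimes>\<^sub>M lebesgue)"
proof -
  have fst: "fst \<in> borel_measurable ((lebesgue :: real measure) \<Otimes>\<^sub>M (lebesgue :: real measure))"
    by (rule measurable_compose[OF measurable_fst]) (rule borel_measurable_lebesgue, simp)
  have snd: "snd \<in> borel_measurable ((lebesgue :: real measure) \<Otimes>\<^sub>M (lebesgue :: real measure))"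
    by (rule measurable_compose[OF measurable_snd]) (rule borel_measurable_lebesgue, simp)
  have "(\<lambda>x. y / (pi * ((fst x - snd x)\<^sup>2 + y\<^sup>2))) \<in> borel_measurable ((lebesgue :: real measure) \<Otimes>\<^sub>M (lebesgue :: real measure))"
    using fst snd by measurable
  then show ?thesis by (simp add: poisson_kernel_def case_prod_beta')
qed

text \<open>At a fixed height the kernel is symmetric, so Fubini's theorem moves the smoothing from
  \<open>w\<close> to the indicator. The indicator is continuous except at two points, whereas
  \<open>w\<close> is only measurable.\<close>

lemma poisson_interval_swap:
  assumes w: "w \<in> borel_measurable lebesgue" "\<And>t. \<bar>w t\<bar> \<le> M" and y: "y > 0"
  shows "(LINT s|lebesgue. indicator {a..b} s * poisson w (Complex s y)) =
         (LINT t|lebesgue. w t * poisson (indicator {a..b}) (Complex t y))"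
proof -
  interpret pair_sigma_finite "lebesgue :: real measure" "lebesgue :: real measure"
    by (rule pair_sigma_finite_lebesgue)
  define f where "f s t = indicator {a..b} s * (poisson_kernel (Complex s y) t * w t)" for s t
  have u: "Complex s y \<in> uhp" for s using y by (simp add: uhp_def)
  have M: "M \<ge> 0" using w(2)[of 0] by linarith
  have i: "integrable lebesgue (indicat_real {a..b})" for a b :: real
    using emeasure_lborel_Icc_eq[of a b] by (intro integrable_real_indicator) (auto split: if_splits)
  have wm: "(\<lambda>x. w (snd x)) \<in> borel_measurable ((lebesgue :: real measure) \<Otimes>\<^sub>M lebesgue)"
    by (rule measurable_compose[OF measurable_snd w(1)])
  have im: "(\<lambda>x. indicat_real {a..b} (fst x)) \<in> borel_measurable ((lebesgue :: real measure) \<Otimes>\<^sub>M (lebesgue :: real measure))"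
    by (rule measurable_compose[OF measurable_fst]) (use i in auto)
  have fm: "case_prod f \<in> borel_measurable (lebesgue \<Otimes>\<^sub>M lebesgue)"
    using borel_measurable_times[OF im borel_measurable_times[OF poisson_kernel_pair_measurable[of y] wm]]
    by (simp add: f_def case_prod_beta')
  have pw: "poisson_integrable w" by (rule poisson_integrable_bounded[OF w])
  have pw': "poisson_integrable (\<lambda>t. \<bar>w t\<bar>)" by (rule poisson_integrable_bounded[where M = M]) (use w in auto)
  have nf: "(LINT t|lebesgue. norm (f s t)) = indicator {a..b} s * poisson (\<lambda>t. \<bar>w t\<bar>) (Complex s y)" for s
    using poisson_kernel_nonneg[OF u[of s]] by (simp add: f_def poisson_def abs_mult)
  have "integrable (lebesgue \<Otimes>\<^sub>M lebesgue) (case_prod f)"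
  proof (rule Fubini_integrable[OF fm])
    show "AE s in lebesgue. integrable lebesgue (\<lambda>t. case_prod f (s, t))"
      using poisson_integrableD[OF pw u] by (auto simp: f_def)
    have m: "(\<lambda>s. LINT t|lebesgue. norm (f s t)) \<in> borel_measurable lebesgue"
      by (rule M1.borel_measurable_lebesgue_integral)
        (use measurable_compose[OF fm borel_measurable_norm] in \<open>simp add: case_prod_beta'\<close>)
    show "integrable lebesgue (\<lambda>s. LINT t|lebesgue. norm (case_prod f (s, t)))"
    proof (rule Bochner_Integration.integrable_bound[of _ "\<lambda>s. M * indicat_real {a..b} s"])
      have "0 \<le> poisson (\<lambda>t. \<bar>w t\<bar>) (Complex s y)" "poisson (\<lambda>t. \<bar>w t\<bar>) (Complex s y) \<le> M" for s
        using poisson_mono[OF pw' poisson_integrable_const[of M] u] poisson_mono[OF poisson_integrable_const[of 0] pw' u] w(2)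
        by (simp_all add: poisson_const u)
      then show "AE s in lebesgue. norm (LINT t|lebesgue. norm (case_prod f (s, t))) \<le> norm (M * indicat_real {a..b} s)"
        unfolding case_prod_conv nf using M by (intro AE_I2) (auto simp: indicator_def)
    qed (use i m in auto)
  qed
  then have "(LINT t|lebesgue. LINT s|lebesgue. f s t) = (LINT s|lebesgue. LINT t|lebesgue. f s t)"
    by (rule Fubini_integral)
  moreover have "(LINT t|lebesgue. f s t) = indicator {a..b} s * poisson w (Complex s y)" for s
    by (simp add: f_def poisson_def)
  moreover have "(LINT s|lebesgue. f s t) = w t * poisson (indicator {a..b}) (Complex t y)" for t
  proof -
    have "f s t = w t * (poisson_kernel (Complex t y) s * indicator {a..b} s)" for s
      by (simp add: f_def poisson_kernel_swap[of s])
    then show ?thesis by (simp add: poisson_def)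
  qed
  ultimately show ?thesis by simp
qed

text \<open>A dominating function uniform in the height. For \<open>\<bar>s\<bar> \<le> c\<close>
  one has \<open>1 + t^2 \<le> 2 * (1 + c^2) * (1 + (t - s)^2)\<close>, and \<open>(t - s)^2\<close>
  times the kernel is at most \<open>y / pi\<close>, hence at most 1. The factor
  \<open>1 + 2 * c\<close> is the mass of the kernel plus a bound for the length of the
  interval.\<close>

lemma poisson_indicator_decay:
  assumes y: "0 < y" "y \<le> 1" and c: "\<bar>a\<bar> \<le> c" "\<bar>b\<bar> \<le> c"
  shows "poisson (indicator {a..b}) (Complex t y) \<le> 2 * (1 + c\<^sup>2) * (1 + 2 * c) / (1 + t\<^sup>2)"
proof -
  have u: "Complex t y \<in> uhp" using y by (simp add: uhp_def)
  have c0: "c \<ge> 0" using c by linarith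
  have i: "integrable lebesgue (indicat_real {a..b})"
    using emeasure_lborel_Icc_eq[of a b] by (intro integrable_real_indicator) (auto split: if_splits)
  have im [measurable]: "indicat_real {a..b} \<in> borel_measurable lebesgue" using i by auto
  have pi: "poisson_integrable (indicat_real {a..b})"
    by (rule poisson_integrable_bounded[OF im, where M = 1]) (auto simp: indicator_def)
  have pw: "(1 + t\<^sup>2) * (poisson_kernel (Complex t y) s * indicator {a..b} s) \<le>
      2 * (1 + c\<^sup>2) * (poisson_kernel (Complex t y) s + indicator {a..b} s)" for s
  proof (cases "s \<in> {a..b}")
    case True
    then have s: "\<bar>s\<bar> \<le> c" using c by auto
    have s2: "s\<^sup>2 \<le> c\<^sup>2" using power_mono[OF s, of 2] by simp
    have "0 \<le> (t - 2 * s)\<^sup>2" by simp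
    then have "1 + t\<^sup>2 \<le> 1 + 2 * s\<^sup>2 + 2 * (t - s)\<^sup>2" by (simp add: power2_eq_square algebra_simps)
    also have "\<dots> \<le> 1 + 2 * c\<^sup>2 + 2 * (1 + c\<^sup>2) * (t - s)\<^sup>2"
      using s2 by (intro add_mono mult_right_mono) auto
    also have "\<dots> \<le> 2 * (1 + c\<^sup>2) + 2 * (1 + c\<^sup>2) * (t - s)\<^sup>2" by simp
    finally have "1 + t\<^sup>2 \<le> 2 * (1 + c\<^sup>2) * (1 + (t - s)\<^sup>2)" by (simp add: algebra_simps)
    then have "(1 + t\<^sup>2) * poisson_kernel (Complex t y) s \<le> 2 * (1 + c\<^sup>2) * (1 + (t - s)\<^sup>2) * poisson_kernel (Complex t y) s"
      using poisson_kernel_nonneg[OF u] by (rule mult_right_mono)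
    also have "\<dots> = 2 * (1 + c\<^sup>2) * (poisson_kernel (Complex t y) s + (t - s)\<^sup>2 * poisson_kernel (Complex t y) s)"
      by (simp add: algebra_simps)
    also have "\<dots> \<le> 2 * (1 + c\<^sup>2) * (poisson_kernel (Complex t y) s + 1)"
    proof -
      have d: "0 < (t - s)\<^sup>2 + y\<^sup>2" using y by (simp add: add_nonneg_pos)
      have "(t - s)\<^sup>2 * y \<le> (t - s)\<^sup>2 * 1" using y by (intro mult_left_mono) auto
      also have "\<dots> \<le> 1 * ((t - s)\<^sup>2 + y\<^sup>2)" by simp
      also have "\<dots> \<le> pi * ((t - s)\<^sup>2 + y\<^sup>2)" using d pi_ge_two by (intro mult_right_mono) auto
      finally have "(t - s)\<^sup>2 * poisson_kernel (Complex t y) s \<le> 1"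
        using d by (simp add: poisson_kernel_def divide_le_eq)
      then show ?thesis by (intro mult_left_mono) auto
    qed
    finally show ?thesis using True by simp
  next
    case False
    then show ?thesis using poisson_kernel_nonneg[OF u, of s] by simp
  qed
  have "(1 + t\<^sup>2) * poisson (indicator {a..b}) (Complex t y) =
      (LINT s|lebesgue. (1 + t\<^sup>2) * (poisson_kernel (Complex t y) s * indicator {a..b} s))"
    unfolding poisson_def by (rule integral_mult_right_zero[symmetric])
  also have "\<dots> \<le> (LINT s|lebesgue. 2 * (1 + c\<^sup>2) * (poisson_kernel (Complex t y) s + indicator {a..b} s))"
    by (intro integral_mono pw integrable_mult_right poisson_integrableD pi u Bochner_Integration.integrable_add
          poisson_kernel_integrable i)
  also have "\<dots> = 2 * (1 + c\<^sup>2) * (1 + measure lebesgue {a..b})"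
    using poisson_kernel_integral[OF u] poisson_kernel_integrable[OF u] i by simp
  also have "\<dots> \<le> 2 * (1 + c\<^sup>2) * (1 + 2 * c)"
    using c c0 by (intro mult_left_mono) (cases "a \<le> b"; auto)+
  finally show ?thesis by (simp add: pos_le_divide_eq mult.commute)
qed

text \<open>The limit is assumed to exist and only has to be identified, so testing against
  intervals suffices: dominated convergence gives the integrals of \<open>v\<close> on one side of
  \<open>poisson_interval_swap\<close> and those of \<open>w\<close> on the other.\<close>

lemma poisson_vertical_limit_AE:
  assumes w: "w \<in> borel_measurable lebesgue" "\<And>t. \<bar>w t\<bar> \<le> M"
    and v: "v \<in> borel_measurable lebesgue" "AE t in lebesgue. (\<lambda>n. poisson w (Complex t (1 / Suc n))) \<longlonglongrightarrow> v t"
  shows "AE t in lebesgue. v t = w t"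
proof -
  have M: "M \<ge> 0" using w(2)[of 0] by linarith
  have u: "Complex t (1 / Suc n) \<in> uhp" for t n by (simp add: uhp_def)
  have pw: "poisson_integrable w" by (rule poisson_integrable_bounded[OF w])
  have pb: "\<bar>poisson w z\<bar> \<le> M" if "z \<in> uhp" for z
    using poisson_mono[OF pw poisson_integrable_const[of M] that] poisson_mono[OF poisson_integrable_const[of "-M"] pw that] w(2)
    by (auto simp: poisson_const that abs_le_iff minus_le_iff)
  \<comment> \<open>The bound by \<open>M\<close> passes to the limit only almost everywhere;
    clamping gives a version that is bounded at every point.\<close>
  define v' where "v' t = max (- M) (min M (v t))" for t
  have v'm [measurable]: "v' \<in> borel_measurable lebesgue" unfolding v'_def using v(1) by measurable
  have v'b: "\<bar>v' t\<bar> \<le> M" for t using M by (auto simp: v'_def)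
  have vv': "AE t in lebesgue. v' t = v t"
    using v(2)
  proof eventually_elim
    case (elim t)
    have "\<bar>v t\<bar> \<le> M"
      by (rule LIMSEQ_le_const2[OF tendsto_rabs[OF elim]]) (use pb u in blast)
    then show ?case by (auto simp: v'_def)
  qed
  have i: "integrable lebesgue (indicat_real {a..b})" for a b :: real
    using emeasure_lborel_Icc_eq[of a b] by (intro integrable_real_indicator) (auto split: if_splits)
  have ib: "integrable lebesgue (\<lambda>t. indicator {a..b} t * h t)"
    if "h \<in> borel_measurable lebesgue" "\<And>t. \<bar>h t\<bar> \<le> M" for h :: "real \<Rightarrow> real" and a b
  proof (rule Bochner_Integration.integrable_bound)
    show "integrable lebesgue (\<lambda>t. M * indicat_real {a..b} t)" using i by simp
    show "(\<lambda>t. indicator {a..b} t * h t) \<in> borel_measurable lebesgue"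
      by (rule borel_measurable_times[OF _ that(1)]) (use i in auto)
    show "AE t in lebesgue. norm (indicator {a..b} t * h t) \<le> norm (M * indicat_real {a..b} t)"
      using that(2) M by (intro AE_I2) (auto simp: indicator_def)
  qed
  have eq: "(LINT t|lebesgue. indicator {a..b} t * v' t) = (LINT t|lebesgue. indicator {a..b} t * w t)" for a b :: real
  proof (rule LIMSEQ_unique)
    define c where "c = max \<bar>a\<bar> \<bar>b\<bar>"
    have im [measurable]: "indicat_real {a..b} \<in> borel_measurable lebesgue" using i by auto
    have w_meas [measurable]: "w \<in> borel_measurable lebesgue" by (rule w(1))
    have pim: "(\<lambda>t. poisson h (Complex t (1 / Suc n))) \<in> borel_measurable lebesgue" if "poisson_integrable h" for h n
    proof -
      have "continuous_on UNIV (\<lambda>t. Re (schwarz h (Complex t (1 / Suc n))))"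
        by (intro continuous_on_Re continuous_on_compose2[OF holomorphic_on_imp_continuous_on[OF schwarz_holomorphic[OF that]]])
           (auto intro!: continuous_intros simp: uhp_def Complex_eq)
      then show ?thesis
        using Re_schwarz[OF that u] by (intro borel_measurable_lebesgue borel_measurable_continuous_onI) simp
    qed
    have pind: "poisson_integrable (indicat_real {a..b})"
      by (rule poisson_integrable_bounded[OF im, where M = 1]) (auto simp: indicator_def)
    show "(\<lambda>n. LINT t|lebesgue. indicator {a..b} t * poisson w (Complex t (1 / Suc n))) \<longlonglongrightarrow> (LINT t|lebesgue. indicator {a..b} t * v' t)"
    proof (rule integral_dominated_convergence)
      show "integrable lebesgue (\<lambda>t. M * indicat_real {a..b} t)" using i by simp
      show "AE t in lebesgue. (\<lambda>n. indicator {a..b} t * poisson w (Complex t (1 / Suc n))) \<longlonglongrightarrow> indicator {a..b} t * v' t"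
        using v(2) vv' by eventually_elim (auto intro: tendsto_mult_left)
      show "AE t in lebesgue. norm (indicator {a..b} t * poisson w (Complex t (1 / Suc n))) \<le> M * indicat_real {a..b} t" for n
        using pb[OF u] by (intro AE_I2) (auto simp: indicator_def)
      show "(\<lambda>t. indicat_real {a..b} t * poisson w (Complex t (1 / Suc n))) \<in> borel_measurable lebesgue" for n
        by (rule borel_measurable_times[OF im pim[OF pw]])
    qed measurable
    have "(\<lambda>n. LINT t|lebesgue. w t * poisson (indicator {a..b}) (Complex t (1 / Suc n))) \<longlonglongrightarrow> (LINT t|lebesgue. w t * indicator {a..b} t)"
    proof (rule integral_dominated_convergence)
      show "integrable lebesgue (\<lambda>t. M * (2 * (1 + c\<^sup>2) * (1 + 2 * c)) / (1 + t\<^sup>2))" by (rule poisson_integrable_const)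
      have "AE t in lebesgue. t \<noteq> a" "AE t in lebesgue. t \<noteq> b"
        by (auto intro!: AE_not_in[of "{a}", simplified] AE_not_in[of "{b}", simplified])
      then show "AE t in lebesgue. (\<lambda>n. w t * poisson (indicator {a..b}) (Complex t (1 / Suc n))) \<longlonglongrightarrow> w t * indicator {a..b} t"
      proof eventually_elim
        case (elim t)
        have "isCont (indicat_real {a..b}) t"
        proof (cases "t \<in> {a..b}")
          case True
          then have "\<forall>\<^sub>F s in nhds t. s \<in> {a<..<b}" using elim by (intro eventually_nhds_in_open) auto
          then have "\<forall>\<^sub>F s in nhds t. indicat_real {a..b} s = 1" by eventually_elim auto
          then show ?thesis by (subst isCont_cong[of _ "\<lambda>_. 1"]) auto
        next
          case False
          then have "\<forall>\<^sub>F s in nhds t. s \<in> - {a..b}" by (intro eventually_nhds_in_open) auto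
          then have "\<forall>\<^sub>F s in nhds t. indicat_real {a..b} s = 0" by eventually_elim auto
          then show ?thesis by (subst isCont_cong[of _ "\<lambda>_. 0"]) auto
        qed
        then have "(poisson (indicat_real {a..b}) \<longlongrightarrow> indicator {a..b} t) (at (of_real t) within uhp)"
          by (rule poisson_tendsto[OF im, rotated]) (auto simp: indicator_def)
        moreover have "filterlim (\<lambda>n. Complex t (1 / Suc n)) (at (of_real t) within uhp) sequentially"
          unfolding filterlim_at
        proof
          have "(\<lambda>n. Complex t (1 / Suc n)) \<longlonglongrightarrow> Complex t 0"
            by (intro tendsto_Complex tendsto_const LIMSEQ_Suc lim_1_over_n)
          then show "(\<lambda>n. Complex t (1 / Suc n)) \<longlonglongrightarrow> of_real t"
            by (simp add: complex_of_real_def)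
        qed (auto simp: uhp_def complex_eq_iff)
        ultimately show ?case
          by (intro tendsto_mult_left) (rule filterlim_compose)
      qed
      show "AE t in lebesgue. norm (w t * poisson (indicator {a..b}) (Complex t (1 / Suc n))) \<le> M * (2 * (1 + c\<^sup>2) * (1 + 2 * c)) / (1 + t\<^sup>2)" for n
      proof (rule AE_I2)
        fix t
        have "0 \<le> poisson (indicat_real {a..b}) (Complex t (1 / Suc n))"
          using poisson_mono[OF poisson_integrable_const[of 0] pind u] unfolding poisson_const[OF u] by simp
        moreover have "poisson (indicat_real {a..b}) (Complex t (1 / Suc n)) \<le> 2 * (1 + c\<^sup>2) * (1 + 2 * c) / (1 + t\<^sup>2)"
          by (rule poisson_indicator_decay) (auto simp: c_def)
        ultimately have "\<bar>w t\<bar> * \<bar>poisson (indicat_real {a..b}) (Complex t (1 / Suc n))\<bar> \<le> M * (2 * (1 + c\<^sup>2) * (1 + 2 * c) / (1 + t\<^sup>2))"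
          using w(2) M by (intro mult_mono) auto
        then show "norm (w t * poisson (indicator {a..b}) (Complex t (1 / Suc n))) \<le> M * (2 * (1 + c\<^sup>2) * (1 + 2 * c)) / (1 + t\<^sup>2)"
          by (simp add: abs_mult)
      qed
      show "(\<lambda>t. w t * poisson (indicat_real {a..b}) (Complex t (1 / Suc n))) \<in> borel_measurable lebesgue" for n
        by (rule borel_measurable_times[OF w(1) pim[OF pind]])
    qed measurable
    then show "(\<lambda>n. LINT t|lebesgue. indicator {a..b} t * poisson w (Complex t (1 / Suc n))) \<longlonglongrightarrow> (LINT t|lebesgue. indicator {a..b} t * w t)"
      by (subst poisson_interval_swap[OF w]) (simp_all add: mult.commute)
  qed
  have hi: "(h has_integral (LINT t|lebesgue. indicator {a..b} t * h t)) {a..b}"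
    if "h \<in> borel_measurable lebesgue" "\<And>t. \<bar>h t\<bar> \<le> M" for h :: "real \<Rightarrow> real" and a b
  proof -
    have "((\<lambda>t. if t \<in> {a..b} then h t else 0) has_integral (LINT t|lebesgue. indicator {a..b} t * h t)) UNIV"
      by (rule has_integral_eq[OF _ has_integral_integral_lebesgue[OF ib[OF that, of a b]]]) (auto simp: indicator_def)
    then show ?thesis by (simp only: has_integral_restrict_UNIV)
  qed
  \<comment> \<open>All integrals of \<open>v' t - w t\<close> over intervals vanish, so the
    constant 0 is an indefinite integral of it, and Lebesgue differentiation returns the
    integrand.\<close>
  have "AE x in lebesgue. ((\<lambda>_. 0) has_real_derivative (v' x - w x)) (at x)"
  proof (rule indefinite_integral_derivative_AE)
    have d: "((\<lambda>t. v' t - w t) has_integral 0) {a..b}" for a b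
      using has_integral_diff[OF hi[OF v'm v'b, of a b] hi[OF w, of a b]] eq[of a b] by simp
    then show "(\<lambda>t. v' t - w t) integrable_on {a..b}" for a b by blast
    show "(0::real) - 0 = integral {x..y} (\<lambda>t. v' t - w t)" for x y using integral_unique[OF d] by simp
  qed
  then show ?thesis using vv'
  proof eventually_elim
    case (elim x)
    have "v' x - w x = 0" using DERIV_unique[OF elim(1) DERIV_const] .
    then show ?case using elim(2) by simp
  qed
qed

text \<open>The Smirnov class without the zero function, encoded by the logarithmic majorant instead
  of by quotients of bounded functions. Nonvanishing of \<open>f\<close> is explicit because
  \<open>ln 0 = 0\<close> would make the majorant meaningless.\<close>

definition smirnov :: "(complex \<Rightarrow> complex) \<Rightarrow> (real \<Rightarrow> complex) \<Rightarrow> bool" where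
  "smirnov F f \<longleftrightarrow> F holomorphic_on uhp \<and> boundary_fun F f \<and> (AE t in lebesgue. f t \<noteq> 0) \<and>
     poisson_integrable (\<lambda>t. ln (norm (f t))) \<and>
     (\<forall>z\<in>uhp. norm (F z) \<le> exp (poisson (\<lambda>t. ln (norm (f t))) z))"

text \<open>Only the modulus is prescribed, so unimodular constants such as the \<open>c\<close> of
  \<open>outer_ext\<close> need no bookkeeping when quotients are formed.\<close>

definition outer :: "(complex \<Rightarrow> complex) \<Rightarrow> (real \<Rightarrow> complex) \<Rightarrow> bool" where
  "outer F f \<longleftrightarrow> smirnov F f \<and> (\<forall>z\<in>uhp. norm (F z) = exp (poisson (\<lambda>t. ln (norm (f t))) z))"

lemma smirnovD:
  assumes "smirnov F f"
  shows "F holomorphic_on uhp" "boundary_fun F f" "AE t in lebesgue. f t \<noteq> 0"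
    "poisson_integrable (\<lambda>t. ln (norm (f t)))" "f \<in> borel_measurable lebesgue"
    "z \<in> uhp \<Longrightarrow> norm (F z) \<le> exp (poisson (\<lambda>t. ln (norm (f t))) z)"
  using assms boundary_fun_measurable[of F f] by (auto simp: smirnov_def)

lemma boundary_fun_mult:
  assumes "boundary_fun F f" "boundary_fun G g"
  shows "boundary_fun (\<lambda>z. F z * G z) (\<lambda>t. f t * g t)"
  using assms unfolding boundary_fun_def by eventually_elim (blast intro: tendsto_mult)

lemma boundary_fun_divide:
  assumes "boundary_fun F f" "boundary_fun G g" "AE t in lebesgue. g t \<noteq> 0"
  shows "boundary_fun (\<lambda>z. F z / G z) (\<lambda>t. f t / g t)"
  using assms unfolding boundary_fun_def by eventually_elim (blast intro: tendsto_divide)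

lemma boundary_fun_AE_cong:
  assumes "boundary_fun F f" "AE t in lebesgue. f t = g t"
  shows "boundary_fun F g"
  using assms unfolding boundary_fun_def by eventually_elim simp

lemma poisson_integrable_cong_AE:
  assumes "poisson_integrable u" "v \<in> borel_measurable lebesgue" "AE t in lebesgue. u t = v t"
  shows "poisson_integrable v"
proof (rule poisson_integrable_dominated[OF _ assms(2)])
  show "poisson_integrable (\<lambda>t. \<bar>u t\<bar>)" using integrable_abs[OF assms(1)] by simp
  show "AE t in lebesgue. \<bar>v t\<bar> \<le> \<bar>u t\<bar>" using assms(3) by eventually_elim simp
qed

text \<open>The exponent may be any a.e. version \<open>u\<close> of the log-modulus: with
  \<open>ln 0 = 0\<close>, sums of logarithms agree with logarithms of products only off the
  zeros.\<close>

lemma smirnovI: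
  assumes "F holomorphic_on uhp" "boundary_fun F f" "AE t in lebesgue. f t \<noteq> 0"
    and u: "poisson_integrable u" "AE t in lebesgue. u t = ln (norm (f t))"
    and le: "\<And>z. z \<in> uhp \<Longrightarrow> norm (F z) \<le> exp (poisson u z)"
  shows "smirnov F f"
proof -
  have [measurable]: "f \<in> borel_measurable lebesgue" by (rule boundary_fun_measurable[OF assms(1,2)])
  have lm: "(\<lambda>t. ln (norm (f t))) \<in> borel_measurable lebesgue" by measurable
  have "poisson u z = poisson (\<lambda>t. ln (norm (f t))) z" for z
    by (rule poisson_cong_AE[OF poisson_integrable_measurable[OF u(1)] lm u(2)])
  then show ?thesis
    using assms poisson_integrable_cong_AE[OF u(1) lm u(2)] by (simp add: smirnov_def)
qed

lemma outerI:
  assumes "F holomorphic_on uhp" "boundary_fun F f" "AE t in lebesgue. f t \<noteq> 0"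
    and u: "poisson_integrable u" "AE t in lebesgue. u t = ln (norm (f t))"
    and eq: "\<And>z. z \<in> uhp \<Longrightarrow> norm (F z) = exp (poisson u z)"
  shows "outer F f"
proof -
  have s: "smirnov F f" by (rule smirnovI[OF assms(1-5)]) (simp add: eq)
  have "poisson u z = poisson (\<lambda>t. ln (norm (f t))) z" for z
    by (rule poisson_cong_AE[OF poisson_integrable_measurable[OF u(1)] _ u(2)])
       (rule poisson_integrable_measurable[OF smirnovD(4)[OF s]])
  then show ?thesis using s eq by (simp add: outer_def)
qed

lemma outerD:
  assumes "outer F f"
  shows "smirnov F f" "z \<in> uhp \<Longrightarrow> norm (F z) = exp (poisson (\<lambda>t. ln (norm (f t))) z)"
  using assms by (simp_all add: outer_def)

lemma smirnov_mult:
  assumes F: "smirnov F f" and G: "smirnov G g"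
  shows "smirnov (\<lambda>z. F z * G z) (\<lambda>t. f t * g t)"
proof (rule smirnovI)
  show "(\<lambda>z. F z * G z) holomorphic_on uhp" by (intro holomorphic_intros smirnovD(1)[OF F] smirnovD(1)[OF G])
  show "boundary_fun (\<lambda>z. F z * G z) (\<lambda>t. f t * g t)" by (rule boundary_fun_mult[OF smirnovD(2)[OF F] smirnovD(2)[OF G]])
  show "AE t in lebesgue. f t * g t \<noteq> 0"
    using smirnovD(3)[OF F] smirnovD(3)[OF G] by eventually_elim simp
  show "poisson_integrable (\<lambda>t. ln (norm (f t)) + ln (norm (g t)))"
    by (rule poisson_integrable_add[OF smirnovD(4)[OF F] smirnovD(4)[OF G]])
  show "AE t in lebesgue. ln (norm (f t)) + ln (norm (g t)) = ln (norm (f t * g t))"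
    using smirnovD(3)[OF F] smirnovD(3)[OF G] by eventually_elim (simp add: norm_mult ln_mult)
  fix z assume z: "z \<in> uhp"
  have "norm (F z * G z) \<le> exp (poisson (\<lambda>t. ln (norm (f t))) z) * exp (poisson (\<lambda>t. ln (norm (g t))) z)"
    unfolding norm_mult using smirnovD(6)[OF F z] smirnovD(6)[OF G z] by (intro mult_mono) auto
  then show "norm (F z * G z) \<le> exp (poisson (\<lambda>t. ln (norm (f t)) + ln (norm (g t))) z)"
    by (simp add: poisson_add[OF smirnovD(4)[OF F] smirnovD(4)[OF G] z] exp_add)
qed

text \<open>Bounding a quotient from above takes a lower bound for the denominator; this is what
  equality in \<open>outer\<close> provides.\<close>

lemma smirnov_divide:
  assumes F: "smirnov F f" and G: "outer G g"
  shows "smirnov (\<lambda>z. F z / G z) (\<lambda>t. f t / g t)"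
proof (rule smirnovI)
  note Gs = outerD(1)[OF G]
  have nz: "G z \<noteq> 0" if "z \<in> uhp" for z using outerD(2)[OF G that] by auto
  show "(\<lambda>z. F z / G z) holomorphic_on uhp"
    using nz by (intro holomorphic_intros smirnovD(1)[OF F] smirnovD(1)[OF Gs])
  show "boundary_fun (\<lambda>z. F z / G z) (\<lambda>t. f t / g t)"
    by (rule boundary_fun_divide[OF smirnovD(2)[OF F] smirnovD(2)[OF Gs] smirnovD(3)[OF Gs]])
  show "AE t in lebesgue. f t / g t \<noteq> 0"
    using smirnovD(3)[OF F] smirnovD(3)[OF Gs] by eventually_elim simp
  show "poisson_integrable (\<lambda>t. ln (norm (f t)) - ln (norm (g t)))"
    using poisson_integrable_add[OF smirnovD(4)[OF F] poisson_integrable_cmult[OF smirnovD(4)[OF Gs], of "-1"]]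
    by simp
  show "AE t in lebesgue. ln (norm (f t)) - ln (norm (g t)) = ln (norm (f t / g t))"
    using smirnovD(3)[OF F] smirnovD(3)[OF Gs] by eventually_elim (simp add: norm_divide ln_div)
  fix z assume z: "z \<in> uhp"
  show "norm (F z / G z) \<le> exp (poisson (\<lambda>t. ln (norm (f t)) - ln (norm (g t))) z)"
    using smirnovD(6)[OF F z] outerD(2)[OF G z]
    by (simp add: poisson_diff[OF smirnovD(4)[OF F] smirnovD(4)[OF Gs] z] exp_diff norm_divide divide_right_mono)
qed

lemma outer_divide:
  assumes F: "outer F f" and G: "outer G g"
  shows "outer (\<lambda>z. F z / G z) (\<lambda>t. f t / g t)"
proof -
  note Fs = outerD(1)[OF F] and Gs = outerD(1)[OF G]
  have s: "smirnov (\<lambda>z. F z / G z) (\<lambda>t. f t / g t)" by (rule smirnov_divide[OF Fs G])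
  show ?thesis
  proof (rule outerI[OF smirnovD(1-3)[OF s]])
    show "poisson_integrable (\<lambda>t. ln (norm (f t)) - ln (norm (g t)))"
      using poisson_integrable_add[OF smirnovD(4)[OF Fs] poisson_integrable_cmult[OF smirnovD(4)[OF Gs], of "-1"]]
      by simp
    show "AE t in lebesgue. ln (norm (f t)) - ln (norm (g t)) = ln (norm (f t / g t))"
      using smirnovD(3)[OF Fs] smirnovD(3)[OF Gs] by eventually_elim (simp add: norm_divide ln_div)
    show "norm (F z / G z) = exp (poisson (\<lambda>t. ln (norm (f t)) - ln (norm (g t))) z)" if "z \<in> uhp" for z
      using outerD(2)[OF F that] outerD(2)[OF G that]
      by (simp add: poisson_diff[OF smirnovD(4)[OF Fs] smirnovD(4)[OF Gs] that] exp_diff norm_divide)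
  qed
qed

lemma boundary_fun_norm_le:
  assumes "boundary_fun F f" and "boundary_fun G g" and "\<And>z. z \<in> uhp \<Longrightarrow> norm (F z) \<le> norm (G z)"
  shows "AE t in lebesgue. norm (f t) \<le> norm (g t)"
  using boundary_fun_vertical[OF assms(1)] boundary_fun_vertical[OF assms(2)]
proof eventually_elim
  case (elim t)
  show ?case
    by (rule LIMSEQ_le[OF tendsto_norm[OF elim(1)] tendsto_norm[OF elim(2)]])
       (use assms(3) in \<open>auto simp: uhp_def\<close>)
qed

section \<open>Outer functions with prescribed boundary modulus\<close>

lemma exp_schwarz_boundary:
  assumes w: "poisson_integrable w" "\<And>t. 0 \<le> w t"
  obtains b where "boundary_fun (\<lambda>z. exp (- schwarz w z)) b"
    "(\<lambda>z. exp (- schwarz w z)) holomorphic_on uhp"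
    "\<And>z. z \<in> uhp \<Longrightarrow> norm (exp (- schwarz w z)) = exp (- poisson w z)"
    "\<And>z. z \<in> uhp \<Longrightarrow> norm (exp (- schwarz w z)) \<le> 1"
proof -
  have hol: "(\<lambda>z. exp (- schwarz w z)) holomorphic_on uhp"
    by (intro holomorphic_intros schwarz_holomorphic w)
  have n: "norm (exp (- schwarz w z)) = exp (- poisson w z)" if "z \<in> uhp" for z
    using that by (simp add: Re_schwarz w)
  have "norm (exp (- schwarz w z)) \<le> 1" if "z \<in> uhp" for z
    using n[OF that] poisson_mono[OF poisson_integrable_const[of 0] w(1) that] w(2) unfolding poisson_const[OF that] by simp
  with fatou_bounded[OF hol this] hol n show ?thesis using that by blast
qed

text \<open>For bounded \<open>w\<close> the modulus stays above \<open>exp (- M)\<close>, so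
  logarithms can be taken in the vertical limit. This shows that the Poisson integral of
  \<open>w\<close> converges, and \<open>poisson_vertical_limit_AE\<close> identifies its limit as
  \<open>w\<close>.\<close>

lemma exp_schwarz_boundary_bounded:
  assumes w: "w \<in> borel_measurable lebesgue" "\<And>t. 0 \<le> w t" "\<And>t. w t \<le> M"
    and b: "boundary_fun (\<lambda>z. exp (- schwarz w z)) b"
  shows "AE t in lebesgue. norm (b t) = exp (- w t)"
proof -
  have wM: "\<bar>w t\<bar> \<le> M" for t using w(2,3)[of t] by simp
  have pw: "poisson_integrable w" by (rule poisson_integrable_bounded[OF w(1) wM])
  have hol: "(\<lambda>z. exp (- schwarz w z)) holomorphic_on uhp"
    by (intro holomorphic_intros schwarz_holomorphic pw)
  have [measurable]: "b \<in> borel_measurable lebesgue" by (rule boundary_fun_measurable[OF hol b])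
  have lower: "AE t in lebesgue. exp (- M) \<le> norm (b t)"
    using boundary_fun_vertical[OF b]
  proof eventually_elim
    case (elim t)
    show ?case
    proof (rule LIMSEQ_le_const[OF tendsto_norm[OF elim]], intro exI[of _ 0] allI impI)
      fix n
      have u: "Complex t (1 / Suc n) \<in> uhp" by (simp add: uhp_def)
      have "poisson w (Complex t (1 / Suc n)) \<le> M"
        using poisson_mono[OF pw poisson_integrable_const[of M] u] w(3) unfolding poisson_const[OF u] by simp
      then show "exp (- M) \<le> norm (exp (- schwarz w (Complex t (1 / Suc n))))"
        using Re_schwarz[OF pw u] by simp
    qed
  qed
  have "AE t in lebesgue. (\<lambda>n. poisson w (Complex t (1 / Suc n))) \<longlonglongrightarrow> - ln (norm (b t))"
    using boundary_fun_vertical[OF b] lower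
  proof eventually_elim
    case (elim t)
    have "norm (b t) \<noteq> 0" using elim(2) exp_gt_zero[of "- M"] by linarith
    then have "(\<lambda>n. - ln (norm (exp (- schwarz w (Complex t (1 / Suc n)))))) \<longlonglongrightarrow> - ln (norm (b t))"
      by (intro tendsto_intros elim)
    moreover have "- ln (norm (exp (- schwarz w (Complex t (1 / Suc n))))) = poisson w (Complex t (1 / Suc n))" for n
      using Re_schwarz[OF pw, of "Complex t (1 / Suc n)"] by (simp add: uhp_def)
    ultimately show ?case by (simp only:)
  qed
  then have "AE t in lebesgue. - ln (norm (b t)) = w t"
    by (intro poisson_vertical_limit_AE[OF w(1) wM]) measurable
  then show ?thesis using lower
  proof eventually_elim
    case (elim t)
    have "0 < norm (b t)" using elim(2) exp_gt_zero[of "- M"] by linarith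
    then show ?case using elim(1) by (metis exp_ln minus_minus)
  qed
qed

text \<open>Truncations of \<open>w\<close> give \<open>\<bar>b\<bar> \<le> exp (- w)\<close> and the log-majorant inequality at \<open>\<i>\<close> gives
  \<open>\<integral> ln \<bar>b\<bar> \<ge> - \<integral> w\<close> for the Poisson measure.\<close>

lemma exp_schwarz_outer:
  assumes w: "poisson_integrable w" "\<And>t. 0 \<le> w t"
  obtains b where "outer (\<lambda>z. exp (- schwarz w z)) b" "AE t in lebesgue. norm (b t) = exp (- w t)"
proof -
  obtain b where b: "boundary_fun (\<lambda>z. exp (- schwarz w z)) b"
    and hol: "(\<lambda>z. exp (- schwarz w z)) holomorphic_on uhp"
    and n: "\<And>z. z \<in> uhp \<Longrightarrow> norm (exp (- schwarz w z)) = exp (- poisson w z)"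
    and n1: "\<And>z. z \<in> uhp \<Longrightarrow> norm (exp (- schwarz w z)) \<le> 1"
    using exp_schwarz_boundary[OF w] by blast
  have wm [measurable]: "w \<in> borel_measurable lebesgue" by (rule poisson_integrable_measurable[OF w(1)])
  have bm [measurable]: "b \<in> borel_measurable lebesgue" by (rule boundary_fun_measurable[OF hol b])
  have le: "AE t in lebesgue. norm (b t) \<le> exp (- min (w t) (real k))" for k
  proof -
    define u where "u t = min (w t) (real k)" for t
    have um: "u \<in> borel_measurable lebesgue" unfolding u_def by measurable
    have u0: "0 \<le> u t" "u t \<le> real k" for t using w(2) by (auto simp: u_def)
    have pu: "poisson_integrable u" by (rule poisson_integrable_bounded[OF um, of "real k"]) (use u0 in simp)
    obtain c where c: "boundary_fun (\<lambda>z. exp (- schwarz u z)) c"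
      and nc: "\<And>z. z \<in> uhp \<Longrightarrow> norm (exp (- schwarz u z)) = exp (- poisson u z)"
      using exp_schwarz_boundary[OF pu u0(1)] by blast
    have "AE t in lebesgue. norm (b t) \<le> norm (c t)"
    proof (rule boundary_fun_norm_le[OF b c])
      fix z assume that: "z \<in> uhp"
      show "norm (exp (- schwarz w z)) \<le> norm (exp (- schwarz u z))"
    proof -
      have "poisson u z \<le> poisson w z"
        by (rule poisson_mono[OF pu w(1) that]) (simp add: u_def)
      then show ?thesis unfolding n[OF that] nc[OF that] by simp
    qed
    qed
    with exp_schwarz_boundary_bounded[OF um u0 c]
    show ?thesis by eventually_elim (simp add: u_def)
  qed
  have lew: "AE t in lebesgue. norm (b t) \<le> exp (- w t)"
  proof -
    have "AE t in lebesgue. \<forall>k. norm (b t) \<le> exp (- min (w t) (real k))"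
      using le by (simp add: AE_all_countable)
    then show ?thesis
    proof eventually_elim
      case (elim t)
      obtain k where "w t \<le> real k" using real_arch_simple by blast
      then show ?case using elim[rule_format, of k] by (simp add: min_def)
    qed
  qed
  have "norm (b t) \<le> 1" if "norm (b t) \<le> exp (- w t)" for t
    using that w(2)[of t] by (meson exp_le_one_iff neg_le_0_iff_le order_trans)
  with lew have le1: "AE t in lebesgue. \<bar>norm (b t)\<bar> \<le> 1" by (auto elim: eventually_mono)
  have pb: "poisson_integrable (\<lambda>t. norm (b t))"
    by (rule poisson_integrable_dominated[OF poisson_integrable_const[of 1] _ le1]) measurable
  have i: "\<i> \<in> uhp" by (simp add: uhp_def)
  have sb: "shifts_bounded (\<lambda>z. exp (- schwarz w z))" by (rule bounded_shifts_bounded[OF hol n1])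
  note maj = poisson_log_majorant[OF hol sb b pb i exp_not_eq_zero]
  have lnle: "AE t in lebesgue. ln (norm (b t)) \<le> - w t"
    using lew maj(1)
  proof eventually_elim
    case (elim t)
    then show ?case by (metis ln_exp ln_mono zero_less_norm_iff)
  qed
  \<comment> \<open>\<open>h\<close> is nonnegative almost everywhere by \<open>lnle\<close>, while
    its Poisson integral at \<open>\<i>\<close> is at most 0; as the kernel is positive,
    \<open>h\<close> vanishes almost everywhere.\<close>
  define h where "h t = - w t - ln (norm (b t))" for t
  have ph: "poisson_integrable h"
    unfolding h_def
    using poisson_integrable_add[OF poisson_integrable_cmult[OF w(1), of "-1"] poisson_integrable_cmult[OF maj(2), of "-1"]]
    by simp
  have "poisson h \<i> = - poisson w \<i> - poisson (\<lambda>t. ln (norm (b t))) \<i>"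
    unfolding h_def using poisson_diff[OF poisson_integrable_cmult[OF w(1), of "-1"] maj(2) i]
    by (simp add: poisson_uminus)
  moreover have "exp (- poisson w \<i>) \<le> exp (poisson (\<lambda>t. ln (norm (b t))) \<i>)"
    using maj(3)[OF i] n[OF i] by simp
  ultimately have "poisson h \<i> \<le> 0" by simp
  have h0: "AE t in lebesgue. 0 \<le> poisson_kernel \<i> t * h t"
    using lnle by eventually_elim (simp add: h_def poisson_kernel_nonneg[OF i])
  have "(LINT t|lebesgue. poisson_kernel \<i> t * h t) = 0"
    using \<open>poisson h \<i> \<le> 0\<close> integral_nonneg_AE[OF h0] by (simp add: poisson_def)
  then have "AE t in lebesgue. poisson_kernel \<i> t * h t = 0"
    using integral_nonneg_eq_0_iff_AE[OF poisson_integrableD[OF ph i] h0] by simp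
  then have lnw: "AE t in lebesgue. - w t = ln (norm (b t))"
  proof eventually_elim
    case (elim t)
    then show ?case using poisson_kernel_pos[OF i, of t] by (simp add: h_def)
  qed
  have "outer (\<lambda>z. exp (- schwarz w z)) b"
  proof (rule outerI[OF hol b maj(1) _ lnw])
    show "poisson_integrable (\<lambda>t. - w t)" using w(1) by simp
    show "norm (exp (- schwarz w z)) = exp (poisson (\<lambda>t. - w t) z)" if "z \<in> uhp" for z
      using n[OF that] by (simp add: poisson_uminus)
  qed
  moreover have "AE t in lebesgue. norm (b t) = exp (- w t)"
    using lnw maj(1)
  proof eventually_elim
    case (elim t)
    then show ?case by simp
  qed
  ultimately show ?thesis using that by blast
qed

text \<open>Boundary values are available for bounded functions only, so \<open>w\<close> is split
  into positive and negative parts. Each gives an outer function bounded by 1, and their quotient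
  has modulus \<open>exp (w t)\<close>.\<close>

proposition outer_exists:
  assumes w: "poisson_integrable w"
  obtains F f where "outer F f" "AE t in lebesgue. norm (f t) = exp (w t)"
proof -
  have wm [measurable]: "w \<in> borel_measurable lebesgue" by (rule poisson_integrable_measurable[OF w])
  have pa: "poisson_integrable (\<lambda>t. \<bar>w t\<bar>)" using integrable_abs[OF w] by simp
  have p1: "poisson_integrable (\<lambda>t. max (w t) 0)" and p2: "poisson_integrable (\<lambda>t. max (- w t) 0)"
    by (auto intro!: poisson_integrable_dominated[OF pa] AE_I2 borel_measurable_max wm borel_measurable_uminus)
  obtain b1 where b1: "outer (\<lambda>z. exp (- schwarz (\<lambda>t. max (w t) 0) z)) b1" "AE t in lebesgue. norm (b1 t) = exp (- max (w t) 0)"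
    using exp_schwarz_outer[OF p1] by auto
  obtain b2 where b2: "outer (\<lambda>z. exp (- schwarz (\<lambda>t. max (- w t) 0) z)) b2" "AE t in lebesgue. norm (b2 t) = exp (- max (- w t) 0)"
    using exp_schwarz_outer[OF p2] by auto
  have "AE t in lebesgue. norm (b2 t / b1 t) = exp (w t)"
    using b1(2) b2(2) by eventually_elim (auto simp: norm_divide max_def simp flip: exp_diff)
  with outer_divide[OF b2(1) b1(1)] show ?thesis using that by blast
qed

lemma outer_fun_outer:
  assumes "outer_fun Q"
  obtains F where "outer F Q"
proof -
  obtain c where Q: "Q \<in> borel_measurable lebesgue" "AE t in lebesgue. Q t \<noteq> 0"
    "integrable lebesgue (\<lambda>t. \<bar>ln (norm (Q t))\<bar> / (1 + t\<^sup>2))" "norm c = 1"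
    and b: "boundary_fun (outer_ext c (\<lambda>t. norm (Q t))) Q"
    using assms unfolding outer_fun_def by blast
  note [measurable] = Q(1)
  have p: "poisson_integrable (\<lambda>t. ln (norm (Q t)))"
    by (rule poisson_integrable_dominated[OF Q(3)]) auto
  have "outer (outer_ext c (\<lambda>t. norm (Q t))) Q"
  proof (rule outerI[OF _ b Q(2) p])
    show "outer_ext c (\<lambda>t. norm (Q t)) holomorphic_on uhp"
      unfolding outer_ext_schwarz by (intro holomorphic_intros schwarz_holomorphic p)
    show "norm (outer_ext c (\<lambda>t. norm (Q t)) z) = exp (poisson (\<lambda>t. ln (norm (Q t))) z)" if "z \<in> uhp" for z
      using Q(4) Re_schwarz[OF p that] by (simp add: outer_ext_schwarz norm_mult)
  qed simp
  then show ?thesis by (rule that)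
qed

section \<open>Hardy spaces and minimal kernels\<close>

lemma Lp_AE_cong:
  assumes "f \<in> Lp p" "AE t in lebesgue. f t = g t"
  shows "g \<in> Lp p"
proof -
  have f: "f \<in> borel_measurable lebesgue" "integrable lebesgue (\<lambda>x. norm (f x) powr p)"
    using assms(1) by (auto simp: Lp_def)
  have [measurable]: "g \<in> borel_measurable lebesgue" by (rule borel_measurable_AE[OF f(1) assms(2)])
  have "integrable lebesgue (\<lambda>x. norm (g x) powr p)"
    by (rule integrable_cong_AE_imp[OF f(2)]) (measurable, use assms(2) in \<open>auto elim: eventually_mono\<close>)
  then show ?thesis by (simp add: Lp_def)
qed

lemma Lp_dominated:
  assumes "f \<in> Lp p" "0 \<le> p" "g \<in> borel_measurable lebesgue" "AE t in lebesgue. norm (g t) \<le> c * norm (f t)"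
  shows "g \<in> Lp p"
proof -
  have f [measurable]: "f \<in> borel_measurable lebesgue" and i: "integrable lebesgue (\<lambda>x. norm (f x) powr p)"
    using assms(1) by (auto simp: Lp_def)
  note [measurable] = assms(3)
  have "integrable lebesgue (\<lambda>x. norm (g x) powr p)"
  proof (rule Bochner_Integration.integrable_bound)
    show "integrable lebesgue (\<lambda>x. \<bar>c\<bar> powr p * norm (f x) powr p)" by (rule integrable_mult_right[OF i])
    show "AE x in lebesgue. norm (norm (g x) powr p) \<le> norm (\<bar>c\<bar> powr p * norm (f x) powr p)"
      using assms(4)
    proof eventually_elim
      case (elim x)
      have "norm (g x) \<le> \<bar>c\<bar> * norm (f x)"
        using elim mult_right_mono[OF abs_ge_self[of c] norm_ge_zero[of "f x"]] by linarith
      then have "norm (g x) powr p \<le> (\<bar>c\<bar> * norm (f x)) powr p" using assms(2) by (intro powr_mono2) auto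
      then show ?case by (simp add: powr_mult)
    qed
  qed measurable
  then show ?thesis by (simp add: Lp_def)
qed

lemma Hp_plus_Lp: "f \<in> Hp_plus p \<Longrightarrow> f \<in> Lp p"
  by (simp add: Hp_plus_def)

lemma Lp_measurable: "f \<in> Lp p \<Longrightarrow> f \<in> borel_measurable lebesgue"
  by (simp add: Lp_def)

lemma Hp_plus_AE_cong:
  assumes "f \<in> Hp_plus p" "AE t in lebesgue. f t = g t"
  shows "g \<in> Hp_plus p"
  using assms Lp_AE_cong boundary_fun_AE_cong unfolding Hp_plus_def by blast

lemma Hp_minus_iff: "f \<in> Hp_minus p \<longleftrightarrow> (\<lambda>x. cnj (f x)) \<in> Hp_plus p"
  unfolding Hp_minus_def by (force intro: image_eqI[where x = "\<lambda>x. cnj (f x)"])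

text \<open>Functions vanishing almost everywhere are put back, so that the class contains all of
  \<open>Hp_plus p\<close> for \<open>1 \<le> p\<close> and is closed under products without side
  conditions.\<close>

definition smirnov_class :: "(real \<Rightarrow> complex) set" where
  "smirnov_class = {f. (\<exists>F. smirnov F f) \<or> (AE t in lebesgue. f t = 0)}"

lemma smirnov_class_mult:
  assumes "f \<in> smirnov_class" "g \<in> smirnov_class"
  shows "(\<lambda>t. f t * g t) \<in> smirnov_class"
proof (cases "(AE t in lebesgue. f t = 0) \<or> (AE t in lebesgue. g t = 0)")
  case True
  then have "AE t in lebesgue. f t * g t = 0" by (auto elim: eventually_mono)
  then show ?thesis by (simp add: smirnov_class_def)
next
  case False
  then show ?thesis using assms smirnov_mult unfolding smirnov_class_def by blast
qed

lemma smirnov_class_divide: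
  assumes "f \<in> smirnov_class" "outer G g"
  shows "(\<lambda>t. f t / g t) \<in> smirnov_class"
proof (cases "AE t in lebesgue. f t = 0")
  case True
  then have "AE t in lebesgue. f t / g t = 0" by (auto elim: eventually_mono)
  then show ?thesis by (simp add: smirnov_class_def)
next
  case False
  then show ?thesis using assms smirnov_divide unfolding smirnov_class_def by blast
qed

lemma outer_smirnov_class: "outer G g \<Longrightarrow> g \<in> smirnov_class"
  using outerD(1) unfolding smirnov_class_def by blast

text \<open>If \<open>F\<close> vanished identically, its vertical limits would give
  \<open>f = 0\<close> almost everywhere; hence there is a point at which
  \<open>poisson_log_majorant\<close> can start.\<close>

lemma Hp_plus_smirnov:
  assumes "f \<in> Hp_plus p" "1 \<le> p" "nonzero_fun f"
  obtains F where "smirnov F f"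
proof -
  obtain F where F: "F \<in> hardy_hol p" "boundary_fun F f" and fL: "f \<in> Lp p"
    using assms(1) unfolding Hp_plus_def by blast
  have hol: "F holomorphic_on uhp" using F(1) by (simp add: hardy_hol_def)
  obtain z1 where z1: "z1 \<in> uhp" "F z1 \<noteq> 0"
  proof (rule ccontr)
    assume "\<not> thesis"
    then have F0: "F z = 0" if "z \<in> uhp" for z using that \<open>\<And>z1. z1 \<in> uhp \<Longrightarrow> F z1 \<noteq> 0 \<Longrightarrow> thesis\<close> by blast
    have "AE t in lebesgue. f t = 0"
      using boundary_fun_vertical[OF F(2)]
    proof eventually_elim
      case (elim t)
      then have "(\<lambda>n::nat. 0) \<longlonglongrightarrow> f t" by (simp add: F0 uhp_def)
      then show ?case using LIMSEQ_unique tendsto_const by blast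
    qed
    then show False using assms(3) by (simp add: nonzero_fun_def)
  qed
  note maj = poisson_log_majorant[OF hol hardy_hol_shifts_bounded[OF F(1) assms(2)] F(2)
      Lp_poisson_integrable(1)[OF fL assms(2)] z1]
  have "smirnov F f"
    unfolding smirnov_def using hol F(2) maj by blast
  then show ?thesis by (rule that)
qed

lemma Hp_plus_smirnov_class: "f \<in> Hp_plus p \<Longrightarrow> 1 \<le> p \<Longrightarrow> f \<in> smirnov_class"
  using Hp_plus_smirnov unfolding smirnov_class_def nonzero_fun_def by blast

text \<open>Smirnov's theorem: \<open>\<bar>F\<bar>\<^sup>p\<close> is dominated by the Poisson integral of \<open>\<bar>f\<bar>\<^sup>p\<close>.\<close>

proposition smirnov_Hp_plus:
  assumes F: "smirnov F f" and fL: "f \<in> Lp p" and p: "0 < p"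
  shows "f \<in> Hp_plus p"
proof -
  interpret pair_sigma_finite "lebesgue :: real measure" "lebesgue :: real measure"
    by (rule pair_sigma_finite_lebesgue)
  note hol = smirnovD(1)[OF F]
  define g where "g t = norm (f t) powr p" for t
  have ig: "integrable lebesgue g" using fL by (simp add: Lp_def g_def[abs_def])
  have gm [measurable]: "g \<in> borel_measurable lebesgue" using ig by auto
  have g0: "0 \<le> g t" for t by (simp add: g_def)
  have pg: "poisson_integrable g"
  proof (rule Bochner_Integration.integrable_bound[OF ig])
    show "(\<lambda>t. g t / (1 + t\<^sup>2)) \<in> borel_measurable lebesgue"
      by (rule borel_measurable_divide[OF gm]) (rule borel_measurable_lebesgue, measurable)
    show "AE t in lebesgue. norm (g t / (1 + t\<^sup>2)) \<le> norm (g t)"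
      using divide_left_mono[of 1 "1 + _\<^sup>2" "g _"] g0 by (auto simp: add_nonneg_nonneg)
  qed
  \<comment> \<open>The exponent for Jensen's inequality. \<open>exp (u t)\<close> is
    \<open>g t\<close> only where \<open>f t \<noteq> 0\<close>, hence the a.e. identities
    below.\<close>
  define u where "u t = p * ln (norm (f t))" for t
  have pu: "poisson_integrable u" unfolding u_def by (rule poisson_integrable_cmult[OF smirnovD(4)[OF F]])
  have ug: "AE t in lebesgue. g t = exp (u t)"
    using smirnovD(3)[OF F] by eventually_elim (simp add: g_def u_def powr_def)
  have um [measurable]: "u \<in> borel_measurable lebesgue" by (rule poisson_integrable_measurable[OF pu])
  have peu: "poisson_integrable (\<lambda>t. exp (u t))"
    by (rule poisson_integrable_cong_AE[OF pg _ ug]) measurable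
  have bound: "norm (F z) powr p \<le> poisson g z" if z: "z \<in> uhp" for z
  proof -
    have "norm (F z) powr p \<le> exp (poisson (\<lambda>t. ln (norm (f t))) z) powr p"
      using smirnovD(6)[OF F z] p by (intro powr_mono2) auto
    also have "\<dots> = exp (poisson u z)"
      by (simp add: powr_def u_def[abs_def] poisson_cmult)
    also have "\<dots> \<le> poisson (\<lambda>t. exp (u t)) z" by (rule exp_poisson_le[OF pu peu z])
    also have "\<dots> = poisson g z" by (rule poisson_cong_AE) (use ug in \<open>auto elim: eventually_mono\<close>)
    finally show ?thesis .
  qed
  have "F \<in> hardy_hol p" unfolding hardy_hol_def
  proof (intro CollectI conjI hol exI[of _ "LINT t|lebesgue. g t"] allI impI)
    fix y :: real assume y: "y > 0"
    have u: "Complex t y \<in> uhp" for t using y by (simp add: uhp_def)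
    have "continuous_on UNIV (\<lambda>x. F (Complex x y))"
      by (rule continuous_on_compose2[OF holomorphic_on_imp_continuous_on[OF hol]])
         (use y in \<open>auto intro!: continuous_intros simp: uhp_def Complex_eq\<close>)
    then have Fm [measurable]: "(\<lambda>x. F (Complex x y)) \<in> borel_measurable lebesgue"
      by (intro borel_measurable_lebesgue borel_measurable_continuous_onI)
    have gm2: "(\<lambda>x. g (snd x)) \<in> borel_measurable ((lebesgue :: real measure) \<Otimes>\<^sub>M lebesgue)"
      by (rule measurable_compose[OF measurable_snd gm])
    have m2: "(\<lambda>(x, t). ennreal (poisson_kernel (Complex x y) t * g t)) \<in> borel_measurable (lebesgue \<Otimes>\<^sub>M lebesgue)"
      using borel_measurable_times[OF poisson_kernel_pair_measurable[of y] gm2] by (simp add: case_prod_beta')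
    \<comment> \<open>By symmetry the kernel also has integral 1 in \<open>x\<close>, so Tonelli's
      theorem bounds the mean on every line by the integral of \<open>g\<close>. Nonnegative
      integrals come first because integrability on the line is part of the claim.\<close>
    have "(\<integral>\<^sup>+x. ennreal (norm (F (Complex x y)) powr p) \<partial>lebesgue) \<le>
        (\<integral>\<^sup>+x. (\<integral>\<^sup>+t. ennreal (poisson_kernel (Complex x y) t * g t) \<partial>lebesgue) \<partial>lebesgue)"
    proof (rule nn_integral_mono)
      fix x
      have "(\<integral>\<^sup>+t. ennreal (poisson_kernel (Complex x y) t * g t) \<partial>lebesgue) = ennreal (poisson g (Complex x y))"
        unfolding poisson_def using poisson_integrableD[OF pg u] g0 poisson_kernel_nonneg[OF u]
        by (intro nn_integral_eq_integral) auto
      then show "ennreal (norm (F (Complex x y)) powr p) \<le> (\<integral>\<^sup>+t. ennreal (poisson_kernel (Complex x y) t * g t) \<partial>lebesgue)"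
        using bound[OF u] by (simp add: ennreal_leI)
    qed
    also have "\<dots> = (\<integral>\<^sup>+t. (\<integral>\<^sup>+x. ennreal (poisson_kernel (Complex x y) t * g t) \<partial>lebesgue) \<partial>lebesgue)"
      by (rule Fubini'[OF m2, symmetric])
    also have "\<dots> = (\<integral>\<^sup>+t. ennreal (g t) \<partial>lebesgue)"
    proof (rule nn_integral_cong)
      fix t
      have "(\<integral>\<^sup>+x. ennreal (poisson_kernel (Complex x y) t * g t) \<partial>lebesgue) =
            (\<integral>\<^sup>+x. ennreal (g t * poisson_kernel (Complex t y) x) \<partial>lebesgue)"
        by (simp add: poisson_kernel_swap[of _ y t] mult.commute)
      also have "\<dots> = ennreal (LINT x|lebesgue. g t * poisson_kernel (Complex t y) x)"
        using poisson_kernel_integrable[OF u] g0 poisson_kernel_nonneg[OF u]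
        by (intro nn_integral_eq_integral) auto
      also have "\<dots> = ennreal (g t)" using poisson_kernel_integral[OF u] by simp
      finally show "(\<integral>\<^sup>+x. ennreal (poisson_kernel (Complex x y) t * g t) \<partial>lebesgue) = ennreal (g t)" .
    qed
    also have "\<dots> = ennreal (LINT t|lebesgue. g t)"
      using ig g0 by (intro nn_integral_eq_integral) auto
    finally have nn: "(\<integral>\<^sup>+x. ennreal (norm (F (Complex x y)) powr p) \<partial>lebesgue) \<le> ennreal (LINT t|lebesgue. g t)" .
    have i: "integrable lebesgue (\<lambda>x. norm (F (Complex x y)) powr p)"
      by (rule integrableI_nonneg) (measurable, use nn in \<open>auto simp: le_less_trans\<close>)
    then show "(\<lambda>x. F (Complex x y)) \<in> Lp p" by (simp add: Lp_def)
    have "ennreal (LINT x|lebesgue. norm (F (Complex x y)) powr p) \<le> ennreal (LINT t|lebesgue. g t)"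
      using nn i by (subst nn_integral_eq_integral[symmetric]) auto
    then show "(LINT x|lebesgue. norm (F (Complex x y)) powr p) \<le> (LINT t|lebesgue. g t)"
      using g0 by (subst (asm) ennreal_le_iff) auto
  qed
  then show ?thesis using fL smirnovD(2)[OF F] unfolding Hp_plus_def by blast
qed

lemma smirnov_class_Hp_plus:
  assumes "f \<in> smirnov_class" "f \<in> Lp p" "0 < p"
  shows "f \<in> Hp_plus p"
proof (cases "AE t in lebesgue. f t = 0")
  case True
  then show ?thesis using Hp_plus_AE_cong[OF zero_in_Hp_plus] by (auto elim: eventually_mono)
next
  case False
  then show ?thesis using assms smirnov_Hp_plus unfolding smirnov_class_def by blast
qed

lemma cnj_measurable [measurable]:
  "f \<in> borel_measurable M \<Longrightarrow> (\<lambda>x. cnj (f x)) \<in> borel_measurable M"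
  by (rule borel_measurable_continuous_on[of cnj]) (intro continuous_intros)

section \<open>Minimal kernels for bounded symbols and for symbols dominated by
  \<open>Q\<close>\<close>

theorem corollary4p2:
  fixes p :: real and f Q :: "real \<Rightarrow> complex"
  assumes "1 < p"
    and "f \<in> Hp_plus p" and "nonzero_fun f"
    and "outer_fun Q" and "bounded_away_from_zero Q"
    and "(\<lambda>x. Q x * f x) \<in> Hp_plus p"
  shows "K_min_Q p Q f = K_min p f \<inter> D_class p Q"
proof -
  have p: "1 \<le> p" "0 < p" "0 \<le> p" using assms(1) by auto
  obtain F where F: "smirnov F f" using Hp_plus_smirnov[OF assms(2) p(1) assms(3)] .
  obtain E e where e: "outer E e" and "AE t in lebesgue. norm (e t) = exp (ln (norm (f t)))"
    using outer_exists[OF smirnovD(4)[OF F]] .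
  then have norm_e: "AE t in lebesgue. norm (e t) = norm (f t)"
    using smirnovD(3)[OF F] by (auto elim: eventually_elim2)
  obtain G where Q: "outer G Q" using outer_fun_outer[OF assms(4)] .
  note fnz = smirnovD(3)[OF F] and enz = smirnovD(3)[OF outerD(1)[OF e]] and Qnz = smirnovD(3)[OF outerD(1)[OF Q]]
  have fm [measurable]: "f \<in> borel_measurable lebesgue" by (rule smirnovD(5)[OF F])
  have em [measurable]: "e \<in> borel_measurable lebesgue" by (rule smirnovD(5)[OF outerD(1)[OF e]])
  have Qm [measurable]: "Q \<in> borel_measurable lebesgue" by (rule smirnovD(5)[OF outerD(1)[OF Q]])
  \<comment> \<open>Analyticity comes from the Smirnov class, integrability from the modulus alone;
    unimodular factors such as \<open>g\<close> therefore do no harm to the second half.\<close>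
  have in_Hp: "h \<in> Hp_plus p" if "h \<in> smirnov_class" "k \<in> Lp p" "h \<in> borel_measurable lebesgue"
    "AE t in lebesgue. norm (h t) = norm (k t)" for h k
    by (rule smirnov_class_Hp_plus[OF that(1) Lp_dominated[OF that(2) p(3) that(3), of 1] p(2)])
       (use that(4) in \<open>auto elim: eventually_mono\<close>)
  have eHp: "e \<in> Hp_plus p"
    by (rule in_Hp[OF outer_smirnov_class[OF e] Hp_plus_Lp[OF assms(2)] em norm_e])
  define g where "g t = cnj (e t) / f t" for t
  have gm [measurable]: "g \<in> borel_measurable lebesgue" unfolding g_def by measurable
  have ng: "AE t in lebesgue. norm (g t) = 1"
    using norm_e fnz by eventually_elim (simp add: g_def norm_divide)
  have gf: "AE t in lebesgue. g t * f t = cnj (e t)"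
    using fnz by eventually_elim (simp add: g_def)
  define K where "K = toeplitz_ker p g"
  define KQ where "KQ = toeplitz_ker p (\<lambda>t. cnj (Q t) * g t)"
  have cl: "\<eta> \<in> smirnov_class" if "\<eta> \<in> Hp_plus p" for \<eta> by (rule Hp_plus_smirnov_class[OF that p(1)])
  have KD: "\<phi> \<in> K \<longleftrightarrow> \<phi> \<in> Hp_plus p \<and> (\<lambda>t. cnj (g t * \<phi> t)) \<in> Hp_plus p" for \<phi>
    by (simp add: K_def toeplitz_ker_eq Hp_minus_iff)
  \<comment> \<open>Conjugation turns the factor \<open>cnj Q\<close> of the symbol into
    \<open>Q\<close>, by which the Smirnov class can be multiplied and divided.\<close>
  have KQD: "\<phi> \<in> KQ \<longleftrightarrow> \<phi> \<in> Hp_plus p \<and> (\<lambda>t. Q t * cnj (g t * \<phi> t)) \<in> Hp_plus p" for \<phi>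
    by (simp add: KQ_def toeplitz_ker_eq Hp_minus_iff mult.assoc)
  have KQ_eq: "KQ = K \<inter> D_class p Q"
  proof (intro set_eqI iffI)
    fix \<phi> assume "\<phi> \<in> KQ"
    then have \<phi>: "\<phi> \<in> Hp_plus p" and \<eta>: "(\<lambda>t. Q t * cnj (g t * \<phi> t)) \<in> Hp_plus p" by (auto simp: KQD)
    have [measurable]: "\<phi> \<in> borel_measurable lebesgue" by (rule Lp_measurable[OF Hp_plus_Lp[OF \<phi>]])
    have "(\<lambda>t. Q t * cnj (g t * \<phi> t) / Q t) \<in> Hp_plus p"
    proof (rule in_Hp[OF smirnov_class_divide[OF cl[OF \<eta>] Q] Hp_plus_Lp[OF \<phi>]])
      show "AE t in lebesgue. norm (Q t * cnj (g t * \<phi> t) / Q t) = norm (\<phi> t)"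
        using ng Qnz by eventually_elim (simp add: norm_mult)
    qed measurable
    then have "(\<lambda>t. cnj (g t * \<phi> t)) \<in> Hp_plus p"
      by (rule Hp_plus_AE_cong) (use Qnz in \<open>auto elim: eventually_mono\<close>)
    moreover have "(\<lambda>t. Q t * \<phi> t) \<in> Lp p"
    proof (rule Lp_dominated[OF Hp_plus_Lp[OF \<eta>] p(3), of _ 1])
      show "AE t in lebesgue. norm (Q t * \<phi> t) \<le> 1 * norm (Q t * cnj (g t * \<phi> t))"
        using ng by eventually_elim (simp add: norm_mult)
    qed measurable
    ultimately show "\<phi> \<in> K \<inter> D_class p Q" using \<phi> by (simp add: KD D_class_def)
  next
    fix \<phi> assume "\<phi> \<in> K \<inter> D_class p Q"
    then have \<phi>: "\<phi> \<in> Hp_plus p" and \<eta>: "(\<lambda>t. cnj (g t * \<phi> t)) \<in> Hp_plus p" and L: "(\<lambda>t. Q t * \<phi> t) \<in> Lp p"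
      by (auto simp: KD D_class_def)
    have [measurable]: "\<phi> \<in> borel_measurable lebesgue" by (rule Lp_measurable[OF Hp_plus_Lp[OF \<phi>]])
    have "(\<lambda>t. Q t * cnj (g t * \<phi> t)) \<in> Hp_plus p"
    proof (rule in_Hp[OF smirnov_class_mult[OF outer_smirnov_class[OF Q] cl[OF \<eta>]] L])
      show "AE t in lebesgue. norm (Q t * cnj (g t * \<phi> t)) = norm (Q t * \<phi> t)"
        using ng by eventually_elim (simp add: norm_mult)
    qed measurable
    then show "\<phi> \<in> KQ" using \<phi> by (simp add: KQD)
  qed

  \<comment> \<open>One statement for both classes of symbols: \<open>k\<close> is
    \<open>\<phi>\<close> when \<open>h\<close> is bounded, and the product
    \<open>Q t * \<phi> t\<close> when \<open>h\<close> is dominated by \<open>Q\<close>.\<close>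
  have minimal: "\<phi> \<in> toeplitz_ker p h"
    if h: "h \<in> borel_measurable lebesgue" "f \<in> toeplitz_ker p h" and \<phi>: "\<phi> \<in> K"
      and L: "k \<in> Lp p" "AE t in lebesgue. norm (h t * \<phi> t) \<le> c * norm (k t)" for h \<phi> k c
  proof -
    note [measurable] = h(1)
    have \<phi>p: "\<phi> \<in> Hp_plus p" and \<eta>: "(\<lambda>t. cnj (g t * \<phi> t)) \<in> Hp_plus p" using \<phi> by (auto simp: KD)
    have [measurable]: "\<phi> \<in> borel_measurable lebesgue" by (rule Lp_measurable[OF Hp_plus_Lp[OF \<phi>p]])
    have \<psi>: "(\<lambda>t. cnj (h t * f t)) \<in> Hp_plus p" using h(2) by (simp add: toeplitz_ker_eq Hp_minus_iff)
    have eq: "AE t in lebesgue. cnj (h t * f t) * cnj (g t * \<phi> t) / e t = cnj (h t * \<phi> t)"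
      using fnz enz by eventually_elim (simp add: g_def)
    have "(\<lambda>t. cnj (h t * f t) * cnj (g t * \<phi> t) / e t) \<in> Hp_plus p"
    proof (rule smirnov_class_Hp_plus[OF smirnov_class_divide[OF smirnov_class_mult[OF cl[OF \<psi>] cl[OF \<eta>]] e] _ p(2)])
      show "(\<lambda>t. cnj (h t * f t) * cnj (g t * \<phi> t) / e t) \<in> Lp p"
      proof (rule Lp_dominated[OF L(1) p(3)])
        show "AE t in lebesgue. norm (cnj (h t * f t) * cnj (g t * \<phi> t) / e t) \<le> c * norm (k t)"
          using eq L(2) by eventually_elim (simp only: complex_mod_cnj)
      qed measurable
    qed
    then have "(\<lambda>t. cnj (h t * \<phi> t)) \<in> Hp_plus p" by (rule Hp_plus_AE_cong[OF _ eq])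
    then show ?thesis using \<phi>p by (simp add: toeplitz_ker_eq Hp_minus_iff)
  qed
  have fK: "f \<in> K"
  proof -
    have "AE t in lebesgue. e t = cnj (g t * f t)"
      using gf by eventually_elim simp
    from Hp_plus_AE_cong[OF eHp this] show ?thesis using assms(2) by (simp only: KD)
  qed
  have fKQ: "f \<in> KQ"
    using fK assms(2) Hp_plus_Lp[OF assms(6)] by (simp add: KQ_eq D_class_def)
  \<comment> \<open>The function \<open>f\<close> itself witnesses that the domain of the operator
    is nontrivial.\<close>
  have ker_symbol: "toeplitz_symbol p h" if "h \<in> borel_measurable lebesgue" "f \<in> toeplitz_ker p h" for h
    using that assms(2,3) Hp_minus_subset_Lp[of p] by (auto simp: toeplitz_symbol_def toeplitz_ker_eq)
  have "K_min p f = K"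
    unfolding K_min_def
  proof (rule Least_equality)
    have "g \<in> bounded_symbols"
      using ng by (auto simp: bounded_symbols_def elim!: eventually_mono intro!: exI[of _ 1])
    then show "K \<in> toeplitz_kernels p bounded_symbols \<and> f \<in> K"
      using fK ker_symbol[OF gm] unfolding toeplitz_kernels_def K_def by blast
    fix K' assume "K' \<in> toeplitz_kernels p bounded_symbols \<and> f \<in> K'"
    then obtain h C where h: "h \<in> borel_measurable lebesgue" "f \<in> toeplitz_ker p h"
      "AE t in lebesgue. norm (h t) \<le> C" and K': "K' = toeplitz_ker p h"
      unfolding toeplitz_kernels_def bounded_symbols_def by blast
    show "K \<le> K'"
    proof
      fix \<phi> assume \<phi>: "\<phi> \<in> K"
      then have "\<phi> \<in> Lp p" by (simp add: KD Hp_plus_Lp)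
      then show "\<phi> \<in> K'" unfolding K'
        by (rule minimal[OF h(1,2) \<phi>, where c = C])
           (use h(3) in \<open>auto simp: norm_mult elim!: eventually_mono intro: mult_right_mono\<close>)
    qed
  qed
  moreover have "K_min_Q p Q f = KQ"
    unfolding K_min_Q_def
  proof (rule Least_equality)
    \<comment> \<open>The two moduli are equal almost everywhere, while \<open>sigma_symbols\<close>
      asks for a strict inequality; with 2 it holds wherever \<open>Q t \<noteq> 0\<close>.\<close>
    have "AE t in lebesgue. norm (cnj (Q t) * g t) < 2 * norm (Q t)"
      using ng Qnz by eventually_elim (simp add: norm_mult)
    then have "(\<lambda>t. cnj (Q t) * g t) \<in> sigma_symbols Q"
      unfolding sigma_symbols_def by (auto intro!: exI[of _ 2])
    then show "KQ \<in> toeplitz_kernels p (sigma_symbols Q) \<and> f \<in> KQ"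
      using fKQ ker_symbol[of "\<lambda>t. cnj (Q t) * g t"] unfolding toeplitz_kernels_def KQ_def by auto
    fix K' assume "K' \<in> toeplitz_kernels p (sigma_symbols Q) \<and> f \<in> K'"
    then obtain h c where h: "h \<in> borel_measurable lebesgue" "f \<in> toeplitz_ker p h"
      "AE t in lebesgue. norm (h t) < c * norm (Q t)" and K': "K' = toeplitz_ker p h"
      unfolding toeplitz_kernels_def sigma_symbols_def by blast
    show "KQ \<le> K'"
    proof
      fix \<phi> assume "\<phi> \<in> KQ"
      then have \<phi>: "\<phi> \<in> K" and L: "(\<lambda>t. Q t * \<phi> t) \<in> Lp p" by (auto simp: KQ_eq D_class_def)
      show "\<phi> \<in> K'" unfolding K'
      proof (rule minimal[OF h(1,2) \<phi> L])
        show "AE t in lebesgue. norm (h t * \<phi> t) \<le> c * norm (Q t * \<phi> t)"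
          using h(3)
        proof eventually_elim
          case (elim t)
          then have "norm (h t) * norm (\<phi> t) \<le> (c * norm (Q t)) * norm (\<phi> t)" by (intro mult_right_mono) auto
          then show ?case by (simp add: norm_mult mult.assoc)
        qed
      qed
    qed
  qed
  ultimately show ?thesis using KQ_eq by simp
qed

end
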